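(* Let $d,c\in\mathbb{N}$ and let $\mathbf G$ be a $c$-colored weakly treeable graphing with maximum degree at most $d$. Then there exists a sequence $(G_n)_{n\in\mathbb{N}}$ of finite $c$-colored graphs with maximum degree at most $d$ that converges locally to $\mathbf G$, i.e. such that for every $r\in\mathbb{N}$ and every $t\in\mathcal G^{d,c}_r$, $$\lim_{n\to\infty}\Pr\bigl[B_r(G_n,X_n)\simeq t\bigr]=\Pr\bigl[B_r(\mathbf G,X)\simeq t\bigr],$$ where $X_n$ is a uniformly random vertex of $G_n$ and $X$ is a random vertex of $\mathbf G$ distributed according to the probability measure of $\mathbf G$.
   Context: Graphs are simple and undirected. Let $V$ be a standard Borel space endowed with an atomless probability measure $\lambda$. A Borel graph on $V$ is a graph with vertex set $V$ whose edge set is a Borel subset of $V\times V$. A graphing is a Borel graph $\mathbf G$ on such a space $(V,\lambda)$, with maximum degree at most $d$ for some $d\in\mathbb{N}$, such that for all measurable $A,B\subseteq V$, $$\int_A \deg_B(x)\,d\lambda(x)=\int_B\deg_A(x)\,d\lambda(x),$$ where $\deg_B(x)$ is the number of neighbors of $x$ in $B$. A treeing is an acyclic graphing (all graphings and treeings thus have uniformly bounded degree). A graphing $\mathbf G$ with vertex set $V$ and measure $\nu$ is weakly treeable if there exists a treeing $\mathbf T$, with vertex set $W$ and measure $\lambda$, such that $V$ is a Borel subset of $W$ with $\lambda(V)>0$, and every connected component of $\mathbf G$ is included in a connected component of $\mathbf T$. Here $\nu$ is understood to be the normalized restriction of $\lambda$ to $V$, i.e. $\nu(Y)=\lambda(Y)/\lambda(V)$.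 A $c$-colored graph is a graph with an arbitrary (not necessarily proper) map from its vertices to $\{1,\dots,c\}$; a $c$-colored graphing is a graphing with a measurable such map. The ball $B_r(G,v)$ is the (colored) subgraph of $G$ induced by the vertices at distance at most $r$ from $v$, rooted at $v$. $\mathcal G^{d,c}_r$ is the set of isomorphism types of $c$-colored rooted graphs with maximum degree at most $d$ in which every vertex is at distance at most $r$ from the root; isomorphisms preserve roots and colors, and $B\simeq t$ means that $B$ has isomorphism type $t$. *)

theory Defs
  imports "HOL-Probability.Probability"
begin

section \<open>Graphs\<close>

definition simple_graph :: "'v set \<Rightarrow> 'v rel \<Rightarrow> bool" where
  "simple_graph V E \<longleftrightarrow> E \<subseteq> V \<times> V \<and> sym E \<and> irrefl E"

definition max_degree_le :: "'v set \<Rightarrow> 'v rel \<Rightarrow> nat \<Rightarrow> bool" where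
  "max_degree_le V E d \<longleftrightarrow> (\<forall>x\<in>V. finite (E `` {x}) \<and> card (E `` {x}) \<le> d)"

definition is_cycle :: "'v rel \<Rightarrow> 'v list \<Rightarrow> bool" where
  "is_cycle E xs \<longleftrightarrow> 3 \<le> length xs \<and> distinct xs \<and>
     (\<forall>i<length xs. (xs ! i, xs ! (Suc i mod length xs)) \<in> E)"

definition acyclic_graph :: "'v rel \<Rightarrow> bool" where
  "acyclic_graph E \<longleftrightarrow> (\<nexists>xs. is_cycle E xs)"

definition conn_components :: "'v set \<Rightarrow> 'v rel \<Rightarrow> 'v set set" where
  "conn_components V E = (\<lambda>x. E\<^sup>* `` {x}) ` V"

section \<open>Graphings\<close>

definition standard_borel :: "'v measure \<Rightarrow> bool" where
  "standard_borel M \<longleftrightarrow> (\<exists>X. topspace X = space M \<and> completely_metrizable_space X \<and>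
     second_countable X \<and> sets M = sigma_sets (space M) {U. openin X U})"

definition atomless :: "'v measure \<Rightarrow> bool" where
  "atomless M \<longleftrightarrow> (\<forall>A\<in>sets M. 0 < emeasure M A \<longrightarrow>
     (\<exists>B\<in>sets M. B \<subseteq> A \<and> 0 < emeasure M B \<and> emeasure M B < emeasure M A))"

definition deg_in :: "'v rel \<Rightarrow> 'v set \<Rightarrow> 'v \<Rightarrow> nat" where
  "deg_in E B x = card (E `` {x} \<inter> B)"

definition borel_graph :: "'v measure \<Rightarrow> 'v rel \<Rightarrow> bool" where
  "borel_graph M E \<longleftrightarrow> standard_borel M \<and> simple_graph (space M) E \<and> E \<in> sets (M \<Otimes>\<^sub>M M)"

(* The degree functions are nonnegative, and in a bounded-degree Borel graph they are Borel,
   so the nonnegative integral below is the usual Lebesgue integral. *)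
definition graphing :: "'v measure \<Rightarrow> 'v rel \<Rightarrow> bool" where
  "graphing M E \<longleftrightarrow> prob_space M \<and> atomless M \<and> borel_graph M E \<and>
     (\<exists>d. max_degree_le (space M) E d) \<and>
     (\<forall>A\<in>sets M. \<forall>B\<in>sets M.
        (\<integral>\<^sup>+x\<in>A. of_nat (deg_in E B x) \<partial>M) = (\<integral>\<^sup>+x\<in>B. of_nat (deg_in E A x) \<partial>M))"

definition treeing :: "'v measure \<Rightarrow> 'v rel \<Rightarrow> bool" where
  "treeing M E \<longleftrightarrow> graphing M E \<and> acyclic_graph E"

(* The treeing lives on a space L over its own type 'w, so that the type of the vertices of the
   graphing puts no restriction on L. The map e identifies the vertex set of the graphing, with
   its Borel structure, with a Borel subset of L; when 'w = 'v one can take e to be the inclusion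
   of a Borel subset. Since 'w occurs only in the existentially quantified L, T and e, it has to
   be a parameter. *)
definition weakly_treeable :: "'w itself \<Rightarrow> 'v measure \<Rightarrow> 'v rel \<Rightarrow> bool" where
  "weakly_treeable (_ :: 'w itself) M E \<longleftrightarrow>
     (\<exists>(L :: 'w measure) T e. treeing L T \<and>
        inj_on e (space M) \<and> e \<in> measurable M L \<and> (\<forall>Y\<in>sets M. e ` Y \<in> sets L) \<and>
        measure L (e ` space M) > 0 \<and>
        (\<forall>Y\<in>sets M. measure M Y = measure L (e ` Y) / measure L (e ` space M)) \<and>
        (\<forall>C\<in>conn_components (space M) E. \<exists>D\<in>conn_components (space L) T. e ` C \<subseteq> D))"

section \<open>Colored graphs and local convergence\<close>

record 'v cgraph =
  verts :: "'v set"
  edges :: "'v rel"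
  color :: "'v \<Rightarrow> nat"

definition colored_graph :: "nat \<Rightarrow> 'v cgraph \<Rightarrow> bool" where
  "colored_graph c G \<longleftrightarrow> simple_graph (verts G) (edges G) \<and> color G ` verts G \<subseteq> {1..c}"

definition graph_ball :: "nat \<Rightarrow> 'v cgraph \<Rightarrow> 'v \<Rightarrow> 'v cgraph" where
  "graph_ball r G v =
     (let B = {u \<in> verts G. \<exists>k\<le>r. (v, u) \<in> edges G ^^ k}
      in \<lparr>verts = B, edges = edges G \<inter> B \<times> B, color = color G\<rparr>)"

(* A rooted graph is a pair of a colored graph and its root. *)
definition rooted_iso :: "'v cgraph \<times> 'v \<Rightarrow> 'w cgraph \<times> 'w \<Rightarrow> bool" where
  "rooted_iso = (\<lambda>(G, v) (H, w). \<exists>f. bij_betw f (verts G) (verts H) \<and> f v = w \<and>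
     (\<forall>x\<in>verts G. \<forall>y\<in>verts G. (x, y) \<in> edges G \<longleftrightarrow> (f x, f y) \<in> edges H) \<and>
     (\<forall>x\<in>verts G. color H (f x) = color G x))"

(* Isomorphism types are given by representatives. Vertices in nat suffice, because a rooted graph
   of bounded degree and bounded radius is finite. *)
definition ball_types :: "nat \<Rightarrow> nat \<Rightarrow> nat \<Rightarrow> (nat cgraph \<times> nat) set" where
  "ball_types d c r = {(H, w). colored_graph c H \<and> max_degree_le (verts H) (edges H) d \<and>
     w \<in> verts H \<and> (\<forall>u\<in>verts H. \<exists>k\<le>r. (w, u) \<in> edges H ^^ k)}"

definition colored_graphing :: "nat \<Rightarrow> 'v measure \<Rightarrow> 'v rel \<Rightarrow> ('v \<Rightarrow> nat) \<Rightarrow> bool" where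
  "colored_graphing c M E \<kappa> \<longleftrightarrow> graphing M E \<and> \<kappa> \<in> measurable M (count_space {1..c})"

definition locally_converges ::
  "nat \<Rightarrow> nat \<Rightarrow> (nat \<Rightarrow> 'u cgraph) \<Rightarrow> 'v measure \<Rightarrow> 'v rel \<Rightarrow> ('v \<Rightarrow> nat) \<Rightarrow> bool" where
  "locally_converges d c G M E \<kappa> \<longleftrightarrow>
     (let \<G> = \<lparr>verts = space M, edges = E, color = \<kappa>\<rparr> in
      \<forall>r. \<forall>t\<in>ball_types d c r.
        (\<lambda>n. measure_pmf.prob (pmf_of_set (verts (G n)))
               {x. rooted_iso (graph_ball r (G n) x, x) t})
        \<longlonglongrightarrow> measure M {x \<in> space M. rooted_iso (graph_ball r \<G> x, x) t})"

end

theory Submission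
  imports Defs "HOL-Library.Nat_Bijection" "HOL-Analysis.Kronecker_Approximation_Theorem"
begin

text \<open>
  Delete from the treeing \<open>T\<close> the small set of vertices around which a fine finite Borel partition
  is not injective on the \<open>N\<close>-ball, and keep only the edges of the given graph that join points at
  bounded distance in what remains. Up to small measure this changes nothing, and now an edge can be
  recorded by a finite label: each vertex stores its part, its colour and the parts of its neighbours.
  It remains to approximate a finitely labelled treeing. The frequencies of the stars (the
  colour-refinement type of a vertex together with those of its neighbours) satisfy the balance
  equations given by mass transport. Dirichlet's simultaneous approximation theorem yields nearby
  integer solutions, and such a solution is realised by a finite graph, obtained by matching
  half-edges. A short closed walk in the finite graph lifts to a walk in \<open>T\<close> that is closed, because
  the labels are injective on balls, and hence backtracks; so the finite graph has the same labelled
  balls as \<open>T\<close>, and decoding the labels gives the required finite coloured graphs.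

  Since the vertex spaces carry Borel rather than completed measures, all measurability statements
  rest on the Lusin--Novikov theorem for Borel relations with sections of bounded size.
\<close>

section \<open>Analytic sets and the Lusin--Novikov theorem\<close>

text \<open>An edge of the given graph may join points that are arbitrarily far apart in
  \<open>T\<close>, and \<open>T\<close> may connect them through points outside the given vertex
  set. Hence there are two truncations in a fixed order: first a length bound \<open>R\<close> that
  loses few edges, then, for a radius \<open>N\<close> of order \<open>r * R\<close> dictated by it,
  a partition that is injective on most \<open>N\<close>-balls. Every point sees only finitely many
  points and edges within bounded distance, so it escapes both exceptional sets in the limit, and
  their measures become small. Points outside the vertex set stay in the finite model with colour
  \<open>0\<close>; conditioning on the other colours comes last.

  Injectivity of the parts serves twice more besides the lifting of closed walks: the types of the
  neighbours of a vertex form a set rather than a multiset, so degrees towards a type are 0 or 1,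
  and a listed part determines the far end of a coded edge. Vertices are glued by their types of
  depth \<open>N\<close>, whereas a star is a type of depth \<open>N + 1\<close>; the balance
  equations are therefore indexed by pairs of types of depth \<open>N\<close>.\<close>

definition analytic :: "'a::topological_space set \<Rightarrow> bool" where
  "analytic A \<longleftrightarrow> (\<exists>C :: ('a \<times> (nat \<Rightarrow> nat)) set. closed C \<and> A = fst ` C)"

lemma analytic_closed: "closed A \<Longrightarrow> analytic A"
  unfolding analytic_def
  by (rule exI[of _ "A \<times> UNIV"]) (auto simp: closed_Times image_iff)

lemma tendsto_coordinatewise:
  fixes f :: "nat \<Rightarrow> 'i \<Rightarrow> 'a::topological_space"
  assumes "\<And>i. (\<lambda>n. f n i) \<longlonglongrightarrow> l i"
  shows "f \<longlonglongrightarrow> l"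
proof -
  have "limitin (product_topology (\<lambda>i. euclidean) UNIV) f l sequentially"
    using assms by (simp add: limitin_componentwise)
  then show ?thesis by (simp add: euclidean_product_topology limitin_canonical_iff)
qed

lemma closed_discrete: "closed (A :: 'a::discrete_topology set)"
  by (simp add: closed_def Topological_Spaces.open_discrete)

lemma closed_Collect_mem:
  assumes "closed C" "continuous_on UNIV f"
  shows "closed {z. f z \<in> C}"
  using closed_vimage[OF assms] by (simp add: vimage_def)

text \<open>The first entry of the witness sequence names the index \<open>n\<close>, the rest is a
  witness for \<open>A n\<close>. Closedness survives because the first entry takes discrete
  values.\<close>

lemma analytic_UN:
  fixes A :: "nat \<Rightarrow> 'a::topological_space set"
  assumes "\<And>n. analytic (A n)"
  shows "analytic (\<Union>n. A n)"
proof -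
  obtain C where C: "\<And>n. closed (C n)" "\<And>n. A n = fst ` (C n :: ('a \<times> (nat \<Rightarrow> nat)) set)"
    using assms unfolding analytic_def by metis
  let ?C = "{z :: 'a \<times> (nat \<Rightarrow> nat). (fst z, \<lambda>n. snd z (Suc n)) \<in> C (snd z 0)}"
  have eq: "?C = (\<Inter>k. {z. snd z 0 \<in> - {k}} \<union> {z. (fst z, \<lambda>n. snd z (Suc n)) \<in> C k})"
    by auto
  have "closed ?C"
    unfolding eq
    by (intro closed_INT ballI closed_Un closed_Collect_mem C continuous_intros
        continuous_on_coordinatewise_then_product
        continuous_on_product_then_coordinatewise)
      (auto simp: Topological_Spaces.open_discrete closed_def)
  moreover have "(\<Union>n. A n) = fst ` ?C"
  proof (intro set_eqI iffI)
    fix x assume "x \<in> (\<Union>n. A n)"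
    then obtain n f where "(x, f) \<in> C n" using C(2) by auto
    then have "(x, case_nat n f) \<in> ?C" by simp
    then show "x \<in> fst ` ?C" by (metis (no_types, lifting) fst_conv image_eqI)
  qed (use C(2) in force)
  ultimately show ?thesis unfolding analytic_def by blast
qed

text \<open>One sequence carries the witnesses for all \<open>A n\<close> at once, interleaved by
  \<open>prod_encode\<close>.\<close>

lemma analytic_INT:
  fixes A :: "nat \<Rightarrow> 'a::topological_space set"
  assumes "\<And>n. analytic (A n)"
  shows "analytic (\<Inter>n. A n)"
proof -
  obtain C where C: "\<And>n. closed (C n)" "\<And>n. A n = fst ` (C n :: ('a \<times> (nat \<Rightarrow> nat)) set)"
    using assms unfolding analytic_def by metis
  let ?C = "{z :: 'a \<times> (nat \<Rightarrow> nat). \<forall>n. (fst z, \<lambda>k. snd z (prod_encode (n, k))) \<in> C n}"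
  have eq: "?C = (\<Inter>n. {z. (fst z, \<lambda>k. snd z (prod_encode (n, k))) \<in> C n})"
    by auto
  have "closed ?C"
    unfolding eq
    by (intro closed_INT ballI closed_Collect_mem C continuous_intros
        continuous_on_coordinatewise_then_product
        continuous_on_product_then_coordinatewise)
  moreover have "(\<Inter>n. A n) = fst ` ?C"
  proof (intro set_eqI iffI)
    fix x assume "x \<in> (\<Inter>n. A n)"
    then have "\<exists>f. (x, f) \<in> C n" for n using C(2)[of n] by force
    then obtain f where "\<And>n. (x, f n) \<in> C n" by metis
    then have "(x, \<lambda>m. f (fst (prod_decode m)) (snd (prod_decode m))) \<in> ?C" by simp
    then show "x \<in> fst ` ?C" by (metis (no_types, lifting) fst_conv image_eqI)
  qed (use C(2) in force)
  ultimately show ?thesis unfolding analytic_def by blast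
qed

lemma analytic_Int: "analytic A \<Longrightarrow> analytic B \<Longrightarrow> analytic (A \<inter> B)"
proof -
  assume "analytic A" "analytic B"
  then have "analytic (\<Inter>n::nat. if n = 0 then A else B)" by (intro analytic_INT) auto
  moreover have "(\<Inter>n::nat. if n = 0 then A else B) = A \<inter> B"
    by (auto split: if_splits)
  ultimately show ?thesis by simp
qed

lemma analytic_INT_finite:
  assumes "finite I" "\<And>i. i \<in> I \<Longrightarrow> analytic (A i)"
  shows "analytic (\<Inter>i\<in>I. A i)"
  using assms by (induction I rule: finite_induct) (auto intro: analytic_Int analytic_closed)

text \<open>The new witness holds a preimage of the point on its even places and the old witness for
  that preimage on its odd ones. The condition is closed because the graph of a continuous
  \<open>g\<close> is closed.\<close>

lemma analytic_image:
  fixes A :: "(nat \<Rightarrow> nat) set" and g :: "(nat \<Rightarrow> nat) \<Rightarrow> nat \<Rightarrow> nat"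
  assumes "analytic A" and g: "continuous_on UNIV g"
  shows "analytic (g ` A)"
proof -
  obtain C where C: "closed C" "A = fst ` (C :: ((nat \<Rightarrow> nat) \<times> (nat \<Rightarrow> nat)) set)"
    using assms unfolding analytic_def by metis
  let ?C = "{z :: (nat \<Rightarrow> nat) \<times> (nat \<Rightarrow> nat).
     (\<lambda>n. snd z (2 * n), \<lambda>n. snd z (Suc (2 * n))) \<in> C} \<inter> {z. fst z = g (\<lambda>n. snd z (2 * n))}"
  have 1: "continuous_on UNIV (\<lambda>z :: (nat \<Rightarrow> nat) \<times> (nat \<Rightarrow> nat). (\<lambda>n. snd z (2 * n)))"
    by (intro continuous_intros continuous_on_coordinatewise_then_product
        continuous_on_product_then_coordinatewise)
  have 2: "continuous_on UNIV (\<lambda>z :: (nat \<Rightarrow> nat) \<times> (nat \<Rightarrow> nat). (\<lambda>n. snd z (Suc (2 * n))))"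
    by (intro continuous_intros continuous_on_coordinatewise_then_product
        continuous_on_product_then_coordinatewise)
  have 3: "continuous_on UNIV (\<lambda>z :: (nat \<Rightarrow> nat) \<times> (nat \<Rightarrow> nat). g (\<lambda>n. snd z (2 * n)))"
    by (rule continuous_on_compose2[OF g 1]) simp
  have "closed {z :: (nat \<Rightarrow> nat) \<times> (nat \<Rightarrow> nat). fst z = g (\<lambda>n. snd z (2 * n))}"
  proof -
    have "{z :: (nat \<Rightarrow> nat) \<times> (nat \<Rightarrow> nat). fst z = g (\<lambda>n. snd z (2 * n))} =
        (\<Inter>i. {z. fst z i = g (\<lambda>n. snd z (2 * n)) i})"
      by (auto simp: fun_eq_iff)
    moreover have "closed {z :: (nat \<Rightarrow> nat) \<times> (nat \<Rightarrow> nat). fst z i = g (\<lambda>n. snd z (2 * n)) i}" for i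
      by (intro closed_Collect_eq continuous_on_product_then_coordinatewise[OF 3]
        continuous_on_product_then_coordinatewise[OF continuous_on_fst[OF continuous_on_id]])
    ultimately show ?thesis by (simp only:) (intro closed_INT ballI)
  qed
  then have "closed ?C"
    by (intro closed_Int closed_Collect_mem C continuous_on_Pair 1 2)
  moreover have "g ` A = fst ` ?C"
  proof (intro set_eqI iffI)
    fix x assume "x \<in> g ` A"
    then obtain y f where y: "(y, f) \<in> C" "x = g y" using C(2) by auto
    let ?h = "\<lambda>n. if even n then y (n div 2) else f (n div 2)"
    have "(x, ?h) \<in> ?C" using y by simp
    then show "x \<in> fst ` ?C" by (metis (no_types, lifting) fst_conv image_eqI)
  next
    fix x assume "x \<in> fst ` ?C"
    then obtain z where "x = g (\<lambda>n. snd z (2 * n))" "(\<lambda>n. snd z (2 * n), \<lambda>n. snd z (Suc (2 * n))) \<in> C"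
      by auto
    then show "x \<in> g ` A" using C(2) by force
  qed
  ultimately show ?thesis unfolding analytic_def by blast
qed

abbreviation baire :: "(nat \<Rightarrow> nat) measure" where
  "baire \<equiv> \<Pi>\<^sub>M i\<in>UNIV. count_space UNIV"

text \<open>Complements of analytic sets need not be analytic, so the induction over Borel sets
  carries each set together with its complement. It starts because cylinders are clopen.\<close>

lemma analytic_sets_baire:
  assumes "A \<in> sets baire"
  shows "analytic A"
proof -
  have "A \<in> sigma_sets UNIV {{f. f i \<in> B} | (i::nat) (B :: nat set). True}"
    using assms unfolding sets_PiM_single by simp
  then have "analytic A \<and> analytic (- A)"
  proof induction
    case (Basic a)
    then obtain i B where a: "a = {f. f i \<in> B}" by auto
    have cl: "closed {f :: nat \<Rightarrow> nat. f i \<in> B'}" for B'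
      using closed_vimage[OF closed_discrete[of B'] continuous_on_product_coordinates[of i]]
      by (simp add: vimage_def)
    have "- a = {f. f i \<in> - B}" using a by auto
    then show ?case using cl[of B] cl[of "- B"] a by (metis analytic_closed)
  next
    case Empty
    then show ?case by (auto intro: analytic_closed)
  next
    case (Compl a)
    then show ?case by (simp add: Compl_eq_Diff_UNIV[symmetric])
  next
    case (Union a)
    then show ?case by (auto intro: analytic_UN analytic_INT simp: Compl_UN)
  qed
  then show ?thesis ..
qed

lemma cylinder_in_baire: "{x. P (x i)} \<in> sets baire"
proof -
  have "{x \<in> space baire. P (x i)} \<in> sets baire"
    by measurable
  then show ?thesis by (simp add: space_PiM)
qed

section \<open>Borel separation of disjoint analytic sets\<close>

definition separable_in :: "'a measure \<Rightarrow> 'a set \<Rightarrow> 'a set \<Rightarrow> bool" where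
  "separable_in M A B \<longleftrightarrow> (\<exists>C\<in>sets M. A \<subseteq> C \<and> B \<inter> C = {})"

lemma separable_in_UN:
  assumes "\<And>(i::nat) (j::nat). separable_in M (A i) (B j)"
  shows "separable_in M (\<Union>i. A i) (\<Union>j. B j)"
proof -
  obtain C where C: "\<And>i j. C i j \<in> sets M" "\<And>i j. A i \<subseteq> C i j" "\<And>i j. B j \<inter> C i j = {}"
    using assms unfolding separable_in_def by metis
  have "(\<Union>i. \<Inter>j. C i j) \<in> sets M" using C(1) by auto
  moreover have "(\<Union>i. A i) \<subseteq> (\<Union>i. \<Inter>j. C i j)" using C(2) by blast
  moreover have "(\<Union>j. B j) \<inter> (\<Union>i. \<Inter>j. C i j) = {}" using C(3) by blast
  ultimately show ?thesis unfolding separable_in_def by blast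
qed

text \<open>Otherwise nested cylinders around \<open>z\<close> and \<open>w\<close> stay inseparable; then \<open>fst z = fst w\<close>,
  and by closedness this point lies in both sets.\<close>

lemma analytic_separable:
  fixes A B :: "(nat \<Rightarrow> nat) set"
  assumes "analytic A" "analytic B" "A \<inter> B = {}"
  shows "separable_in baire A B"
proof (rule ccontr)
  assume nsep: "\<not> ?thesis"
  obtain C D :: "((nat \<Rightarrow> nat) \<times> (nat \<Rightarrow> nat)) set"
    where C: "closed C" "A = fst ` C" and D: "closed D" "B = fst ` D"
    using assms unfolding analytic_def by metis
  define K :: "nat \<Rightarrow> (nat \<Rightarrow> nat) \<times> (nat \<Rightarrow> nat) \<Rightarrow> ((nat \<Rightarrow> nat) \<times> (nat \<Rightarrow> nat)) set"
    where "K n z = {v. \<forall>i<n. fst v i = fst z i \<and> snd v i = snd z i}" for n z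
  \<comment> \<open>The number \<open>k\<close> codes the entries of both components at place
    \<open>n\<close>, so a cylinder of length \<open>n\<close> splits into countably many of length
    \<open>n + 1\<close>, as \<open>separable_in_UN\<close> requires.\<close>
  define upd :: "nat \<Rightarrow> (nat \<Rightarrow> nat) \<times> (nat \<Rightarrow> nat) \<Rightarrow> nat \<Rightarrow> (nat \<Rightarrow> nat) \<times> (nat \<Rightarrow> nat)"
    where "upd n z k = ((fst z)(n := fst (prod_decode k)), (snd z)(n := snd (prod_decode k)))" for n z k
  have Kup: "K n z = (\<Union>k. K (Suc n) (upd n z k))" for n z
  proof (intro set_eqI iffI)
    fix v assume "v \<in> K n z"
    then have "v \<in> K (Suc n) (upd n z (prod_encode (fst v n, snd v n)))"
      by (auto simp: K_def upd_def less_Suc_eq)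
    then show "v \<in> (\<Union>k. K (Suc n) (upd n z k))" by blast
  qed (auto simp: K_def upd_def less_Suc_eq split: if_splits)
  let ?N = "\<lambda>n z w. \<not> separable_in baire (fst ` (C \<inter> K n z)) (fst ` (D \<inter> K n w))"
  have step: "\<exists>k l. ?N (Suc n) (upd n z k) (upd n w l)" if "?N n z w" for n z w
  proof (rule ccontr)
    assume "\<not> ?thesis"
    then have "separable_in baire (\<Union>k. fst ` (C \<inter> K (Suc n) (upd n z k)))
       (\<Union>l. fst ` (D \<inter> K (Suc n) (upd n w l)))"
      by (intro separable_in_UN) auto
    moreover have "(\<Union>k. fst ` (C \<inter> K (Suc n) (upd n z k))) = fst ` (C \<inter> K n z)"
      unfolding Kup[of n z] by blast
    moreover have "(\<Union>l. fst ` (D \<inter> K (Suc n) (upd n w l))) = fst ` (D \<inter> K n w)"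
      unfolding Kup[of n w] by blast
    ultimately show False using that by simp
  qed
  define P where "P n q = ?N n (fst q) (snd q)" for n q
  define Q where "Q n q q' = (\<exists>k l. q' = (upd n (fst q) k, upd n (snd q) l))" for n q q'
  have "P 0 (undefined, undefined)"
    using nsep C D by (simp add: P_def K_def)
  moreover have "\<exists>q'. P (Suc n) q' \<and> Q n q q'" if "P n q" for n q
  proof -
    obtain k l where "?N (Suc n) (upd n (fst q) k) (upd n (snd q) l)"
      using step \<open>P n q\<close> unfolding P_def by blast
    then show ?thesis
      by (intro exI[of _ "(upd n (fst q) k, upd n (snd q) l)"]) (auto simp: P_def Q_def)
  qed
  ultimately obtain s where s: "\<And>n. P n (s n)" "\<And>n. Q n (s n) (s (Suc n))"
    using dependent_nat_choice[of P Q] by blast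
  \<comment> \<open>Stage \<open>n\<close> changes only place \<open>n\<close>. Entries at place
    \<open>i\<close> are thus final from stage \<open>Suc i\<close> on, and the diagonal gives the
    limits \<open>z\<close> and \<open>w\<close>.\<close>
  have st1: "fst (fst (s m)) i = fst (fst (s (Suc i))) i \<and> snd (fst (s m)) i = snd (fst (s (Suc i))) i \<and>
     fst (snd (s m)) i = fst (snd (s (Suc i))) i \<and> snd (snd (s m)) i = snd (snd (s (Suc i))) i"
    if "i < m" for i m
    using that
  proof (induction m)
    case (Suc m)
    show ?case
    proof (cases "i = m")
      case False
      then show ?thesis using Suc s(2)[of m] by (auto simp: Q_def upd_def)
    qed simp
  qed simp
  define z where "z = (\<lambda>i. fst (fst (s (Suc i))) i, \<lambda>i. snd (fst (s (Suc i))) i)"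
  define w where "w = (\<lambda>i. fst (snd (s (Suc i))) i, \<lambda>i. snd (snd (s (Suc i))) i)"
  have zw: "fst (fst (s n)) i = fst z i" "snd (fst (s n)) i = snd z i"
    "fst (snd (s n)) i = fst w i" "snd (snd (s n)) i = snd w i" if "i < n" for i n
    using st1[OF that] unfolding z_def w_def fst_conv snd_conv by auto
  have "K n (fst (s n)) = K n z" "K n (snd (s n)) = K n w" for n
    by (simp_all add: K_def zw cong: conj_cong)
  then have N: "?N n z w" for n using s(1)[of n] by (simp add: P_def)
  have mem: "v \<in> F" if F: "closed F" "\<And>n. F \<inter> K n v \<noteq> {}" for F v
  proof -
    have "\<exists>u. u \<in> F \<and> u \<in> K n v" for n using F(2)[of n] by auto
    then obtain u where u: "\<And>n. u n \<in> F" "\<And>n. u n \<in> K n v" by metis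
    have ev: "\<forall>\<^sub>F n in sequentially. fst (u n) i = fst v i \<and> snd (u n) i = snd v i" for i
      unfolding eventually_sequentially
    proof (intro exI[of _ "Suc i"] allI impI)
      fix n assume "Suc i \<le> n"
      then show "fst (u n) i = fst v i \<and> snd (u n) i = snd v i" using u(2)[of n] by (auto simp: K_def)
    qed
    have "(\<lambda>n. fst (u n)) \<longlonglongrightarrow> fst v"
      by (rule tendsto_coordinatewise, rule tendsto_eventually, rule eventually_mono[OF ev], erule conjunct1)
    moreover have "(\<lambda>n. snd (u n)) \<longlonglongrightarrow> snd v"
      by (rule tendsto_coordinatewise, rule tendsto_eventually, rule eventually_mono[OF ev], erule conjunct2)
    ultimately have "(\<lambda>n. (fst (u n), snd (u n))) \<longlonglongrightarrow> (fst v, snd v)" by (rule tendsto_Pair)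
    then show ?thesis
      using Lim_in_closed_set[OF F(1), of u sequentially v] u(1) by auto
  qed
  have emp: "separable_in baire {} X" "separable_in baire Y {}" for X Y
    using sets.top[of baire] unfolding separable_in_def
    by (auto simp: space_PiM intro: bexI[of _ "{}"])
  have "z \<in> C" by (rule mem[OF C(1)]) (use N emp in \<open>metis image_empty\<close>)
  moreover have "w \<in> D" by (rule mem[OF D(1)]) (use N emp in \<open>metis image_empty\<close>)
  moreover have "fst z = fst w"
  proof (rule ccontr)
    assume "fst z \<noteq> fst w"
    then obtain i where i: "fst z i \<noteq> fst w i" by auto
    have "separable_in baire (fst ` (C \<inter> K (Suc i) z)) (fst ` (D \<inter> K (Suc i) w))"
      unfolding separable_in_def
      by (rule bexI[of _ "{x. x i = fst z i}"]) (use i cylinder_in_baire in \<open>auto simp: K_def\<close>)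
    then show False using N by blast
  qed
  ultimately show False using assms(3) C(2) D(2) by (metis disjoint_iff image_eqI)
qed

text \<open>A point is coded by indices of members of a dense sequence that approximate it at speed
  \<open>(1/2)^n\<close>, and decoded by taking the limit. Such a retraction is weaker than a Borel
  isomorphism with Baire space, but it suffices for moving Borel statements back and forth.\<close>

lemma standard_borel_retract:
  assumes "standard_borel M" "space M \<noteq> {}"
  obtains \<psi> \<phi> where "\<psi> \<in> measurable M baire" "\<phi> \<in> measurable baire M"
    "\<And>x. x \<in> space M \<Longrightarrow> \<phi> (\<psi> x) = x"
proof -
  obtain X where X: "topspace X = space M" "completely_metrizable_space X" "second_countable X"
    "sets M = sigma_sets (space M) {U. openin X U}"
    using assms(1) unfolding standard_borel_def by blast
  obtain S d where "Metric_space S d" and compl: "Metric_space.mcomplete S d"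
    and Xm: "X = Metric_space.mtopology S d"
    using X(2) unfolding completely_metrizable_space_def by blast
  then interpret Metric_space S d by simp
  have S: "space M = S" using X(1) Xm by simp
  have open_sets: "U \<in> sets M" if "openin mtopology U" for U
    using that X(4) Xm by auto
  obtain \<B> where \<B>: "countable \<B>" "\<And>V. V \<in> \<B> \<Longrightarrow> openin mtopology V"
    "\<And>U x. openin mtopology U \<Longrightarrow> x \<in> U \<Longrightarrow> \<exists>V\<in>\<B>. x \<in> V \<and> V \<subseteq> U"
    using X(3) Xm unfolding second_countable_def by metis
  obtain x0 where x0: "x0 \<in> S" using assms(2) S by auto
  define P where "P = insert x0 ((\<lambda>V. SOME x. x \<in> V) ` (\<B> - {{}}))"
  have P: "countable P" "P \<noteq> {}" using \<B>(1) by (auto simp: P_def)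
  define a where "a = from_nat_into P"
  have PS: "P \<subseteq> S"
  proof
    fix y assume "y \<in> P"
    then consider "y = x0" | V where "V \<in> \<B>" "V \<noteq> {}" "y = (SOME x. x \<in> V)" by (auto simp: P_def)
    then show "y \<in> S"
    proof cases
      case 2
      then have "y \<in> V" by (simp add: some_in_eq)
      then show ?thesis using openin_subset[OF \<B>(2)[OF 2(1)]] by auto
    qed (use x0 in simp)
  qed
  then have aS: "a n \<in> S" for n using from_nat_into[OF P(2)] by (auto simp: a_def)
  have dense: "\<exists>n. d x (a n) < e" if "x \<in> S" "e > 0" for x e
  proof -
    have "openin mtopology (mball x e)" "x \<in> mball x e" using that by auto
    then obtain V where V: "V \<in> \<B>" "x \<in> V" "V \<subseteq> mball x e" using \<B>(3) by blast
    then have "(SOME x. x \<in> V) \<in> V" "(SOME x. x \<in> V) \<in> P"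
      by (auto simp: P_def some_in_eq)
    then obtain n where "a n \<in> V" using from_nat_into_surj[OF P(1)] a_def by metis
    then have "a n \<in> mball x e" using V by blast
    then show ?thesis by (intro exI[of _ n]) simp
  qed
  define \<epsilon> :: "nat \<Rightarrow> real" where "\<epsilon> n = (1/2)^n" for n
  have \<epsilon>: "\<epsilon> n > 0" for n by (simp add: \<epsilon>_def)
  have \<epsilon>0: "\<exists>N. \<forall>n\<ge>N. 3 * \<epsilon> n < e" if "e > 0" for e
  proof -
    have "\<exists>N. (1/2::real)^N < e / 3" by (rule real_arch_pow_inv) (use that in auto)
    then obtain N where N: "(1/2::real)^N < e / 3" ..
    have "3 * \<epsilon> n < e" if "n \<ge> N" for n
    proof -
      have "(1/2::real) ^ n \<le> (1/2) ^ N" using that by (intro power_decreasing) auto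
      then show ?thesis using N unfolding \<epsilon>_def by argo
    qed
    then show ?thesis by blast
  qed
  define \<psi> where "\<psi> x n = (LEAST j. d x (a j) < \<epsilon> n)" for x n
  have \<psi>: "d x (a (\<psi> x n)) < \<epsilon> n" if "x \<in> S" for x n
    unfolding \<psi>_def by (rule LeastI_ex) (use dense \<epsilon> that in auto)
  have "\<psi> \<in> measurable M baire"
  proof (rule measurable_PiM_single')
    fix n :: nat
    have [measurable]: "Measurable.pred M (\<lambda>x. d x (a j) < \<epsilon> n)" for j
    proof -
      have "{x \<in> space M. d x (a j) < \<epsilon> n} = mball (a j) (\<epsilon> n)"
        using aS[of j] unfolding S in_mball by (auto simp: commute)
      then show ?thesis unfolding pred_def using open_sets by simp
    qed
    show "(\<lambda>x. \<psi> x n) \<in> measurable M (count_space UNIV)"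
      unfolding \<psi>_def by measurable
  qed auto
  \<comment> \<open>The sequences that can be decoded. The bound is what the triangle inequality
    gives for codes of actual points; in the limit it becomes a distance of at most
    \<open>\<epsilon> n\<close>.\<close>
  define F where "F = {h. \<forall>n m. d (a (h n)) (a (h m)) \<le> \<epsilon> n + \<epsilon> m}"
  have cauchy_lim: "\<exists>l\<in>S. \<forall>n. d (a (h n)) l \<le> \<epsilon> n" if "h \<in> F" for h
  proof -
    have "MCauchy (\<lambda>n. a (h n))"
      unfolding MCauchy_def
    proof (intro conjI allI impI)
      fix e :: real assume "e > 0"
      then obtain N where N: "\<And>n. n \<ge> N \<Longrightarrow> 3 * \<epsilon> n < e" using \<epsilon>0 by blast
      have "d (a (h n)) (a (h m)) < e" if "N \<le> n" "N \<le> m" for n m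
      proof -
        have "d (a (h n)) (a (h m)) \<le> \<epsilon> n + \<epsilon> m" using \<open>h \<in> F\<close> by (auto simp: F_def)
        then show ?thesis using N[OF that(1)] N[OF that(2)] \<epsilon>[of n] \<epsilon>[of m] by linarith
      qed
      then show "\<exists>N. \<forall>n n'. N \<le> n \<longrightarrow> N \<le> n' \<longrightarrow> d (a (h n)) (a (h n')) < e" by blast
    qed (use aS in auto)
    then obtain l where l: "limitin mtopology (\<lambda>n. a (h n)) l sequentially"
      using compl unfolding mcomplete_def by blast
    then have lS: "l \<in> S" by (simp add: limitin_mspace)
    have "d (a (h n)) l \<le> \<epsilon> n" for n
    proof (rule field_le_epsilon)
      fix e :: real assume "e > 0"
      then obtain N where N: "\<And>n. n \<ge> N \<Longrightarrow> 3 * \<epsilon> n < e / 2" using \<epsilon>0[of "e/2"] by auto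
      obtain N' where N': "\<And>n. n \<ge> N' \<Longrightarrow> d (a (h n)) l < e / 2"
        using l \<open>e > 0\<close> unfolding limit_metric_sequentially by (meson half_gt_zero)
      let ?m = "max N N'"
      have "d (a (h n)) l \<le> d (a (h n)) (a (h ?m)) + d (a (h ?m)) l"
        using aS lS by (intro triangle) auto
      moreover have "d (a (h n)) (a (h ?m)) \<le> \<epsilon> n + \<epsilon> ?m" using that by (auto simp: F_def)
      ultimately show "d (a (h n)) l \<le> \<epsilon> n + e" using N[of ?m] N'[of ?m] \<epsilon>[of ?m] by simp
    qed
    then show ?thesis using lS by blast
  qed
  define \<phi> where "\<phi> h = (if h \<in> F then SOME l. l \<in> S \<and> (\<forall>n. d (a (h n)) l \<le> \<epsilon> n) else x0)" for h
  have \<phi>F: "\<phi> h \<in> S" "d (a (h n)) (\<phi> h) \<le> \<epsilon> n" if "h \<in> F" for h n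
    using someI_ex[of "\<lambda>l. l \<in> S \<and> (\<forall>n. d (a (h n)) l \<le> \<epsilon> n)"] cauchy_lim[OF that] that
    by (auto simp: \<phi>_def)
  have retr: "\<phi> (\<psi> x) = x" if "x \<in> space M" for x
  proof -
    have x: "x \<in> S" using that S by simp
    have "d (a (\<psi> x n)) (a (\<psi> x m)) \<le> \<epsilon> n + \<epsilon> m" for n m
      using triangle[OF aS x aS, of "\<psi> x n" "\<psi> x m"] \<psi>[OF x, of n] \<psi>[OF x, of m]
      by (simp add: commute)
    then have F: "\<psi> x \<in> F" by (simp add: F_def)
    have "d x (\<phi> (\<psi> x)) < e" if "e > 0" for e
    proof -
      obtain n where n: "3 * \<epsilon> n < e" using \<epsilon>0[OF \<open>e > 0\<close>] by blast
      show ?thesis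
        using triangle[OF x aS \<phi>F(1)[OF F], of "\<psi> x n"] \<psi>[OF x, of n] \<phi>F(2)[OF F, of n] n \<epsilon>[of n]
        by linarith
    qed
    then have "d x (\<phi> (\<psi> x)) = 0" using nonneg[of x "\<phi> (\<psi> x)"] by (metis less_irrefl less_le)
    then show ?thesis using x \<phi>F(1)[OF F] zero by auto
  qed
  have F_sets: "F \<in> sets baire"
  proof -
    have "F = (\<Inter>n. \<Inter>m. \<Union>i. \<Union>j. if d (a i) (a j) \<le> \<epsilon> n + \<epsilon> m then {h. h n = i} \<inter> {h. h m = j} else {})"
      by (auto simp: F_def split: if_splits)
    also have "\<dots> \<in> sets baire"
    proof -
      have "(if d (a i) (a j) \<le> \<epsilon> n + \<epsilon> m then {h. h n = i} \<inter> {h. h m = j} else {}) \<in> sets baire" for n m i j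
        using cylinder_in_baire[of "\<lambda>v. v = i" n] cylinder_in_baire[of "\<lambda>v. v = j" m]
        by (auto intro: sets.Int)
      then show ?thesis
        using sets.top[of baire]
        by (intro sets.countable_INT'' sets.countable_UN'') (auto simp: space_PiM)
    qed
    finally show ?thesis .
  qed
  have "\<phi> \<in> measurable baire M"
  proof (rule measurable_sigma_sets[OF X(4)])
    show "{U. openin X U} \<subseteq> Pow (space M)" using X(1) openin_subset by fastforce
    show "\<phi> \<in> space baire \<rightarrow> space M" using \<phi>F(1) x0 S by (auto simp: \<phi>_def)
    fix U assume "U \<in> {U. openin X U}"
    then have U: "openin mtopology U" using Xm by simp
    \<comment> \<open>The limit is within \<open>\<epsilon> n\<close> of \<open>a (h n)\<close>,
      hence inside the ball of radius \<open>2 * \<epsilon> n\<close>, which in turn lies in the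
      ball of radius \<open>3 * \<epsilon> n\<close> around the limit. So on \<open>F\<close> the
      preimage of an open set is a countable union of cylinders.\<close>
    have mem: "\<phi> h \<in> U \<longleftrightarrow> (\<exists>n. mball (a (h n)) (2 * \<epsilon> n) \<subseteq> U)" if h: "h \<in> F" for h
    proof
      assume "\<phi> h \<in> U"
      then obtain e where e: "e > 0" "mball (\<phi> h) e \<subseteq> U" using U unfolding openin_mtopology by blast
      obtain n where n: "3 * \<epsilon> n < e" using \<epsilon>0[OF \<open>e > 0\<close>] by blast
      have "mball (a (h n)) (2 * \<epsilon> n) \<subseteq> mball (\<phi> h) e"
      proof
        fix y assume y: "y \<in> mball (a (h n)) (2 * \<epsilon> n)"
        then show "y \<in> mball (\<phi> h) e"
          using triangle[OF \<phi>F(1)[OF h] aS, of y "h n"] \<phi>F(1)[OF h] \<phi>F(2)[OF h, of n] n by (auto simp: commute)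
      qed
      then show "\<exists>n. mball (a (h n)) (2 * \<epsilon> n) \<subseteq> U" using e by blast
    next
      assume "\<exists>n. mball (a (h n)) (2 * \<epsilon> n) \<subseteq> U"
      then obtain n where n: "mball (a (h n)) (2 * \<epsilon> n) \<subseteq> U" by blast
      have "\<phi> h \<in> mball (a (h n)) (2 * \<epsilon> n)"
        using \<phi>F(1)[OF h] \<phi>F(2)[OF h, of n] aS \<epsilon>[of n] by auto
      then show "\<phi> h \<in> U" using n by blast
    qed
    have "\<phi> -` U \<inter> space baire = (F \<inter> (\<Union>n. {h. mball (a (h n)) (2 * \<epsilon> n) \<subseteq> U})) \<union>
       (if x0 \<in> U then - F else {})"
    proof (intro set_eqI)
      fix h
      show "h \<in> \<phi> -` U \<inter> space baire \<longleftrightarrow> h \<in> (F \<inter> (\<Union>n. {h. mball (a (h n)) (2 * \<epsilon> n) \<subseteq> U})) \<union>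
         (if x0 \<in> U then - F else {})"
      proof (cases "h \<in> F")
        case False
        then have "\<phi> h = x0" by (simp add: \<phi>_def)
        then show ?thesis using False by (simp add: space_PiM)
      qed (use mem[of h] in \<open>simp add: space_PiM\<close>)
    qed
    also have "\<dots> \<in> sets baire"
      using F_sets sets.compl_sets[OF F_sets]
      by (auto intro!: sets.Un sets.Int sets.countable_UN' cylinder_in_baire simp: space_PiM Compl_eq_Diff_UNIV)
    finally show "\<phi> -` U \<inter> space baire \<in> sets baire" .
  qed
  then show ?thesis using that[of \<psi> \<phi>] \<open>\<psi> \<in> measurable M baire\<close> retr by blast
qed

text \<open>The form in which Borel relations are used from here on. Projections of arbitrary Borel
  relations are only analytic, whereas this class has Borel domains and is closed under composition
  and, if the diagonal is Borel, under differences. The functions are total and are cut down by the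
  sets \<open>D n\<close>, so that no partial functions occur.\<close>

definition graph_union :: "'v measure \<Rightarrow> 'v rel \<Rightarrow> bool" where
  "graph_union M E \<longleftrightarrow> (\<exists>(g :: nat \<Rightarrow> 'v \<Rightarrow> 'v) D.
     (\<forall>n. g n \<in> measurable M M \<and> D n \<in> sets M) \<and> E = {(x, g n x) | n x. x \<in> D n})"

lemma graph_unionI:
  assumes "countable I" "\<And>i. i \<in> I \<Longrightarrow> g i \<in> measurable M M" "\<And>i. i \<in> I \<Longrightarrow> D i \<in> sets M"
    and "E = {(x, g i x) | i x. i \<in> I \<and> x \<in> D i}"
  shows "graph_union M E"
proof (cases "I = {}")
  case True
  then show ?thesis unfolding graph_union_def
    by (intro exI[of _ "\<lambda>_ x. x"] exI[of _ "\<lambda>_. {}"]) (use assms(4) in auto)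
next
  case False
  show ?thesis unfolding graph_union_def
  proof (intro exI[of _ "\<lambda>n. g (from_nat_into I n)"] exI[of _ "\<lambda>n. D (from_nat_into I n)"] conjI allI)
    show "E = {(x, g (from_nat_into I n) x) | n x. x \<in> D (from_nat_into I n)}"
      unfolding assms(4) using from_nat_into_surj[OF assms(1)] from_nat_into[OF False] by metis
  qed (use assms(2,3) from_nat_into[OF False] in auto)
qed

lemma graph_unionE:
  assumes "graph_union M E"
  obtains g D where "\<And>n::nat. g n \<in> measurable M M" "\<And>n. D n \<in> sets M"
    "\<And>x y. (x, y) \<in> E \<longleftrightarrow> (\<exists>n. x \<in> D n \<and> y = g n x)"
proof -
  obtain g D where "\<forall>n::nat. g n \<in> measurable M M \<and> D n \<in> sets M" "E = {(x, g n x) | n x. x \<in> D n}"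
    using assms unfolding graph_union_def by (elim exE conjE) (rule that)
  then show thesis by (intro that[of g D]) auto
qed

lemma graph_union_Un:
  assumes "graph_union M E" "graph_union M E'"
  shows "graph_union M (E \<union> E')"
proof -
  obtain g D where g: "\<And>n::nat. g n \<in> measurable M M" "\<And>n. D n \<in> sets M"
    "\<And>x y. (x, y) \<in> E \<longleftrightarrow> (\<exists>n. x \<in> D n \<and> y = g n x)"
    by (rule graph_unionE[OF assms(1)]) (rule that; assumption)
  obtain g' D' where g': "\<And>n::nat. g' n \<in> measurable M M" "\<And>n. D' n \<in> sets M"
    "\<And>x y. (x, y) \<in> E' \<longleftrightarrow> (\<exists>n. x \<in> D' n \<and> y = g' n x)"
    by (rule graph_unionE[OF assms(2)]) (rule that; assumption)
  define h where "h = (\<lambda>(b, n). if b then g n else g' n)"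
  define C where "C = (\<lambda>(b, n). if b then D n else D' n)"
  have 1: "h i \<in> measurable M M" and 2: "C i \<in> sets M" for i
    using g(1,2) g'(1,2) by (cases i; simp add: h_def C_def)+
  have "p \<in> E \<union> E' \<longleftrightarrow> (\<exists>i. fst p \<in> C i \<and> snd p = h i (fst p))" for p
    using g(3)[of "fst p" "snd p"] g'(3)[of "fst p" "snd p"] by (auto simp: h_def C_def split: if_splits)
  then have 3: "E \<union> E' = {(x, h i x) |i x. i \<in> UNIV \<and> x \<in> C i}"
    by fastforce
  show ?thesis by (rule graph_unionI[OF _ 1 2 3]) (rule countableI_type)
qed

text \<open>Interleaving a pair into one sequence turns the projection into the continuous map that
  keeps the even places.\<close>

lemma analytic_Domain:
  assumes "E \<in> sets (baire \<Otimes>\<^sub>M baire)"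
  shows "analytic (Domain E)"
proof -
  let ?u = "\<lambda>z :: nat \<Rightarrow> nat. (\<lambda>n. z (2 * n), \<lambda>n. z (Suc (2 * n)))"
  have m: "(\<lambda>z. \<lambda>n. z (f n)) \<in> measurable baire baire" for f :: "nat \<Rightarrow> nat"
    by (rule measurable_PiM_single') (auto intro: measurable_component_singleton)
  have "?u \<in> measurable baire (baire \<Otimes>\<^sub>M baire)"
    by (intro measurable_Pair m)
  from measurable_sets[OF this assms] have "?u -` E \<in> sets baire" by (simp add: space_PiM)
  then have "analytic ((\<lambda>z n. z (2 * n)) ` (?u -` E))"
    by (intro analytic_image analytic_sets_baire continuous_on_coordinatewise_then_product
        continuous_on_product_coordinates)
  also have "(\<lambda>z n. z (2 * n)) ` (?u -` E) = Domain E"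
  proof (intro set_eqI iffI)
    fix x assume "x \<in> Domain E"
    then obtain y where y: "(x, y) \<in> E" by auto
    let ?z = "\<lambda>n. if even n then x (n div 2) else y (n div 2)"
    have "?z \<in> ?u -` E" and "x = (\<lambda>n. ?z (2 * n))" using y by auto
    then show "x \<in> (\<lambda>z n. z (2 * n)) ` (?u -` E)" by (intro rev_image_eqI[of ?z])
  qed auto
  finally show ?thesis .
qed

lemma cylinder_pair_in_baire: "{p. P (snd p n)} \<in> sets (baire \<Otimes>\<^sub>M baire)"
proof -
  have "{p \<in> space (baire \<Otimes>\<^sub>M baire). P (snd p n)} \<in> sets (baire \<Otimes>\<^sub>M baire)" by measurable
  then show ?thesis by (simp add: space_pair_measure space_PiM)
qed

text \<open>The points of \<open>A\<close> whose unique partner has entry \<open>k\<close> at place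
  \<open>n\<close> and the other points of \<open>A\<close> form disjoint analytic sets, so a Borel
  set \<open>C n k\<close> separates them. Reading \<open>g\<close> off these sets makes it Borel
  everywhere, although \<open>A\<close> is only analytic.\<close>

lemma analytic_uniformization:
  assumes E: "E \<in> sets (baire \<Otimes>\<^sub>M baire)" and A: "analytic A"
    and ex1: "\<And>x. x \<in> A \<Longrightarrow> \<exists>!y. (x, y) \<in> E"
  obtains g where "g \<in> measurable baire baire" "\<And>x. x \<in> A \<Longrightarrow> (x, g x) \<in> E"
proof -
  have "separable_in baire (A \<inter> Domain (E \<inter> {p. snd p n = k})) (A \<inter> Domain (E \<inter> {p. snd p n \<noteq> k}))" for n k
    by (intro analytic_separable analytic_Int A analytic_Domain sets.Int E
        cylinder_pair_in_baire[of "\<lambda>i. i = k"] cylinder_pair_in_baire[of "\<lambda>i. i \<noteq> k"])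
      (use ex1 in auto)
  then obtain C where C: "\<And>n k. C n k \<in> sets baire"
      "\<And>n k. A \<inter> Domain (E \<inter> {p. snd p n = k}) \<subseteq> C n k"
      "\<And>n k. A \<inter> Domain (E \<inter> {p. snd p n \<noteq> k}) \<inter> C n k = {}"
    unfolding separable_in_def by metis
  define g where "g x n = (LEAST k. x \<in> C n k)" for x n
  show ?thesis
  proof
    show "g \<in> measurable baire baire"
    proof (rule measurable_PiM_single')
      fix n :: nat
      have [measurable]: "C n k \<in> sets baire" for k by (rule C)
      show "(\<lambda>x. g x n) \<in> measurable baire (count_space UNIV)" unfolding g_def by measurable
    qed auto
    fix x assume x: "x \<in> A"
    obtain y where y: "(x, y) \<in> E" using ex1[OF x] by blast
    have "x \<in> C n k \<longleftrightarrow> k = y n" for n k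
      using C(2)[of n k] C(3)[of n k] x y by fastforce
    then have "g x = y" by (auto simp: g_def Least_equality)
    then show "(x, g x) \<in> E" using y by simp
  qed
qed

lemma finite_separating_prefix:
  fixes F :: "(nat \<Rightarrow> 'a) set"
  assumes "finite F"
  shows "\<exists>k. inj_on (\<lambda>y. map y [0..<k]) F"
proof -
  have "\<exists>i. x \<noteq> y \<longrightarrow> x i \<noteq> y i" for x y :: "nat \<Rightarrow> 'a" by (auto simp: fun_eq_iff)
  then obtain i where i: "\<And>x y :: nat \<Rightarrow> 'a. x \<noteq> y \<Longrightarrow> x (i x y) \<noteq> y (i x y)" by metis
  let ?k = "Suc (Max ((\<lambda>(x, y). i x y) ` (F \<times> F)))"
  have "inj_on (\<lambda>y. map y [0..<?k]) F"
  proof (rule inj_onI, rule ccontr)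
    fix x y assume *: "x \<in> F" "y \<in> F" "map x [0..<?k] = map y [0..<?k]" "x \<noteq> y"
    have "i x y < ?k" unfolding less_Suc_eq_le using * assms by (intro Max_ge) (auto intro: rev_image_eqI)
    then show False using i[OF *(4)] *(3) by (simp add: map_eq_conv del: upt_Suc)
  qed
  then show ?thesis by blast
qed

text \<open>Induction on the section size. A section of the full size \<open>Suc d\<close> is
  recognised by \<open>Suc d\<close> disjoint cylinders that all meet it; each contains exactly one
  of its points, so uniformization applies cylinder by cylinder. Over the remaining points the
  sections have size at most \<open>d\<close>.\<close>

theorem lusin_novikov_baire:
  assumes "E \<in> sets (baire \<Otimes>\<^sub>M baire)"
    and "\<And>x. finite (E `` {x}) \<and> card (E `` {x}) \<le> d"
  shows "graph_union baire E"
  using assms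
proof (induction d arbitrary: E)
  case 0
  then have "E = {}" by (auto simp: card_eq_0_iff)
  then show ?case by (intro graph_unionI[of "{}"]) auto
next
  case (Suc d)
  note E = Suc.prems(1)
  define Cyl where "Cyl s = {y :: nat \<Rightarrow> nat. map y [0..<length s] = s}" for s
  have Cyl: "UNIV \<times> Cyl s \<in> sets (baire \<Otimes>\<^sub>M baire)" for s
  proof -
    have "y \<in> Cyl s \<longleftrightarrow> (\<forall>i. i < length s \<longrightarrow> y i = s ! i)" for y
      unfolding Cyl_def using map_nth[of s]
      by (auto intro!: nth_equalityI) (metis add_0 diff_zero length_map length_upt nth_map nth_upt)
    then have eq: "UNIV \<times> Cyl s = (\<Inter>i. {p. i < length s \<longrightarrow> snd p i = s ! i})" by auto
    have "range (\<lambda>i. {p. i < length s \<longrightarrow> snd p i = s ! i}) \<subseteq> sets (baire \<Otimes>\<^sub>M baire)"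
      using cylinder_pair_in_baire[of "\<lambda>v. i < length s \<longrightarrow> v = s ! i" i for i] by blast
    then show ?thesis unfolding eq by (intro sets.countable_INT') auto
  qed
  \<comment> \<open>Distinct words of a common length have disjoint cylinders, so a member of
    \<open>\<S>\<close> describes \<open>Suc d\<close> disjoint clopen sets. There are only
    countably many members.\<close>
  define \<S> where "\<S> = {S. finite S \<and> card S = Suc d \<and> (\<exists>k. \<forall>s\<in>S. length (s :: nat list) = k)}"
  have "\<S> \<subseteq> {S :: nat list set. finite S \<and> S \<subseteq> UNIV}" by (auto simp: \<S>_def)
  then have \<S>c: "countable \<S>" using countable_Collect_finite_subset[of "UNIV :: nat list set"] countable_subset
    by blast
  have Cyl_unique: "s = t" if "S \<in> \<S>" "s \<in> S" "t \<in> S" "y \<in> Cyl s" "y \<in> Cyl t" for S s t y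
  proof -
    have "length s = length t" using that(1-3) by (auto simp: \<S>_def)
    then show ?thesis using that(4,5) by (simp add: Cyl_def)
  qed
  define D where "D S = (\<Inter>s\<in>S. Domain (E \<inter> UNIV \<times> Cyl s))" for S
  have key: "\<exists>g. g \<in> measurable baire baire \<and> (\<forall>x\<in>D S. (x, g x) \<in> E \<and> g x \<in> Cyl s)"
    if S: "S \<in> \<S>" "s \<in> S" for S s
  proof -
    have "\<exists>!y. (x, y) \<in> E \<inter> UNIV \<times> Cyl s" if x: "x \<in> D S" for x
    proof -
      have "\<forall>t\<in>S. \<exists>y. (x, y) \<in> E \<and> y \<in> Cyl t" using x by (auto simp: D_def)
      then obtain h where h: "\<And>t. t \<in> S \<Longrightarrow> (x, h t) \<in> E \<and> h t \<in> Cyl t" by metis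
      have inj: "inj_on h S"
        by (rule inj_onI) (metis Cyl_unique[OF S(1)] h)
      have sub: "h ` S \<subseteq> E `` {x}" using h by auto
      have hS: "h ` S = E `` {x}"
        by (rule card_seteq) (use Suc.prems(2)[of x] sub S(1) card_image[OF inj] in \<open>auto simp: \<S>_def\<close>)
      have "y = h s" if y: "(x, y) \<in> E" "y \<in> Cyl s" for y
      proof -
        obtain t where t: "t \<in> S" "y = h t" using y hS by auto
        then have "t = s" using Cyl_unique[OF S(1) t(1) S(2), of y] h y(2) by simp
        then show ?thesis using t by simp
      qed
      then show ?thesis using h[OF S(2)] by auto
    qed
    moreover have "analytic (D S)"
      unfolding D_def by (intro analytic_INT_finite analytic_Domain sets.Int E Cyl) (use S in \<open>auto simp: \<S>_def\<close>)
    ultimately obtain g where "g \<in> measurable baire baire" "\<And>x. x \<in> D S \<Longrightarrow> (x, g x) \<in> E \<inter> UNIV \<times> Cyl s"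
      using analytic_uniformization[OF sets.Int[OF E Cyl[of s]], of "D S"] by blast
    then show ?thesis by blast
  qed
  define g where "g S s = (SOME g. g \<in> measurable baire baire \<and> (\<forall>x\<in>D S. (x, g x) \<in> E \<and> g x \<in> Cyl s))" for S s
  have g: "g S s \<in> measurable baire baire" "\<And>x. x \<in> D S \<Longrightarrow> (x, g S s x) \<in> E \<and> g S s x \<in> Cyl s"
    if "S \<in> \<S>" "s \<in> S" for S s
    using someI_ex[OF key[OF that]] unfolding g_def by blast+
  \<comment> \<open>A priori \<open>D S\<close> is analytic, as a finite intersection of
    projections. But the Borel functions \<open>g S s\<close> are defined everywhere, and
    \<open>D S\<close> is exactly the set where all of them select points of the section, which is a
    Borel condition.\<close>
  have D_sets: "D S \<in> sets baire" if S: "S \<in> \<S>" for S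
  proof -
    have "D S = (\<Inter>s\<in>S. (\<lambda>x. (x, g S s x)) -` (E \<inter> UNIV \<times> Cyl s) \<inter> space baire)"
    proof (intro set_eqI iffI)
      fix x assume "x \<in> (\<Inter>s\<in>S. (\<lambda>x. (x, g S s x)) -` (E \<inter> UNIV \<times> Cyl s) \<inter> space baire)"
      then have "\<forall>s\<in>S. (x, g S s x) \<in> E \<inter> UNIV \<times> Cyl s" by blast
      then show "x \<in> D S" unfolding D_def by (meson DomainI INT_I)
    qed (use g(2)[OF S] in \<open>simp add: space_PiM\<close>)
    also have "\<dots> \<in> sets baire"
      using S by (intro sets.finite_INT measurable_sets[of _ _ "baire \<Otimes>\<^sub>M baire"] measurable_Pair
          measurable_ident_sets g sets.Int E Cyl) (auto simp: \<S>_def)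
    finally show ?thesis .
  qed
  define F where "F = (\<Union>S\<in>\<S>. D S)"
  have F_sets: "F \<in> sets baire" unfolding F_def by (intro sets.countable_UN'' \<S>c D_sets)
  have "graph_union baire (E \<inter> F \<times> UNIV)"
  proof (rule graph_unionI[of "SIGMA S:\<S>. S" "\<lambda>(S, s). g S s" _ "\<lambda>(S, s). D S"])
    show "countable (SIGMA S:\<S>. S)"
      by (intro countable_SIGMA \<S>c countable_finite) (auto simp: \<S>_def)
    show "E \<inter> F \<times> UNIV = {(x, (case i of (S, s) \<Rightarrow> g S s) x) |i x. i \<in> Sigma \<S> (\<lambda>S. S) \<and> x \<in> (case i of (S, s) \<Rightarrow> D S)}"
      (is "_ = ?R")
    proof (intro set_eqI iffI)
      fix p assume "p \<in> E \<inter> F \<times> UNIV"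
      then obtain x y S where p: "p = (x, y)" "(x, y) \<in> E" "S \<in> \<S>" "x \<in> D S" by (auto simp: F_def)
      have inj: "inj_on (\<lambda>s. g S s x) S"
        by (rule inj_onI) (metis Cyl_unique[OF p(3)] g(2)[OF p(3) _ p(4)])
      have sub: "(\<lambda>s. g S s x) ` S \<subseteq> E `` {x}" using g(2)[OF p(3) _ p(4)] by auto
      have "(\<lambda>s. g S s x) ` S = E `` {x}"
        by (rule card_seteq) (use Suc.prems(2)[of x] sub p(3) card_image[OF inj] in \<open>auto simp: \<S>_def\<close>)
      then obtain s where "s \<in> S" "y = g S s x" using p(2) by auto
      then show "p \<in> ?R" using p by (auto intro!: exI[of _ "(S, s)"])
    next
      fix p assume "p \<in> ?R"
      then show "p \<in> E \<inter> F \<times> UNIV" using g(2) by (auto simp: F_def)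
    qed
  qed (use g(1) D_sets in auto)
  moreover have "graph_union baire (E - F \<times> UNIV)"
  proof (rule Suc.IH)
    show "E - F \<times> UNIV \<in> sets (baire \<Otimes>\<^sub>M baire)"
      using sets.Diff[OF E pair_measureI[OF F_sets sets.top[of baire]]] by (simp add: space_PiM)
    fix x
    have fin: "finite (E `` {x})" "card (E `` {x}) \<le> Suc d" using Suc.prems(2)[of x] by auto
    have sub: "(E - F \<times> UNIV) `` {x} \<subseteq> E `` {x}" by auto
    show "finite ((E - F \<times> UNIV) `` {x}) \<and> card ((E - F \<times> UNIV) `` {x}) \<le> d"
    proof (cases "x \<in> F")
      case False
      have "card (E `` {x}) \<noteq> Suc d"
      proof
        assume card: "card (E `` {x}) = Suc d"
        obtain k where k: "inj_on (\<lambda>y. map y [0..<k]) (E `` {x})"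
          using finite_separating_prefix[OF fin(1)] by blast
        let ?S = "(\<lambda>y. map y [0..<k]) ` (E `` {x})"
        have "?S \<in> \<S>" using card_image[OF k] card fin by (auto simp: \<S>_def)
        moreover have "x \<in> D ?S" by (auto simp: D_def Cyl_def)
        ultimately show False using False by (auto simp: F_def)
      qed
      then show ?thesis using fin sub card_mono[OF fin(1) sub] finite_subset[OF sub] by linarith
    qed (simp add: Image_def)
  qed
  ultimately have un: "graph_union baire ((E \<inter> F \<times> UNIV) \<union> (E - F \<times> UNIV))"
    by (rule graph_union_Un)
  have eq: "(E \<inter> F \<times> UNIV) \<union> (E - F \<times> UNIV) = E" by blast
  show ?case using un unfolding eq .
qed

theorem lusin_novikov:
  assumes "standard_borel M" and E: "E \<in> sets (M \<Otimes>\<^sub>M M)"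
    and fin: "\<And>x. x \<in> space M \<Longrightarrow> finite (E `` {x}) \<and> card (E `` {x}) \<le> d"
  shows "graph_union M E"
proof (cases "space M = {}")
  case True
  then have "E = {}" using sets.sets_into_space[OF E] by (auto simp: space_pair_measure)
  then show ?thesis by (intro graph_unionI[of "{}"]) auto
next
  case False
  obtain \<psi> \<phi> where \<psi>: "\<psi> \<in> measurable M baire" and \<phi>: "\<phi> \<in> measurable baire M"
    and retr: "\<And>x. x \<in> space M \<Longrightarrow> \<phi> (\<psi> x) = x"
    using standard_borel_retract[OF assms(1) False] by blast
  have \<psi>\<phi>: "(\<lambda>h. \<psi> (\<phi> h)) \<in> measurable baire baire" using measurable_compose[OF \<phi> \<psi>] .
  have Esp: "E \<subseteq> space M \<times> space M" using sets.sets_into_space[OF E] by (simp add: space_pair_measure)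
  define R where "R = {h. \<psi> (\<phi> h) = h}"
  have R: "R \<in> sets baire"
  proof -
    have "R = (\<Inter>n. \<Union>k. {h. \<psi> (\<phi> h) n = k} \<inter> {h. h n = k})" by (auto simp: R_def fun_eq_iff)
    also have "\<dots> \<in> sets baire"
    proof -
      have "{h. \<psi> (\<phi> h) n = k} \<in> sets baire" for n k
        using measurable_sets[OF \<psi>\<phi> cylinder_in_baire[of "\<lambda>v. v = k" n]] by (simp add: vimage_def space_PiM)
      then have "{h. \<psi> (\<phi> h) n = k} \<inter> {h. h n = k} \<in> sets baire" for n k
        using cylinder_in_baire[of "\<lambda>v. v = k" n] by (intro sets.Int)
      then show ?thesis
        using sets.top[of baire]
        by (intro sets.countable_INT'' sets.countable_UN'') (auto simp: space_PiM)
    qed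
    finally show ?thesis .
  qed
  define E' where "E' = {(h, h'). (\<phi> h, \<phi> h') \<in> E \<and> \<psi> (\<phi> h) = h \<and> \<psi> (\<phi> h') = h'}"
  have "E' = ((\<lambda>p. (\<phi> (fst p), \<phi> (snd p))) -` E \<inter> space (baire \<Otimes>\<^sub>M baire)) \<inter> R \<times> R"
    by (auto simp: E'_def R_def space_pair_measure space_PiM)
  moreover have "(\<lambda>p. (\<phi> (fst p), \<phi> (snd p))) \<in> measurable (baire \<Otimes>\<^sub>M baire) (M \<Otimes>\<^sub>M M)"
    by (intro measurable_Pair measurable_compose[OF measurable_fst \<phi>] measurable_compose[OF measurable_snd \<phi>])
  ultimately have E': "E' \<in> sets (baire \<Otimes>\<^sub>M baire)"
    using R measurable_sets[OF _ E] by auto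
  have "finite (E' `` {h}) \<and> card (E' `` {h}) \<le> d" for h
  proof -
    have "E' `` {h} \<subseteq> \<psi> ` (E `` {\<phi> h})" by (auto simp: E'_def intro: rev_image_eqI)
    moreover have "finite (E `` {\<phi> h}) \<and> card (E `` {\<phi> h}) \<le> d"
      using measurable_space[OF \<phi>, of h] by (intro fin) (simp add: space_PiM)
    ultimately show ?thesis
      by (meson card_image_le card_mono finite_imageI finite_subset le_trans)
  qed
  from lusin_novikov_baire[OF E' this] have gu: "graph_union baire E'" .
  obtain g D where g: "\<And>n::nat. g n \<in> measurable baire baire" "\<And>n. D n \<in> sets baire"
    "\<And>x y. (x, y) \<in> E' \<longleftrightarrow> (\<exists>n. x \<in> D n \<and> y = g n x)"
    by (rule graph_unionE[OF gu]) (rule that; assumption)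
  have EE': "(x, y) \<in> E \<longleftrightarrow> x \<in> space M \<and> y \<in> space M \<and> (\<psi> x, \<psi> y) \<in> E'" for x y
    using Esp retr by (auto simp: E'_def)
  show ?thesis
  proof (rule graph_unionI[of UNIV "\<lambda>n x. \<phi> (g n (\<psi> x))" _ "\<lambda>n. \<psi> -` D n \<inter> space M"])
    show "E = {(x, \<phi> (g i (\<psi> x))) |i x. i \<in> UNIV \<and> x \<in> \<psi> -` D i \<inter> space M}" (is "_ = ?R")
    proof (intro set_eqI iffI)
      fix p assume "p \<in> E"
      moreover obtain x y where p: "p = (x, y)" by force
      ultimately have "x \<in> space M" "y \<in> space M" "(\<psi> x, \<psi> y) \<in> E'" using EE' by auto
      then obtain n where "\<psi> y = g n (\<psi> x)" "\<psi> x \<in> D n" using g(3) by auto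
      then show "p \<in> ?R" using p \<open>x \<in> space M\<close> retr[OF \<open>y \<in> space M\<close>] by force
    next
      fix p assume "p \<in> ?R"
      then obtain n x where p: "p = (x, \<phi> (g n (\<psi> x)))" "\<psi> x \<in> D n" "x \<in> space M" by auto
      then have "(\<psi> x, g n (\<psi> x)) \<in> E'" using g(3) by auto
      then show "p \<in> E" using p retr by (auto simp: E'_def)
    qed
    show "(\<lambda>x. \<phi> (g i (\<psi> x))) \<in> measurable M M" for i
      by (rule measurable_compose[OF measurable_compose[OF \<psi> g(1)] \<phi>])
  qed (auto intro: measurable_sets[OF \<psi>] g(2))
qed

section \<open>Rooted isomorphisms and colour refinement\<close>

text \<open>\<open>rooted_iso\<close> does not ask that roots be vertices; the inverse of
  \<open>f\<close> is guaranteed to send \<open>w\<close> back to \<open>v\<close> only when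
  \<open>v\<close> is a vertex.\<close>

lemma rooted_iso_sym:
  assumes "rooted_iso (G, v) (H, w)" "v \<in> verts G"
  shows "rooted_iso (H, w) (G, v)"
proof -
  obtain f where f: "bij_betw f (verts G) (verts H)" "f v = w"
     "\<forall>x\<in>verts G. \<forall>y\<in>verts G. (x, y) \<in> edges G \<longleftrightarrow> (f x, f y) \<in> edges H"
     "\<forall>x\<in>verts G. color H (f x) = color G x"
    using assms(1) unfolding rooted_iso_def by auto
  let ?g = "inv_into (verts G) f"
  have g: "?g y \<in> verts G" "f (?g y) = y" if "y \<in> verts H" for y
    using that f(1) by (auto simp: bij_betw_def inv_into_into f_inv_into_f)
  show ?thesis unfolding rooted_iso_def prod.case
  proof (intro exI[of _ ?g] conjI ballI)
    show "bij_betw ?g (verts H) (verts G)" using f(1) by (rule bij_betw_inv_into)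
    show "?g w = v" using f(1,2) assms(2) by (metis bij_betw_inv_into_left)
    fix x y assume "x \<in> verts H" "y \<in> verts H"
    then show "(x, y) \<in> edges H \<longleftrightarrow> (?g x, ?g y) \<in> edges G" using f(3) g by metis
  next
    fix x assume "x \<in> verts H"
    then show "color G (?g x) = color H x" using f(4) g by metis
  qed
qed

lemma rooted_iso_trans:
  assumes "rooted_iso (G, v) (H, w)" "rooted_iso (H, w) (K, z)"
  shows "rooted_iso (G, v) (K, z)"
proof -
  obtain f where f: "bij_betw f (verts G) (verts H)" "f v = w"
     "\<forall>x\<in>verts G. \<forall>y\<in>verts G. (x, y) \<in> edges G \<longleftrightarrow> (f x, f y) \<in> edges H"
     "\<forall>x\<in>verts G. color H (f x) = color G x"
    using assms(1) unfolding rooted_iso_def by auto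
  obtain g where g: "bij_betw g (verts H) (verts K)" "g w = z"
     "\<forall>x\<in>verts H. \<forall>y\<in>verts H. (x, y) \<in> edges H \<longleftrightarrow> (g x, g y) \<in> edges K"
     "\<forall>x\<in>verts H. color K (g x) = color H x"
    using assms(2) unfolding rooted_iso_def by auto
  have fH: "f x \<in> verts H" if "x \<in> verts G" for x using f(1) that by (auto simp: bij_betw_def)
  show ?thesis unfolding rooted_iso_def prod.case
    by (rule exI[of _ "g \<circ> f"]) (use f g fH bij_betw_trans[OF f(1) g(1)] in auto)
qed

lemma verts_graph_ball:
  "y \<in> verts (graph_ball r G v) \<longleftrightarrow> y \<in> verts G \<and> (\<exists>k\<le>r. (v, y) \<in> edges G ^^ k)"
  by (simp add: graph_ball_def Let_def)

lemma edges_graph_ball: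
  "(x, y) \<in> edges (graph_ball r G v) \<longleftrightarrow>
     (x, y) \<in> edges G \<and> x \<in> verts (graph_ball r G v) \<and> y \<in> verts (graph_ball r G v)"
  by (simp add: graph_ball_def Let_def)

lemma root_in_ball: "v \<in> verts G \<Longrightarrow> v \<in> verts (graph_ball r G v)"
  unfolding verts_graph_ball by (auto intro!: exI[of _ 0])

lemma rooted_iso_cong:
  assumes "rooted_iso (G, v) (H, w)" "v \<in> verts G"
  shows "rooted_iso (G, v) t \<longleftrightarrow> rooted_iso (H, w) t"
  using rooted_iso_sym[OF assms] rooted_iso_trans assms by (metis prod.exhaust)

lemma relpow_sym:
  assumes "sym S" "(x, y) \<in> S ^^ n"
  shows "(y, x) \<in> S ^^ n"
  using assms(2)
proof (induction n arbitrary: y)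
  case (Suc n)
  then obtain z where "(x, z) \<in> S ^^ n" "(z, y) \<in> S" by auto
  then show ?case using Suc.IH assms(1) by (meson relpow_Suc_I2 symD)
qed simp

lemma relpow_add_I: "(x, y) \<in> S ^^ m \<Longrightarrow> (y, z) \<in> S ^^ n \<Longrightarrow> (x, z) \<in> S ^^ (m + n)"
  by (auto simp: relpow_add)

text \<open>Take a shortest segment of the walk between two visits of one vertex. Irreflexivity
  excludes length 1, the absence of backtracking excludes length 2, and a longer segment would be a
  cycle.\<close>

lemma closed_walk_backtracks:
  assumes ac: "acyclic_graph E" and ir: "irrefl E"
    and g: "\<And>i. i < j \<Longrightarrow> (g i, g (Suc i)) \<in> E" "g 0 = g j" "0 < j"
  shows "\<exists>i. i + 2 \<le> j \<and> g i = g (i + 2)"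
proof (rule ccontr)
  assume no: "\<not> ?thesis"
  define P where "P n \<longleftrightarrow> (\<exists>a. 0 < n \<and> a + n \<le> j \<and> g a = g (a + n))" for n
  have "P j" using g by (auto simp: P_def intro!: exI[of _ 0])
  define n where "n = (LEAST n. P n)"
  have "P n" unfolding n_def by (rule LeastI) fact
  then obtain a where a: "0 < n" "a + n \<le> j" "g a = g (a + n)" by (auto simp: P_def)
  have least: "\<not> P m" if "m < n" for m using that unfolding n_def by (rule not_less_Least)
  have "n \<noteq> 1"
  proof
    assume "n = 1"
    then have "(g a, g a) \<in> E" using a g(1)[of a] by auto
    then show False using ir by (auto simp: irrefl_def)
  qed
  moreover have "n \<noteq> 2" using no a by auto
  ultimately have "3 \<le> n" using a(1) by linarith
  define xs where "xs = map (\<lambda>i. g (a + i)) [0..<n]"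
  have neq: "g (a + i) \<noteq> g (a + k)" if "i < k" "k < n" for i k
  proof
    assume "g (a + i) = g (a + k)"
    then have "P (k - i)" using that a unfolding P_def by (intro exI[of _ "a + i"]) auto
    then show False using least[of "k - i"] that by auto
  qed
  have "is_cycle E xs"
    unfolding is_cycle_def
  proof (intro conjI allI impI)
    show "distinct xs"
      using neq by (auto simp: xs_def distinct_map inj_on_def) (metis linorder_neqE_nat)
    fix i assume "i < length xs"
    then have i: "i < n" by (simp add: xs_def)
    show "(xs ! i, xs ! (Suc i mod length xs)) \<in> E"
    proof (cases "Suc i = n")
      case True
      then show ?thesis using g(1)[of "a + i"] a i by (auto simp: xs_def)
    next
      case False
      then show ?thesis using g(1)[of "a + i"] a i by (auto simp: xs_def)
    qed
  qed (use \<open>3 \<le> n\<close> in \<open>simp add: xs_def\<close>)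
  then show False using ac by (auto simp: acyclic_graph_def)
qed

text \<open>Colour refinement (one-dimensional Weisfeiler-Leman), coded by natural numbers so that
  types in different graphs can be compared. Recording the set of neighbour colours instead of the
  multiset loses nothing in the graphs considered here, whose neighbours carry distinct parts.
  \<open>set_encode\<close> is faithful only on finite sets, whence the assumptions of local
  finiteness below.\<close>

fun wl :: "'a rel \<Rightarrow> ('a \<Rightarrow> nat) \<Rightarrow> nat \<Rightarrow> 'a \<Rightarrow> nat" where
  "wl S p 0 x = p x"
| "wl S p (Suc k) x = prod_encode (wl S p k x, set_encode (wl S p k ` (S `` {x})))"

lemma wl_mono: "wl S p n x = wl S' q n u \<Longrightarrow> k \<le> n \<Longrightarrow> wl S p k x = wl S' q k u"
proof (induction n)
  case (Suc n)
  then show ?case by (cases "k = Suc n") auto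
qed simp

lemma wl_label: "wl S p n x = wl S' q n u \<Longrightarrow> p x = q u"
  using wl_mono[of S p n x S' q u 0] by simp

lemma wl_step:
  assumes "finite (S `` {x})" "finite (S' `` {u})"
    and "wl S p (Suc k) x = wl S' q (Suc k) u" "(x, y) \<in> S"
  shows "\<exists>v. (u, v) \<in> S' \<and> wl S p k y = wl S' q k v"
proof -
  have "wl S p k ` (S `` {x}) = wl S' q k ` (S' `` {u})"
    using assms(1-3) set_encode_eq[of "wl S p k ` (S `` {x})" "wl S' q k ` (S' `` {u})"] by simp
  then have "wl S p k y \<in> wl S' q k ` (S' `` {u})" using assms(4) by blast
  then show ?thesis by auto
qed

definition locally_finite :: "'a rel \<Rightarrow> bool" where
  "locally_finite S \<longleftrightarrow> (\<forall>x. finite (S `` {x}))"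

text \<open>One round of refinement pays for one step, because a colour lists the colours of the
  neighbours one round earlier.\<close>

lemma wl_walk:
  assumes fin: "locally_finite S" "locally_finite S'"
    and eq: "wl S p N (f 0) = wl S' q N u"
    and f: "\<And>i. i < j \<Longrightarrow> (f i, f (Suc i)) \<in> S" and "j \<le> N"
  shows "\<exists>g. g 0 = u \<and> (\<forall>i<j. (g i, g (Suc i)) \<in> S') \<and> (\<forall>i\<le>j. wl S p (N - i) (f i) = wl S' q (N - i) (g i))"
  using f \<open>j \<le> N\<close>
proof (induction j)
  case 0
  then show ?case using eq by (intro exI[of _ "\<lambda>_. u"]) simp
next
  case (Suc j)
  then obtain g where g: "g 0 = u" "\<forall>i<j. (g i, g (Suc i)) \<in> S'"
      "\<forall>i\<le>j. wl S p (N - i) (f i) = wl S' q (N - i) (g i)"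
    by auto
  have "N - j = Suc (N - Suc j)" using Suc.prems by simp
  then have "wl S p (Suc (N - Suc j)) (f j) = wl S' q (Suc (N - Suc j)) (g j)" using g(3) by (metis order_refl)
  from wl_step[OF _ _ this Suc.prems(1)[of j]]
  obtain v where v: "(g j, v) \<in> S'" "wl S p (N - Suc j) (f (Suc j)) = wl S' q (N - Suc j) v"
    using fin by (auto simp: locally_finite_def)
  show ?case
    by (rule exI[of _ "g(Suc j := v)"]) (use g v in \<open>auto simp: less_Suc_eq le_Suc_eq\<close>)
qed

lemma wl_relpow:
  assumes "locally_finite S" "locally_finite S'"
    and "wl S p N x = wl S' q N u" "(x, y) \<in> S ^^ j" "j \<le> N"
  shows "\<exists>v. (u, v) \<in> S' ^^ j \<and> wl S p (N - j) y = wl S' q (N - j) v"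
proof -
  obtain f where f: "f 0 = x" "f j = y" "\<And>i. i < j \<Longrightarrow> (f i, f (Suc i)) \<in> S"
    using assms(4) unfolding relpow_fun_conv by auto
  obtain g where "g 0 = u" "\<forall>i<j. (g i, g (Suc i)) \<in> S'"
      "\<forall>i\<le>j. wl S p (N - i) (f i) = wl S' q (N - i) (g i)"
    using wl_walk[OF assms(1,2), of p N f q u j] assms(3,5) f by auto
  then show ?thesis using f by (intro exI[of _ "g j"]) (auto simp: relpow_fun_conv)
qed

section \<open>Labels that encode a graph\<close>

definition mk_label :: "nat \<Rightarrow> nat \<Rightarrow> nat set \<Rightarrow> nat" where
  "mk_label i k A = prod_encode (i, prod_encode (k, set_encode A))"

definition lab_part :: "nat \<Rightarrow> nat" where "lab_part l = fst (prod_decode l)"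
definition lab_col :: "nat \<Rightarrow> nat" where "lab_col l = fst (prod_decode (snd (prod_decode l)))"
definition lab_nbs :: "nat \<Rightarrow> nat set" where "lab_nbs l = set_decode (snd (prod_decode (snd (prod_decode l))))"

lemma mk_label_sels [simp]:
  "lab_part (mk_label i k A) = i" "lab_col (mk_label i k A) = k"
  "finite A \<Longrightarrow> lab_nbs (mk_label i k A) = A"
  by (auto simp: mk_label_def lab_part_def lab_col_def lab_nbs_def)

definition inj_walks :: "'a rel \<Rightarrow> ('a \<Rightarrow> nat) \<Rightarrow> nat \<Rightarrow> bool" where
  "inj_walks S p N \<longleftrightarrow> (\<forall>j\<le>N. \<forall>x y. (x, y) \<in> S ^^ j \<longrightarrow> lab_part (p x) = lab_part (p y) \<longrightarrow> x = y)"

text \<open>Two vertices are adjacent if a walk of length at most \<open>R\<close> joins them and the label of each lists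
  the part of the other. Colour \<open>0\<close> marks the vertices outside the decoded graph.\<close>

definition decoded_graph :: "'a set \<Rightarrow> 'a rel \<Rightarrow> ('a \<Rightarrow> nat) \<Rightarrow> nat \<Rightarrow> 'a cgraph" where
  "decoded_graph X S p R = \<lparr>verts = {x \<in> X. lab_col (p x) \<noteq> 0},
     edges = {(x, y). x \<in> X \<and> y \<in> X \<and> lab_col (p x) \<noteq> 0 \<and> lab_col (p y) \<noteq> 0 \<and>
       (\<exists>j\<le>R. (x, y) \<in> S ^^ j) \<and> lab_part (p y) \<in> lab_nbs (p x) \<and> lab_part (p x) \<in> lab_nbs (p y)},
     color = (\<lambda>x. lab_col (p x))\<rparr>"

text \<open>\<open>y\<close> and \<open>v\<close> are the ends of walks from \<open>x\<close> and \<open>u\<close> that see the same refined colours.\<close>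

definition matched where
  "matched S p S' q N x u K y v \<longleftrightarrow>
     (\<exists>j\<le>K. (x, y) \<in> S ^^ j \<and> (u, v) \<in> S' ^^ j \<and> wl S p (N - j) y = wl S' q (N - j) v)"

lemma matched_commuteD: "matched S p S' q N x u K y v \<Longrightarrow> matched S' q S p N u x K v y"
  by (auto simp: matched_def)

lemma matched_mono: "matched S p S' q N x u K y v \<Longrightarrow> K \<le> K' \<Longrightarrow> matched S p S' q N x u K' y v"
  unfolding matched_def by (meson le_trans)

lemma matched_label: "matched S p S' q N x u K y v \<Longrightarrow> p y = q v"
  by (auto simp: matched_def dest: wl_label)

text \<open>Both candidates carry the label of \<open>y\<close> and are joined through
  \<open>u\<close> by a walk of length at most \<open>2 * K\<close>, a range in which parts are
  injective.\<close>

lemma matched_unique: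
  assumes "matched S p S' q N x u K y v" "matched S p S' q N x u K y v'"
    and "sym S'" "inj_walks S' q N" "2 * K \<le> N"
  shows "v = v'"
proof -
  have pq: "q v = q v'" using assms(1,2) matched_label by metis
  obtain i j where ij: "i \<le> K" "j \<le> K" "(u, v) \<in> S' ^^ i" "(u, v') \<in> S' ^^ j"
    using assms(1,2) by (auto simp: matched_def)
  then have "(v, v') \<in> S' ^^ (i + j)" using relpow_add_I relpow_sym[OF assms(3)] by metis
  moreover have "i + j \<le> N" using ij assms(5) by simp
  ultimately show ?thesis using assms(4) pq unfolding inj_walks_def by metis
qed

lemma relpow_carrier:
  assumes "S \<subseteq> X \<times> X" "x \<in> X" "(x, y) \<in> S ^^ j"
  shows "y \<in> X"
  using assms(3) by (induction j arbitrary: y) (use assms in auto)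

text \<open>A decoded edge is a walk of length at most \<open>R\<close> together with a condition on
  the labels of its ends. Refined colours carry both over to the other graph, at the price of at
  most \<open>R\<close> rounds.\<close>

lemma matched_edge:
  assumes fin: "locally_finite S" "locally_finite S'" and X: "S' \<subseteq> X' \<times> X'" "u \<in> X'"
    and m: "matched S p S' q N x u K y v" and e: "(y, y') \<in> edges (decoded_graph X S p R)"
    and "K + R \<le> N"
  shows "\<exists>v'. (v, v') \<in> edges (decoded_graph X' S' q R) \<and> matched S p S' q N x u (K + R) y' v'"
proof -
  obtain j where j: "j \<le> K" "(x, y) \<in> S ^^ j" "(u, v) \<in> S' ^^ j" "wl S p (N - j) y = wl S' q (N - j) v"
    using m by (auto simp: matched_def)
  obtain i where i: "i \<le> R" "(y, y') \<in> S ^^ i" using e by (auto simp: decoded_graph_def)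
  obtain v' where v': "(v, v') \<in> S' ^^ i" "wl S p (N - j - i) y' = wl S' q (N - j - i) v'"
    using wl_relpow[OF fin j(4) i(2)] i(1) j(1) assms(7) by (metis add_le_imp_le_diff add_mono add.commute le_trans)
  have uv': "(u, v') \<in> S' ^^ (j + i)" using j v' relpow_add_I by metis
  have m': "matched S p S' q N x u (K + R) y' v'"
    unfolding matched_def
    by (intro exI[of _ "j + i"]) (use i j v' uv' relpow_add_I[OF j(2) i(2)] in auto)
  have "v \<in> X'" "v' \<in> X'" using relpow_carrier[OF X] j(3) uv' by blast+
  then show ?thesis
    using e m' v'(1) i matched_label[OF m] matched_label[OF m'] by (auto simp: decoded_graph_def)
qed

lemma matched_ball:
  assumes fin: "locally_finite S" "locally_finite S'" and X: "S' \<subseteq> X' \<times> X'" "u \<in> X'"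
    and eq: "wl S p N x = wl S' q N u" and y: "(x, y) \<in> edges (decoded_graph X S p R) ^^ k"
    and "k * R \<le> N"
  shows "\<exists>v. (u, v) \<in> edges (decoded_graph X' S' q R) ^^ k \<and> matched S p S' q N x u (k * R) y v"
  using y \<open>k * R \<le> N\<close>
proof (induction k arbitrary: y)
  case 0
  then show ?case using eq by (auto simp: matched_def)
next
  case (Suc k)
  then obtain z where z: "(x, z) \<in> edges (decoded_graph X S p R) ^^ k" "(z, y) \<in> edges (decoded_graph X S p R)"
    by auto
  obtain v where v: "(u, v) \<in> edges (decoded_graph X' S' q R) ^^ k" "matched S p S' q N x u (k * R) z v"
    using Suc.IH[OF z(1)] Suc.prems by auto
  have "k * R + R \<le> N" using Suc.prems by simp
  from matched_edge[OF fin X v(2) z(2) this] v(1) show ?case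
    by (metis add.commute mult_Suc relpow_Suc_I)
qed

text \<open>The isomorphism is \<open>matched\<close>. Vertices of the balls are reached by at most
  \<open>s * R\<close> steps. An edge is carried over from one of its ends by at most
  \<open>R\<close> more steps, and its other end must then be the partner already chosen. Comparing
  two partners at radius \<open>Suc s * R\<close> doubles the length, which explains the bound on
  \<open>N\<close>.\<close>

lemma decoded_ball_iso:
  assumes fin: "locally_finite S" "locally_finite S'" and X: "S \<subseteq> X \<times> X" "S' \<subseteq> X' \<times> X'"
    and sym: "sym S" "sym S'" and inj: "inj_walks S p N" "inj_walks S' q N"
    and x: "x \<in> X" "u \<in> X'" and eq: "wl S p N x = wl S' q N u" and N: "2 * (Suc s * R) \<le> N"
  shows "rooted_iso (graph_ball s (decoded_graph X S p R) x, x) (graph_ball s (decoded_graph X' S' q R) u, u)"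
proof -
  let ?G = "decoded_graph X S p R" and ?H = "decoded_graph X' S' q R"
  let ?K = "Suc s * R"
  let ?m = "matched S p S' q N x u"
  have pq: "p x = q u" using eq by (rule wl_label)
  have vG: "y \<in> verts ?G \<longleftrightarrow> y \<in> X \<and> lab_col (p y) \<noteq> 0" for y by (simp add: decoded_graph_def)
  have vH: "y \<in> verts ?H \<longleftrightarrow> y \<in> X' \<and> lab_col (q y) \<noteq> 0" for y by (simp add: decoded_graph_def)
  have kR: "k * R \<le> s * R" "s * R + R = ?K" if "k \<le> s" for k using that by auto
  have sR: "s * R \<le> N" "s * R + R \<le> N" using N by auto
  have funR: "v = v'" if "?m ?K y v" "?m ?K y v'" for y v v'
    using matched_unique[OF that sym(2) inj(2) N] .
  have funL: "y = y'" if "?m ?K y v" "?m ?K y' v" for y y' v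
    using matched_unique[OF that[THEN matched_commuteD] sym(1) inj(1) N] .
  define BG where "BG = verts (graph_ball s ?G x)"
  define BH where "BH = verts (graph_ball s ?H u)"
  have carX: "y \<in> X" if "?m K y v" for y v K using that relpow_carrier[OF X(1) x(1)] by (auto simp: matched_def)
  have carX': "v \<in> X'" if "?m K y v" for y v K using that relpow_carrier[OF X(2) x(2)] by (auto simp: matched_def)
  have GH: "\<exists>v\<in>BH. ?m (s * R) y v" if mem: "y \<in> BG" for y
  proof -
    obtain k where k: "k \<le> s" "(x, y) \<in> edges ?G ^^ k" "y \<in> verts ?G"
      using mem unfolding BG_def verts_graph_ball by blast
    obtain v where v: "(u, v) \<in> edges ?H ^^ k" "?m (k * R) y v"
      using matched_ball[OF fin X(2) x(2) eq k(2) le_trans[OF kR(1)[OF k(1)] sR(1)]] by (elim exE conjE) (rule that)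
    have "v \<in> verts ?H" using carX'[OF v(2)] matched_label[OF v(2)] k(3) vG vH by simp
    then have "v \<in> BH" unfolding BH_def verts_graph_ball using v(1) k(1) by blast
    then show ?thesis using matched_mono[OF v(2) kR(1)[OF k(1)]] by (rule bexI[rotated])
  qed
  have HG: "\<exists>y\<in>BG. ?m (s * R) y v" if mem: "v \<in> BH" for v
  proof -
    obtain k where k: "k \<le> s" "(u, v) \<in> edges ?H ^^ k" "v \<in> verts ?H"
      using mem unfolding BH_def verts_graph_ball by blast
    obtain y where y: "(x, y) \<in> edges ?G ^^ k" "matched S' q S p N u x (k * R) v y"
      using matched_ball[OF fin(2,1) X(1) x(1) eq[symmetric] k(2) le_trans[OF kR(1)[OF k(1)] sR(1)]]
      by (elim exE conjE) (rule that)
    have y': "?m (k * R) y v" by (rule matched_commuteD) (rule y(2))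
    have "y \<in> verts ?G" using carX[OF y'] matched_label[OF y'] k(3) vG vH by simp
    then have "y \<in> BG" unfolding BG_def verts_graph_ball using y(1) k(1) by blast
    then show ?thesis using matched_mono[OF y' kR(1)[OF k(1)]] by (rule bexI[rotated])
  qed
  define f where "f y = (SOME v. v \<in> BH \<and> ?m (s * R) y v)" for y
  have f: "f y \<in> BH" "?m (s * R) y (f y)" if "y \<in> BG" for y
    using someI_ex[of "\<lambda>v. v \<in> BH \<and> ?m (s * R) y v"] GH[OF that] by (auto simp: f_def)
  have fK: "?m ?K y (f y)" if "y \<in> BG" for y
    by (rule matched_mono[OF f(2)[OF that]]) simp
  have edge: "(y, y') \<in> edges ?G \<longleftrightarrow> (f y, f y') \<in> edges ?H" if y: "y \<in> BG" "y' \<in> BG" for y y'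
  proof
    assume e: "(y, y') \<in> edges ?G"
    obtain v' where v': "(f y, v') \<in> edges ?H" "?m (s * R + R) y' v'"
      using matched_edge[OF fin X(2) x(2) f(2)[OF y(1)] e sR(2)] by (elim exE conjE) (rule that)
    then have "v' = f y'" using funR[OF _ fK[OF y(2)]] by (simp add: add.commute)
    then show "(f y, f y') \<in> edges ?H" using v' by simp
  next
    assume e: "(f y, f y') \<in> edges ?H"
    obtain z where z: "(y, z) \<in> edges ?G" "matched S' q S p N u x (s * R + R) (f y') z"
      using matched_edge[OF fin(2,1) X(1) x(1) matched_commuteD[OF f(2)[OF y(1)]] e sR(2)]
      by (elim exE conjE) (rule that)
    then have "z = y'" using funL[OF _ fK[OF y(2)]] matched_commuteD[OF z(2)] by (simp add: add.commute)
    then show "(y, y') \<in> edges ?G" using z by simp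
  qed
  have bij: "bij_betw f BG BH"
    unfolding bij_betw_def
  proof (intro conjI set_eqI iffI)
    show "inj_on f BG" using funL fK by (metis inj_onI)
    fix v assume "v \<in> BH"
    then obtain y where y: "y \<in> BG" "?m (s * R) y v" using HG by blast
    have "?m ?K y v" by (rule matched_mono[OF y(2)]) simp
    then have "v = f y" using funR fK[OF y(1)] by blast
    then show "v \<in> f ` BG" using y by blast
  qed (use f in auto)
  have fx: "f x = u" if "x \<in> BG"
  proof -
    have "?m ?K x u" using eq unfolding matched_def by (intro exI[of _ 0]) auto
    then show ?thesis using funR fK[OF that] by blast
  qed
  show ?thesis
  proof (cases "x \<in> BG")
    case True
    show ?thesis unfolding rooted_iso_def prod.case
    proof (intro exI[of _ f] conjI ballI)
      show "bij_betw f (verts (graph_ball s ?G x)) (verts (graph_ball s ?H u))"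
        using bij by (simp add: BG_def BH_def)
      show "f x = u" using fx True by simp
    next
      fix y y' assume "y \<in> verts (graph_ball s ?G x)" "y' \<in> verts (graph_ball s ?G x)"
      then have y: "y \<in> BG" "y' \<in> BG" by (auto simp: BG_def)
      have "(y, y') \<in> edges (graph_ball s ?G x) \<longleftrightarrow> (y, y') \<in> edges ?G"
        using y unfolding BG_def edges_graph_ball by blast
      moreover have "(f y, f y') \<in> edges (graph_ball s ?H u) \<longleftrightarrow> (f y, f y') \<in> edges ?H"
        using f(1)[OF y(1)] f(1)[OF y(2)] unfolding BH_def edges_graph_ball by blast
      ultimately show "(y, y') \<in> edges (graph_ball s ?G x) \<longleftrightarrow> (f y, f y') \<in> edges (graph_ball s ?H u)"
        using edge[OF y] by simp
    next
      fix y assume "y \<in> verts (graph_ball s ?G x)"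
      then have y: "y \<in> BG" by (auto simp: BG_def)
      show "color (graph_ball s ?H u) (f y) = color (graph_ball s ?G x) y"
        using matched_label[OF f(2)[OF y]] by (simp add: graph_ball_def decoded_graph_def Let_def)
    qed
  next
    \<comment> \<open>The root has colour \<open>0\<close>, so it is no vertex of the decoded graph
      and has no decoded edges. Both balls are empty, and only the roots have to correspond.\<close>
    case False
    have c0: "lab_col (p x) = 0"
      using False x vG root_in_ball[of x ?G s] by (auto simp: BG_def)
    have edgesG: "edges ?G `` {x} = {}" "edges ?H `` {u} = {}"
      using c0 pq by (auto simp: decoded_graph_def)
    have relx: "(a, y) \<in> r ^^ k \<longleftrightarrow> k = 0 \<and> y = a" if "r `` {a} = {}" for r :: "'z rel" and a y k
      using that by (cases k) (auto dest!: relpow_Suc_D2 simp del: relpow.simps(2))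
    have "y \<notin> BG" for y
    proof
      assume "y \<in> BG"
      then have "y = x" "y \<in> verts ?G" unfolding BG_def verts_graph_ball relx[OF edgesG(1)] by auto
      then show False using c0 vG by simp
    qed
    then have BG0: "BG = {}" by blast
    have "y \<notin> BH" for y
    proof
      assume "y \<in> BH"
      then have "y = u" "y \<in> verts ?H" unfolding BH_def verts_graph_ball relx[OF edgesG(2)] by auto
      then show False using c0 pq vH by simp
    qed
    then have BH0: "BH = {}" by blast
    show ?thesis using BG0 BH0
      unfolding rooted_iso_def prod.case BG_def BH_def by (intro exI[of _ "\<lambda>_. u"]) (auto simp: bij_betw_def)
  qed
qed

section \<open>Finite models of colour refinement\<close>

text \<open>A walk of the model between vertices with the same part lifts to a closed walk in the forest \<open>T\<close>,
  which backtracks. As neighbours have distinct parts, the walk itself backtracks at the same step and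
  can be shortened.\<close>

lemma inj_walks_model:
  assumes T: "acyclic_graph T" "irrefl T" "locally_finite T" "inj_walks T p N"
    and S: "locally_finite S" "S \<subseteq> U \<times> U" "sym S" "\<And>u. u \<in> U \<Longrightarrow> inj_on (\<lambda>v. lab_part (q v)) (S `` {u})"
    and real: "\<And>u. u \<in> U \<Longrightarrow> \<exists>x. wl S q N u = wl T p N x"
  shows "inj_walks S q N"
proof -
  have "u = v" if "(u, v) \<in> S ^^ j" "j \<le> N" "lab_part (q u) = lab_part (q v)" for u v j
    using that
  proof (induction j arbitrary: u v rule: less_induct)
    case (less j)
    show ?case
    proof (cases "j = 0")
      case True
      then show ?thesis using less.prems by simp
    next
      case False
      obtain f where f: "f 0 = u" "f j = v" "\<And>i. i < j \<Longrightarrow> (f i, f (Suc i)) \<in> S"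
        using less.prems(1) unfolding relpow_fun_conv by auto
      have "u \<in> U" using f(3)[of 0] False f(1) S(2) by auto
      then obtain x where x: "wl S q N (f 0) = wl T p N x" using real f(1) by auto
      obtain g where g: "g 0 = x" "\<forall>i<j. (g i, g (Suc i)) \<in> T"
          "\<forall>i\<le>j. wl S q (N - i) (f i) = wl T p (N - i) (g i)"
      proof -
        have "\<exists>g. g 0 = x \<and> (\<forall>i<j. (g i, g (Suc i)) \<in> T) \<and>
            (\<forall>i\<le>j. wl S q (N - i) (f i) = wl T p (N - i) (g i))"
          by (rule wl_walk[where f = f, OF S(1) T(3) x _ less.prems(2)]) (rule f(3))
        then show ?thesis by (elim exE conjE) (rule that)
      qed
      have lab: "q (f i) = p (g i)" if "i \<le> j" for i 
        by (rule wl_label[of S q "N - i" _ T]) (use g(3) that in blast)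
      have "(g 0, g j) \<in> T ^^ j" unfolding relpow_fun_conv using g(2) by auto
      moreover have "lab_part (p (g 0)) = lab_part (p (g j))"
        using lab[of 0] lab[of j] f less.prems(3) by simp
      ultimately have "g 0 = g j" using T(4) less.prems(2) unfolding inj_walks_def by blast
      then obtain i where i: "i + 2 \<le> j" "g i = g (i + 2)"
        using closed_walk_backtracks[OF T(1,2), of j g] g(2) False by auto
      have e: "(f i, f (Suc i)) \<in> S" "(f (Suc i), f (i + 2)) \<in> S" using f(3) i by auto
      have "(f 0, f i) \<in> S ^^ i" unfolding relpow_fun_conv using f(3) i by (intro exI[of _ f]) auto
      moreover have "(f (i + 2), f (i + 2 + (j - (i + 2)))) \<in> S ^^ (j - (i + 2))"
        unfolding relpow_fun_conv using f(3) i by (intro exI[of _ "\<lambda>k. f (i + 2 + k)"]) auto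
      moreover have "f i = f (i + 2)"
      proof (rule inj_onD[OF S(4)[of "f (Suc i)"]])
        show "f (Suc i) \<in> U" using e S(2) by auto
        show "lab_part (q (f i)) = lab_part (q (f (i + 2)))"
          using lab[of i] lab[of "i + 2"] g(3) i by simp
      qed (use e S(3) in \<open>auto dest: symD\<close>)
      ultimately have "(u, v) \<in> S ^^ (i + (j - (i + 2)))"
        using relpow_add_I f(1,2) i(1) by (metis le_add_diff_inverse)
      then show ?thesis using less.IH[of "i + (j - (i + 2))" u v] less.prems i by auto
    qed
  qed
  then show ?thesis unfolding inj_walks_def by blast
qed


text \<open>\<open>\<Sigma>\<close> is a set of codes of stars, of which \<open>lab\<close> and \<open>nbl\<close> return the label of the centre and the
  labels of its neighbours. By the balance condition the half-edges from \<open>a\<close> to \<open>b\<close> can be matched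
  with those from \<open>b\<close> to \<open>a\<close>.\<close>

lemma star_model:
  fixes n :: "nat \<Rightarrow> nat" and lab :: "nat \<Rightarrow> nat" and nbl :: "nat \<Rightarrow> nat set"
  assumes "finite \<Sigma>" and irr: "\<And>\<sigma>. \<sigma> \<in> \<Sigma> \<Longrightarrow> lab \<sigma> \<notin> nbl \<sigma>"
    and bal: "\<And>a b. (\<Sum>\<sigma> | \<sigma> \<in> \<Sigma> \<and> lab \<sigma> = a \<and> b \<in> nbl \<sigma>. n \<sigma>) = (\<Sum>\<sigma> | \<sigma> \<in> \<Sigma> \<and> lab \<sigma> = b \<and> a \<in> nbl \<sigma>. n \<sigma>)"
  obtains U :: "nat set" and S \<tau> where "finite U" "\<And>u. u \<in> U \<Longrightarrow> \<tau> u \<in> \<Sigma> \<and> 0 < n (\<tau> u)"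
    "\<And>\<sigma>. \<sigma> \<in> \<Sigma> \<Longrightarrow> card {u \<in> U. \<tau> u = \<sigma>} = n \<sigma>" "S \<subseteq> U \<times> U" "sym S"
    "\<And>u. u \<in> U \<Longrightarrow> inj_on (\<lambda>v. lab (\<tau> v)) (S `` {u})"
    "\<And>u. u \<in> U \<Longrightarrow> (\<lambda>v. lab (\<tau> v)) ` (S `` {u}) = nbl (\<tau> u)"
proof -
  define U where "U = prod_encode ` (SIGMA \<sigma>:\<Sigma>. {..<n \<sigma>})"
  define \<tau> where "\<tau> u = fst (prod_decode u)" for u
  have U: "finite U" using assms(1) by (auto simp: U_def)
  have \<tau>: "\<tau> u \<in> \<Sigma> \<and> 0 < n (\<tau> u)" if "u \<in> U" for u using that by (auto simp: U_def \<tau>_def)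
  have fib: "card {u \<in> U. \<tau> u = \<sigma>} = n \<sigma>" if "\<sigma> \<in> \<Sigma>" for \<sigma>
  proof -
    have "{u \<in> U. \<tau> u = \<sigma>} = (\<lambda>i. prod_encode (\<sigma>, i)) ` {..<n \<sigma>}"
      using that by (auto simp: U_def \<tau>_def)
    then show ?thesis by (simp add: card_image inj_on_def)
  qed
  define A where "A a b = {u \<in> U. lab (\<tau> u) = a \<and> b \<in> nbl (\<tau> u)}" for a b
  have cardA: "card (A a b) = (\<Sum>\<sigma> | \<sigma> \<in> \<Sigma> \<and> lab \<sigma> = a \<and> b \<in> nbl \<sigma>. n \<sigma>)" for a b
  proof -
    have "A a b = (\<Union>\<sigma>\<in>{\<sigma>\<in>\<Sigma>. lab \<sigma> = a \<and> b \<in> nbl \<sigma>}. {u \<in> U. \<tau> u = \<sigma>})"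
      using \<tau> by (auto simp: A_def)
    also have "card \<dots> = (\<Sum>\<sigma> | \<sigma> \<in> \<Sigma> \<and> lab \<sigma> = a \<and> b \<in> nbl \<sigma>. card {u \<in> U. \<tau> u = \<sigma>})"
      by (rule card_UN_disjoint) (use assms(1) U in auto)
    finally show ?thesis using fib by simp
  qed
  have "\<exists>h. bij_betw h (A a b) (A b a)" for a b
    by (rule finite_same_card_bij) (use U cardA bal in \<open>auto simp: A_def\<close>)
  then obtain h where h: "\<And>a b. bij_betw (h a b) (A a b) (A b a)" by metis
  \<comment> \<open>Using a bijection in one direction and its inverse in the other makes the gluing
    symmetric. The case \<open>a = b\<close> does not arise for actual half-edges, by
    \<open>irr\<close>.\<close>
  define m where "m a b = (if a < b then h a b else inv_into (A b a) (h b a))" for a b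
  have m: "m a b u \<in> A b a" "m b a (m a b u) = u" if "u \<in> A a b" "a \<noteq> b" for a b u
    using that bij_betwE[OF h[of a b]] bij_betwE[OF bij_betw_inv_into[OF h[of b a]]]
      bij_betw_inv_into_left[OF h[of a b]] bij_betw_inv_into_right[OF h[of b a]]
    by (auto simp: m_def)
  define S where "S = {(u, m (lab (\<tau> u)) b u) | u b. u \<in> U \<and> b \<in> nbl (\<tau> u)}"
  have mS: "u \<in> A (lab (\<tau> u)) b" "lab (\<tau> u) \<noteq> b" if "u \<in> U" "b \<in> nbl (\<tau> u)" for u b
    using that irr \<tau> by (auto simp: A_def)
  have mlab: "lab (\<tau> (m (lab (\<tau> u)) b u)) = b" "m (lab (\<tau> u)) b u \<in> U"
      "lab (\<tau> u) \<in> nbl (\<tau> (m (lab (\<tau> u)) b u))" if "u \<in> U" "b \<in> nbl (\<tau> u)" for u b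
    using m(1)[OF mS[OF that]] by (auto simp: A_def)
  have SU: "S `` {u} = (\<lambda>b. m (lab (\<tau> u)) b u) ` nbl (\<tau> u)" if "u \<in> U" for u
    using that by (auto simp: S_def)
  show ?thesis
  proof (rule that[of U \<tau> S, OF U \<tau> fib])
    show "S \<subseteq> U \<times> U" using mlab by (auto simp: S_def)
    show "sym S"
    proof (rule symI)
      fix u v assume "(u, v) \<in> S"
      then obtain b where b: "u \<in> U" "b \<in> nbl (\<tau> u)" "v = m (lab (\<tau> u)) b u" by (auto simp: S_def)
      have "u = m (lab (\<tau> v)) (lab (\<tau> u)) v" using m(2)[OF mS[OF b(1,2)]] mlab(1)[OF b(1,2)] b(3) by simp
      then show "(v, u) \<in> S" using mlab[OF b(1,2)] b(3) unfolding S_def by blast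
    qed
    fix u assume u: "u \<in> U"
    show "inj_on (\<lambda>v. lab (\<tau> v)) (S `` {u})" unfolding SU[OF u] using mlab(1)[OF u] by (auto simp: inj_on_def)
    show "(\<lambda>v. lab (\<tau> v)) ` (S `` {u}) = nbl (\<tau> u)"
      unfolding SU[OF u] image_image using mlab(1)[OF u] by simp
  qed
qed

section \<open>Colour refinement in the finite model\<close>

definition down :: "nat \<Rightarrow> nat \<Rightarrow> nat" where "down i = (\<lambda>l. fst (prod_decode l)) ^^ i"

text \<open>A colour has the colour of the previous round as its first component, so projecting
  undoes a round.\<close>

lemma down_wl: "down i (wl T p (k + i) x) = wl T p k x"
  by (induction i) (auto simp: down_def funpow_Suc_right simp del: funpow.simps(2))

text \<open>The neighbours of \<open>u\<close> are prescribed only by their types of depth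
  \<open>N\<close>; their own stars may differ from those around \<open>x\<close>. This is enough,
  because round \<open>Suc k\<close> at \<open>u\<close> looks only at round \<open>k\<close> of the
  neighbours, and \<open>k \<le> N\<close>.\<close>

lemma wl_model:
  assumes T: "locally_finite T" and S: "S \<subseteq> U \<times> U"
    and real: "\<And>u. u \<in> U \<Longrightarrow> \<exists>x. \<tau> u = wl T p (Suc N) x"
    and nb: "\<And>u. u \<in> U \<Longrightarrow> (\<lambda>v. fst (prod_decode (\<tau> v))) ` (S `` {u}) = set_decode (snd (prod_decode (\<tau> u)))"
    and "u \<in> U" "k \<le> Suc N"
  shows "wl S (\<lambda>u. down (Suc N) (\<tau> u)) k u = down (Suc N - k) (\<tau> u)"
  using \<open>u \<in> U\<close> \<open>k \<le> Suc N\<close>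
proof (induction k arbitrary: u)
  case (Suc k)
  let ?q = "\<lambda>u. down (Suc N) (\<tau> u)"
  obtain x where x: "\<tau> u = wl T p (Suc N) x" using real Suc.prems by blast
  have dS: "down (Suc N - k) l = down (N - k) (fst (prod_decode l))" for l
    using Suc.prems(2) by (simp add: down_def Suc_diff_le funpow_Suc_right del: funpow.simps(2))
  have fin: "finite (wl T p N ` (T `` {x}))" using T by (simp add: locally_finite_def)
  have "wl S ?q k ` (S `` {u}) = (\<lambda>v. down (N - k) (fst (prod_decode (\<tau> v)))) ` (S `` {u})"
    using S Suc by (intro image_cong) (auto simp: dS)
  also have "\<dots> = down (N - k) ` (\<lambda>v. fst (prod_decode (\<tau> v))) ` (S `` {u})"
    by (simp add: image_image)
  also have "(\<lambda>v. fst (prod_decode (\<tau> v))) ` (S `` {u}) = wl T p N ` (T `` {x})"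
    using nb[OF Suc.prems(1)] fin by (simp add: x)
  also have "down (N - k) ` wl T p N ` (T `` {x}) = wl T p k ` (T `` {x})"
    using down_wl[of "N - k" T p k] Suc.prems(2) by (simp add: image_image)
  finally have "wl S ?q k ` (S `` {u}) = wl T p k ` (T `` {x})" .
  moreover have "wl S ?q k u = wl T p k x"
    using Suc down_wl[of "N - k" T p k x] by (simp add: dS x)
  ultimately have "wl S ?q (Suc k) u = wl T p (Suc k) x" by simp
  also have "\<dots> = down (Suc N - Suc k) (\<tau> u)"
    using down_wl[of "N - k" T p "Suc k" x] Suc.prems(2) by (simp add: x)
  finally show ?case .
qed simp

text \<open>The approximation error of a partial sum is below \<open>1/2\<close>, so an integer equation between partial
  sums that holds for the real solution holds exactly for its approximation.\<close>

lemma integer_solution: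
  fixes w :: "nat \<Rightarrow> real"
  assumes "finite \<Sigma>" and w: "\<And>\<sigma>. \<sigma> \<in> \<Sigma> \<Longrightarrow> 0 \<le> w \<sigma>" "(\<Sum>\<sigma>\<in>\<Sigma>. w \<sigma>) = 1" and "0 < \<epsilon>"
  obtains n :: "nat \<Rightarrow> nat" and Q :: nat where "0 < Q" "(\<Sum>\<sigma>\<in>\<Sigma>. n \<sigma>) = Q"
    "\<And>\<sigma>. \<sigma> \<in> \<Sigma> \<Longrightarrow> \<bar>real (n \<sigma>) / Q - w \<sigma>\<bar> \<le> \<epsilon>" "\<And>\<sigma>. \<sigma> \<in> \<Sigma> \<Longrightarrow> 0 < n \<sigma> \<Longrightarrow> 0 < w \<sigma>"
    "\<And>A B. A \<subseteq> \<Sigma> \<Longrightarrow> B \<subseteq> \<Sigma> \<Longrightarrow> (\<Sum>\<sigma>\<in>A. w \<sigma>) = (\<Sum>\<sigma>\<in>B. w \<sigma>) \<Longrightarrow> (\<Sum>\<sigma>\<in>A. n \<sigma>) = (\<Sum>\<sigma>\<in>B. n \<sigma>)"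
proof -
  obtain e where e: "bij_betw e {..<card \<Sigma>} \<Sigma>"
    using ex_bij_betw_nat_finite[OF assms(1)] by (auto simp: lessThan_atLeast0)
  let ?i = "inv_into {..<card \<Sigma>} e"
  have i: "?i \<sigma> < card \<Sigma>" "e (?i \<sigma>) = \<sigma>" if "\<sigma> \<in> \<Sigma>" for \<sigma>
    using that e bij_betw_inv_into[OF e] by (auto simp: bij_betw_inv_into_right dest: bij_betwE)
  obtain K where K: "1 / \<epsilon> < real K" using reals_Archimedean2 by blast
  \<comment> \<open>The bound \<open>K\<close> gives precision \<open>\<epsilon>\<close>. Exceeding
    \<open>2 * card \<Sigma>\<close> keeps the error of a partial sum below \<open>1/2\<close>.
    Exceeding 1 makes the approximating integers nonnegative, and positive only where
    \<open>w\<close> is.\<close>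
  define N where "N = max K (2 * card \<Sigma> + 2)"
  have N: "0 < N" "1 / real N \<le> \<epsilon>" "2 * card \<Sigma> < N" "1 < N"
  proof -
    have "1 / \<epsilon> \<le> real N" using K by (simp add: N_def)
    moreover have "0 < real N" by (simp add: N_def)
    ultimately show "1 / real N \<le> \<epsilon>" using assms(4) by (simp add: field_simps)
  qed (auto simp: N_def)
  obtain q p where qp: "0 < q" "\<And>i. i < card \<Sigma> \<Longrightarrow> \<bar>of_int q * w (e i) - of_int (p i)\<bar> < 1 / real N"
    using Dirichlet_approx_simult[OF N(1), of "card \<Sigma>" "\<lambda>i. w (e i)"] by metis
  define Q where "Q = nat q"
  define n where "n \<sigma> = nat (p (?i \<sigma>))" for \<sigma>
  have Q: "0 < Q" "real_of_int q = real Q" using qp(1) by (auto simp: Q_def)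
  have inv1: "1 / real N < 1" using N(4) by simp
  have close: "\<bar>real Q * w \<sigma> - real (n \<sigma>)\<bar> < 1 / real N" if "\<sigma> \<in> \<Sigma>" for \<sigma>
  proof -
    have a: "\<bar>real Q * w \<sigma> - of_int (p (?i \<sigma>))\<bar> < 1 / real N"
      using qp(2)[OF i(1)[OF that]] i(2)[OF that] Q by simp
    have "0 \<le> real Q * w \<sigma>" using w(1)[OF that] by simp
    then have "- 1 < real_of_int (p (?i \<sigma>))" using a inv1 by linarith
    then have "0 \<le> p (?i \<sigma>)" by linarith
    then show ?thesis using a by (simp add: n_def)
  qed
  have err: "\<bar>(\<Sum>\<sigma>\<in>A. real Q * w \<sigma>) - (\<Sum>\<sigma>\<in>A. real (n \<sigma>))\<bar> \<le> card \<Sigma> / real N" if "A \<subseteq> \<Sigma>" for A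
  proof -
    have "\<bar>(\<Sum>\<sigma>\<in>A. real Q * w \<sigma>) - (\<Sum>\<sigma>\<in>A. real (n \<sigma>))\<bar> \<le> (\<Sum>\<sigma>\<in>A. \<bar>real Q * w \<sigma> - real (n \<sigma>)\<bar>)"
      by (simp add: sum_subtractf[symmetric])
    also have "\<dots> \<le> (\<Sum>\<sigma>\<in>A. 1 / real N)"
      using close that by (intro sum_mono) (auto intro: less_imp_le)
    also have "\<dots> = card A / real N" by simp
    also have "\<dots> \<le> card \<Sigma> / real N"
      using card_mono[OF assms(1) that] by (simp add: divide_right_mono)
    finally show ?thesis .
  qed
  have small: "2 * (card \<Sigma> / real N) < 1" using N(1,3) by (simp add: field_simps)
  show ?thesis
  proof (rule that[OF Q(1)])
    have "\<bar>real Q - real (\<Sum>\<sigma>\<in>\<Sigma>. n \<sigma>)\<bar> < 1"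
      using err[of \<Sigma>] small w(2) by (simp add: sum_distrib_left[symmetric])
    then show "(\<Sum>\<sigma>\<in>\<Sigma>. n \<sigma>) = Q" by linarith
  next
    fix \<sigma> assume \<sigma>: "\<sigma> \<in> \<Sigma>"
    have "\<bar>real (n \<sigma>) / Q - w \<sigma>\<bar> = \<bar>real Q * w \<sigma> - real (n \<sigma>)\<bar> / Q"
    proof -
      have "real (n \<sigma>) / Q - w \<sigma> = (real (n \<sigma>) - real Q * w \<sigma>) / Q"
        using Q(1) by (simp add: field_simps)
      then show ?thesis by (simp add: abs_minus_commute)
    qed
    also have "\<dots> \<le> \<bar>real Q * w \<sigma> - real (n \<sigma>)\<bar>"
      using Q(1) by (simp add: divide_le_eq mult_left_le mult_le_cancel_left1)
    also have "\<dots> \<le> \<epsilon>" using close[OF \<sigma>] N(2) by linarith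
    finally show "\<bar>real (n \<sigma>) / Q - w \<sigma>\<bar> \<le> \<epsilon>" .
    assume "0 < n \<sigma>"
    then have "1 \<le> real (n \<sigma>)" by simp
    then have "0 < real Q * w \<sigma>" using close[OF \<sigma>] inv1 by linarith
    then show "0 < w \<sigma>" using Q(1) by (simp add: zero_less_mult_iff)
  next
    fix A B assume AB: "A \<subseteq> \<Sigma>" "B \<subseteq> \<Sigma>" "(\<Sum>\<sigma>\<in>A. w \<sigma>) = (\<Sum>\<sigma>\<in>B. w \<sigma>)"
    then have "(\<Sum>\<sigma>\<in>A. real Q * w \<sigma>) = (\<Sum>\<sigma>\<in>B. real Q * w \<sigma>)" by (simp add: sum_distrib_left[symmetric])
    then have "\<bar>real (\<Sum>\<sigma>\<in>A. n \<sigma>) - real (\<Sum>\<sigma>\<in>B. n \<sigma>)\<bar> < 1"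
      using err[OF AB(1)] err[OF AB(2)] small by simp
    then show "(\<Sum>\<sigma>\<in>A. n \<sigma>) = (\<Sum>\<sigma>\<in>B. n \<sigma>)" by linarith
  qed
qed

section \<open>Unions of graphs of Borel functions\<close>

definition diagonal_measurable :: "'v measure \<Rightarrow> bool" where
  "diagonal_measurable M \<longleftrightarrow> (\<forall>g\<in>measurable M M. \<forall>h\<in>measurable M M. {x \<in> space M. g x = h x} \<in> sets M)"

text \<open>Each bit asks whether the code of a point in Baire space has a given entry at a given
  place. Finitely many bits at a time will serve as the finite Borel partitions.\<close>

lemma standard_borel_separating_sequence:
  assumes "standard_borel M" "space M \<noteq> {}"
  obtains b :: "nat \<Rightarrow> 'v \<Rightarrow> bool" where "\<And>i. {x \<in> space M. b i x} \<in> sets M"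
    "\<And>x y. x \<in> space M \<Longrightarrow> y \<in> space M \<Longrightarrow> x \<noteq> y \<Longrightarrow> \<exists>i. b i x \<noteq> b i y"
proof -
  obtain \<psi> \<phi> where \<psi>: "\<psi> \<in> measurable M baire" and \<phi>: "\<phi> \<in> measurable baire M"
    and retr: "\<And>x. x \<in> space M \<Longrightarrow> \<phi> (\<psi> x) = x"
    using standard_borel_retract[OF assms] by blast
  define b where "b i x \<longleftrightarrow> \<psi> x (fst (prod_decode i)) = snd (prod_decode i)" for i x
  show ?thesis
  proof
    fix i
    have "{x \<in> space M. b i x} = \<psi> -` {h. h (fst (prod_decode i)) = snd (prod_decode i)} \<inter> space M"
      by (auto simp: b_def)
    also have "\<dots> \<in> sets M"
      using cylinder_in_baire[of "\<lambda>v. v = snd (prod_decode i)" "fst (prod_decode i)"]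
      by (rule measurable_sets[OF \<psi>])
    finally show "{x \<in> space M. b i x} \<in> sets M" .
  next
    fix x y assume xy: "x \<in> space M" "y \<in> space M" "x \<noteq> y"
    then have "\<psi> x \<noteq> \<psi> y" using retr by metis
    then obtain n where "\<psi> x n \<noteq> \<psi> y n" by auto
    then have "b (prod_encode (n, \<psi> x n)) x \<noteq> b (prod_encode (n, \<psi> x n)) y" by (simp add: b_def)
    then show "\<exists>i. b i x \<noteq> b i y" by blast
  qed
qed

lemma standard_borel_diagonal:
  assumes "standard_borel M"
  shows "diagonal_measurable M"
proof (cases "space M = {}")
  case False
  obtain b :: "nat \<Rightarrow> 'a \<Rightarrow> bool" where b: "\<And>i. {x \<in> space M. b i x} \<in> sets M"
    "\<And>x y. x \<in> space M \<Longrightarrow> y \<in> space M \<Longrightarrow> x \<noteq> y \<Longrightarrow> \<exists>i. b i x \<noteq> b i y"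
    using standard_borel_separating_sequence[OF assms False] by blast
  show ?thesis unfolding diagonal_measurable_def
  proof (intro ballI)
    fix g h assume gh: "g \<in> measurable M M" "h \<in> measurable M M"
    have "Measurable.pred M (b i)" for i using b(1)[of i] by (simp add: pred_def)
    note * = measurable_compose[OF gh(1) this] measurable_compose[OF gh(2) this]
    have "{x \<in> space M. g x = h x} = {x \<in> space M. \<forall>i. b i (g x) = b i (h x)}"
      using b(2) measurable_space[OF gh(1)] measurable_space[OF gh(2)] by fastforce
    also have "\<dots> \<in> sets M"
    proof -
      have "Measurable.pred M (\<lambda>x. \<forall>i. b i (g x) = b i (h x))"
        using * by measurable
      then show ?thesis by (simp add: pred_def)
    qed
    finally show "{x \<in> space M. g x = h x} \<in> sets M" .
  qed
qed (simp add: diagonal_measurable_def)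

lemma graph_unionI':
  assumes "\<And>i::'i::countable. g i \<in> measurable M M" "\<And>i. D i \<in> sets M"
    and E: "\<And>x y. (x, y) \<in> E \<longleftrightarrow> (\<exists>i. x \<in> D i \<and> y = g i x)"
  shows "graph_union M E"
proof (rule graph_unionI[of UNIV g M D])
  have "p \<in> E \<longleftrightarrow> p \<in> {(x, g i x) |i x. i \<in> UNIV \<and> x \<in> D i}" for p
    using E[of "fst p" "snd p"] by (cases p) auto
  then show "E = {(x, g i x) |i x. i \<in> UNIV \<and> x \<in> D i}" by blast
qed (use assms(1,2) in auto)

lemma graph_union_space: "graph_union M E \<Longrightarrow> E \<subseteq> space M \<times> space M"
  unfolding graph_union_def by (auto dest: sets.sets_into_space measurable_space)

lemma graph_union_Domain:
  assumes "graph_union M E"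
  shows "Domain E \<in> sets M"
proof -
  obtain g D where g: "\<And>n::nat. g n \<in> measurable M M" "\<And>n. D n \<in> sets M"
    "\<And>x y. (x, y) \<in> E \<longleftrightarrow> (\<exists>n. x \<in> D n \<and> y = g n x)"
    by (rule graph_unionE[OF assms]) (rule that; assumption)
  have "Domain E = (\<Union>n. D n)" using g(3) by blast
  then show ?thesis using g(2) by auto
qed

lemma graph_union_empty: "graph_union M {}"
  by (rule graph_unionI[of "{}"]) auto

lemma graph_union_UN:
  fixes E :: "nat \<Rightarrow> 'v rel"
  assumes "\<And>n. graph_union M (E n)"
  shows "graph_union M (\<Union>n. E n)"
proof -
  have "\<exists>g D. (\<forall>k::nat. g k \<in> measurable M M) \<and> (\<forall>k. D k \<in> sets M) \<and>
      (\<forall>x y. (x, y) \<in> E n \<longleftrightarrow> (\<exists>k. x \<in> D k \<and> y = g k x))" for n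
    by (rule graph_unionE[OF assms[of n]]) (intro exI conjI allI; assumption)
  then obtain g D where g: "\<And>n k::nat. g n k \<in> measurable M M" "\<And>n k. D n k \<in> sets M"
    "\<And>n x y. (x, y) \<in> E n \<longleftrightarrow> (\<exists>k. x \<in> D n k \<and> y = g n k x)"
    by metis
  show ?thesis
  proof (rule graph_unionI'[of "\<lambda>(n, k). g n k" M "\<lambda>(n, k). D n k"])
    fix x y
    show "(x, y) \<in> (\<Union>n. E n) \<longleftrightarrow> (\<exists>i. x \<in> (case i of (n, k) \<Rightarrow> D n k) \<and> y = (case i of (n, k) \<Rightarrow> g n k) x)"
      using g(3) by simp
  qed (simp_all add: g(1,2) split_beta)
qed

lemma graph_union_UN_le:
  assumes "\<And>n::nat. n \<le> R \<Longrightarrow> graph_union M (E n)"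
  shows "graph_union M (\<Union>n\<le>R. E n)"
proof -
  have "(\<Union>n\<le>R. E n) = (\<Union>n. if n \<le> R then E n else {})" by (auto split: if_splits)
  moreover have "graph_union M (\<Union>n. if n \<le> R then E n else {})"
    by (rule graph_union_UN) (simp add: assms graph_union_empty)
  ultimately show ?thesis by simp
qed

lemma graph_union_Id: "graph_union M (Id_on (space M))"
  by (rule graph_unionI[of "{()}" "\<lambda>_ x. x" M "\<lambda>_. space M"]) auto

lemma graph_union_relcomp:
  assumes "graph_union M E" "graph_union M F"
  shows "graph_union M (E O F)"
proof -
  obtain g D where g: "\<And>n::nat. g n \<in> measurable M M" "\<And>n. D n \<in> sets M"
    "\<And>x y. (x, y) \<in> E \<longleftrightarrow> (\<exists>n. x \<in> D n \<and> y = g n x)"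
    by (rule graph_unionE[OF assms(1)]) (rule that; assumption)
  obtain h C where h: "\<And>n::nat. h n \<in> measurable M M" "\<And>n. C n \<in> sets M"
    "\<And>x y. (x, y) \<in> F \<longleftrightarrow> (\<exists>n. x \<in> C n \<and> y = h n x)"
    by (rule graph_unionE[OF assms(2)]) (rule that; assumption)
  have Dsp: "D n \<subseteq> space M" for n using g(2) sets.sets_into_space by blast
  show ?thesis
  proof (rule graph_unionI[of UNIV "\<lambda>(n, m) x. h m (g n x)" M "\<lambda>(n, m). D n \<inter> (g n -` C m \<inter> space M)"])
    show "E O F = {(x, (case i of (n, m) \<Rightarrow> \<lambda>x. h m (g n x)) x) |i x. i \<in> UNIV \<and>
        x \<in> (case i of (n, m) \<Rightarrow> D n \<inter> (g n -` C m \<inter> space M))}" (is "_ = ?R")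
    proof (intro set_eqI)
      fix p :: "'a \<times> 'a"
      obtain x z where p: "p = (x, z)" by force
      have "p \<in> E O F \<longleftrightarrow> (\<exists>y. (x, y) \<in> E \<and> (y, z) \<in> F)" using p by auto
      also have "\<dots> \<longleftrightarrow> (\<exists>n m. x \<in> D n \<and> g n x \<in> C m \<and> z = h m (g n x))"
        unfolding g(3) h(3) by blast
      also have "\<dots> \<longleftrightarrow> p \<in> ?R" using p Dsp by auto
      finally show "p \<in> E O F \<longleftrightarrow> p \<in> ?R" .
    qed
    fix i :: "nat \<times> nat"
    obtain n m where i: "i = (n, m)" by force
    show "(case i of (n, m) \<Rightarrow> \<lambda>x. h m (g n x)) \<in> measurable M M"
      unfolding i prod.case by (rule measurable_compose[OF g(1) h(1)])
    show "(case i of (n, m) \<Rightarrow> D n \<inter> (g n -` C m \<inter> space M)) \<in> sets M"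
      unfolding i prod.case by (intro sets.Int g(2) measurable_sets[OF g(1) h(2)])
  qed (rule countableI_type)
qed

text \<open>\<open>E ^^ 0\<close> is the identity on the whole type, hence the factor
  \<open>Id_on (space M)\<close>.\<close>

lemma graph_union_relpow:
  assumes "graph_union M E"
  shows "graph_union M (Id_on (space M) O E ^^ j)"
proof (induction j)
  case 0
  then show ?case using graph_union_Id by simp
next
  case (Suc j)
  then show ?case using graph_union_relcomp[OF Suc assms] by (simp add: O_assoc)
qed

lemma graph_union_Collect:
  assumes "graph_union M E" and P: "\<And>g. g \<in> measurable M M \<Longrightarrow> {x \<in> space M. P x (g x)} \<in> sets M"
  shows "graph_union M {(x, y). (x, y) \<in> E \<and> P x y}"
proof -
  obtain g D where g: "\<And>n::nat. g n \<in> measurable M M" "\<And>n. D n \<in> sets M"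
    "\<And>x y. (x, y) \<in> E \<longleftrightarrow> (\<exists>n. x \<in> D n \<and> y = g n x)"
    by (rule graph_unionE[OF assms(1)]) (rule that; assumption)
  have Dsp: "D n \<subseteq> space M" for n using g(2) sets.sets_into_space by blast
  show ?thesis
  proof (rule graph_unionI'[of g M "\<lambda>n. D n \<inter> {x \<in> space M. P x (g n x)}"])
    fix x y
    show "(x, y) \<in> {(x, y). (x, y) \<in> E \<and> P x y} \<longleftrightarrow> (\<exists>n. x \<in> D n \<inter> {x \<in> space M. P x (g n x)} \<and> y = g n x)"
      using g(3)[of x y] Dsp by blast
  qed (auto intro!: g P)
qed

lemma graph_union_section_measurable:
  assumes "graph_union M F" "diagonal_measurable M" "h \<in> measurable M M"
  shows "{x \<in> space M. (x, h x) \<in> F} \<in> sets M"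
proof -
  obtain g D where g: "\<And>n::nat. g n \<in> measurable M M" "\<And>n. D n \<in> sets M"
    "\<And>x y. (x, y) \<in> F \<longleftrightarrow> (\<exists>n. x \<in> D n \<and> y = g n x)"
    by (rule graph_unionE[OF assms(1)]) (rule that; assumption)
  have "{x \<in> space M. (x, h x) \<in> F} = (\<Union>n. D n \<inter> {x \<in> space M. h x = g n x})"
    using sets.sets_into_space[OF g(2)] by (auto simp: g(3))
  also have "\<dots> \<in> sets M"
    using assms(2,3) g unfolding diagonal_measurable_def by (intro sets.countable_UN'' sets.Int) auto
  finally show ?thesis .
qed

text \<open>Complements need not stay in the class, but differences do: along each function that
  contributes to \<open>E\<close>, membership in \<open>F\<close> is a Borel condition on the
  argument.\<close>

lemma graph_union_Diff:
  assumes "graph_union M E" "graph_union M F" "diagonal_measurable M"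
  shows "graph_union M (E - F)"
proof -
  have "{x \<in> space M. (x, g x) \<notin> F} \<in> sets M" if "g \<in> measurable M M" for g
  proof -
    have "{x \<in> space M. (x, g x) \<notin> F} = space M - {x \<in> space M. (x, g x) \<in> F}" by auto
    then show ?thesis using graph_union_section_measurable[OF assms(2,3) that] by simp
  qed
  then have "graph_union M {(x, y). (x, y) \<in> E \<and> (x, y) \<notin> F}"
    by (rule graph_union_Collect[OF assms(1)])
  moreover have "{(x, y). (x, y) \<in> E \<and> (x, y) \<notin> F} = E - F" by auto
  ultimately show ?thesis by simp
qed

lemma graph_union_restrict:
  assumes "graph_union M E" "A \<in> sets M" "B \<in> sets M"
  shows "graph_union M (E \<inter> A \<times> B)"
proof -
  have "{x \<in> space M. x \<in> A \<and> g x \<in> B} \<in> sets M" if "g \<in> measurable M M" for g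
  proof -
    have "{x \<in> space M. x \<in> A \<and> g x \<in> B} = A \<inter> (g -` B \<inter> space M)"
      using sets.sets_into_space[OF assms(2)] by auto
    then show ?thesis using measurable_sets[OF that assms(3)] assms(2) by simp
  qed
  then have "graph_union M {(x, y). (x, y) \<in> E \<and> x \<in> A \<and> y \<in> B}"
    by (rule graph_union_Collect[OF assms(1)])
  moreover have "{(x, y). (x, y) \<in> E \<and> x \<in> A \<and> y \<in> B} = E \<inter> A \<times> B" by auto
  ultimately show ?thesis by simp
qed

section \<open>Borel functions with finitely many values\<close>

definition fin_measurable :: "'v measure \<Rightarrow> ('v \<Rightarrow> nat) \<Rightarrow> bool" where
  "fin_measurable M f \<longleftrightarrow> finite (f ` space M) \<and> (\<forall>l. {x \<in> space M. f x = l} \<in> sets M)"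

lemma fin_measurable_sets:
  assumes "fin_measurable M f"
  shows "{x \<in> space M. P (f x)} \<in> sets M"
proof -
  have "{x \<in> space M. P (f x)} = (\<Union>l. if P l then {x \<in> space M. f x = l} else {})"
    by (auto split: if_splits)
  also have "\<dots> \<in> sets M" using assms by (intro sets.countable_UN'') (auto simp: fin_measurable_def)
  finally show ?thesis .
qed

lemma fin_measurable_pair:
  assumes "fin_measurable M f" "fin_measurable M g"
  shows "fin_measurable M (\<lambda>x. h (f x) (g x))"
  unfolding fin_measurable_def
proof (intro conjI allI)
  have "(\<lambda>x. h (f x) (g x)) ` space M \<subseteq> (\<lambda>(a, b). h a b) ` (f ` space M \<times> g ` space M)" by force
  then show "finite ((\<lambda>x. h (f x) (g x)) ` space M)"
    using assms by (meson finite_SigmaI finite_imageI finite_subset fin_measurable_def)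
  fix l
  have "{x \<in> space M. h (f x) (g x) = l} = (\<Union>a. {x \<in> space M. f x = a} \<inter> {x \<in> space M. h a (g x) = l})"
    by auto
  also have "\<dots> \<in> sets M"
    using assms(1) fin_measurable_sets[OF assms(2)]
    by (intro sets.countable_UN'' sets.Int) (auto simp: fin_measurable_def)
  finally show "{x \<in> space M. h (f x) (g x) = l} \<in> sets M" .
qed

text \<open>That the value \<open>b\<close> occurs among the neighbours is a Borel condition, being
  the domain of a restricted \<open>graph_union\<close>. Finitely many such conditions determine the
  code.\<close>

lemma fin_measurable_nbs:
  assumes E: "graph_union M E" and f: "fin_measurable M f"
  shows "fin_measurable M (\<lambda>x. set_encode (f ` (E `` {x})))"
proof -
  let ?K = "f ` space M"
  have K: "finite ?K" using f by (simp add: fin_measurable_def)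
  have sub: "f ` (E `` {x}) \<subseteq> ?K" for x using graph_union_space[OF E] by auto
  have nb: "{x \<in> space M. b \<in> f ` (E `` {x})} \<in> sets M" for b
  proof -
    have "{x \<in> space M. b \<in> f ` (E `` {x})} = Domain (E \<inter> space M \<times> {y \<in> space M. f y = b})"
      using graph_union_space[OF E] by (auto simp: image_iff Bex_def)
    then show ?thesis using f graph_union_Domain[OF graph_union_restrict[OF E sets.top, of "{y \<in> space M. f y = b}"]]
      by (simp add: fin_measurable_def)
  qed
  show ?thesis unfolding fin_measurable_def
  proof (intro conjI allI)
    have "(\<lambda>x. set_encode (f ` (E `` {x}))) ` space M \<subseteq> set_encode ` Pow ?K" using sub by blast
    then show "finite ((\<lambda>x. set_encode (f ` (E `` {x}))) ` space M)"
      using K by (meson finite_Pow_iff finite_imageI finite_subset)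
    fix l
    have eq: "{x \<in> space M. set_encode (f ` (E `` {x})) = l} =
       (\<Union>B\<in>{B \<in> Pow ?K. set_encode B = l}. space M \<inter> (\<Inter>b\<in>?K. if b \<in> B then {x \<in> space M. b \<in> f ` (E `` {x})}
          else space M - {x \<in> space M. b \<in> f ` (E `` {x})}))" (is "?L = ?R")
    proof (intro set_eqI iffI)
      fix x assume x: "x \<in> ?L"
      have "x \<in> (if b \<in> f ` (E `` {x}) then {x \<in> space M. b \<in> f ` (E `` {x})}
          else space M - {x \<in> space M. b \<in> f ` (E `` {x})})" for b
        using x by simp
      then show "x \<in> ?R" using x sub[of x] by (intro UN_I[of "f ` (E `` {x})"]) auto
    next
      fix x assume "x \<in> ?R"
      then obtain B where B: "B \<subseteq> ?K" "set_encode B = l" "x \<in> space M"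
        "\<And>b. b \<in> ?K \<Longrightarrow> x \<in> (if b \<in> B then {x \<in> space M. b \<in> f ` (E `` {x})}
          else space M - {x \<in> space M. b \<in> f ` (E `` {x})})"
        by blast
      have "b \<in> f ` (E `` {x}) \<longleftrightarrow> b \<in> B" if "b \<in> ?K" for b
        using B(4)[OF that] by (simp split: if_splits)
      then have "f ` (E `` {x}) = B" using sub[of x] B(1) by blast
      then show "x \<in> ?L" using B by simp
    qed
    have fin: "finite {B \<in> Pow ?K. set_encode B = l}" using K by simp
    show "{x \<in> space M. set_encode (f ` (E `` {x})) = l} \<in> sets M"
      unfolding eq
    proof (intro sets.finite_UN fin)
      fix B
      have *: "(if b \<in> B then {x \<in> space M. b \<in> f ` (E `` {x})}
          else space M - {x \<in> space M. b \<in> f ` (E `` {x})}) \<in> sets M" for b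
        using nb by simp
      show "space M \<inter> (\<Inter>b\<in>?K. if b \<in> B then {x \<in> space M. b \<in> f ` (E `` {x})}
          else space M - {x \<in> space M. b \<in> f ` (E `` {x})}) \<in> sets M"
      proof (cases "?K = {}")
        case False
        then show ?thesis by (intro sets.Int sets.finite_INT * K sets.top)
      qed simp
    qed
  qed
qed

lemma fin_measurable_wl:
  assumes "graph_union M E" "fin_measurable M p"
  shows "fin_measurable M (wl E p k)"
proof (induction k)
  case 0
  then show ?case using assms(2) by (simp add: fin_measurable_def)
next
  case (Suc k)
  have "wl E p (Suc k) = (\<lambda>x. prod_encode (wl E p k x, set_encode (wl E p k ` (E `` {x}))))" by auto
  then show ?case
    using fin_measurable_pair[OF Suc fin_measurable_nbs[OF assms(1) Suc], of "\<lambda>a b. prod_encode (a, b)"] by simp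
qed

section \<open>Finite models of labelled treeings\<close>

declare wl.simps(2) [simp del]

text \<open>The invariance clause of \<open>graphing\<close>, isolated so that it can be passed on
  to truncated forests by itself.\<close>

definition mass_transport :: "'v measure \<Rightarrow> 'v rel \<Rightarrow> bool" where
  "mass_transport M E \<longleftrightarrow> (\<forall>A\<in>sets M. \<forall>B\<in>sets M.
     (\<integral>\<^sup>+x\<in>A. of_nat (deg_in E B x) \<partial>M) = (\<integral>\<^sup>+x\<in>B. of_nat (deg_in E A x) \<partial>M))"

lemma (in prob_space) prob_fibres:
  assumes f: "fin_measurable M f"
  shows "prob {x \<in> space M. P (f x)} = (\<Sum>l | l \<in> f ` space M \<and> P l. prob {x \<in> space M. f x = l})"
proof -
  let ?I = "{l \<in> f ` space M. P l}"
  have "{x \<in> space M. P (f x)} = (\<Union>l\<in>?I. {x \<in> space M. f x = l})" by auto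
  also have "prob \<dots> = (\<Sum>l\<in>?I. prob {x \<in> space M. f x = l})"
    using f by (intro finite_measure_finite_Union) (auto simp: fin_measurable_def disjoint_family_on_def)
  finally show ?thesis .
qed

lemma inj_walks_neighbours:
  assumes "sym T" "inj_walks T p N" "2 \<le> N"
  shows "inj_on (\<lambda>y. lab_part (p y)) (T `` {x})"
proof (rule inj_onI)
  fix y z assume yz: "y \<in> T `` {x}" "z \<in> T `` {x}" "lab_part (p y) = lab_part (p z)"
  then have "(y, z) \<in> T ^^ 2" using assms(1) by (auto simp: numeral_2_eq_2 dest: symD)
  then show "y = z" using assms(2,3) yz(3) unfolding inj_walks_def by blast
qed

text \<open>A type of depth \<open>Suc N\<close> is a star: its components are the type of depth
  \<open>N\<close> of the centre and the set of those of the neighbours. Good frequencies of stars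
  therefore give good frequencies of all types of depth \<open>N\<close>.\<close>

theorem finite_model:
  fixes M :: "'v measure"
  assumes "prob_space M" and gu: "graph_union M T" and T: "sym T" "irrefl T" "acyclic_graph T" "locally_finite T"
    and mt: "mass_transport M T" and p: "fin_measurable M p" and inj: "inj_walks T p N" and N: "2 \<le> N"
    and "0 < \<epsilon>"
  obtains U :: "nat set" and S q where "finite U" "U \<noteq> {}" "S \<subseteq> U \<times> U" "sym S" "locally_finite S" "inj_walks S q N"
    "\<And>u. u \<in> U \<Longrightarrow> \<exists>x\<in>space M. wl S q N u = wl T p N x"
    "\<And>P. \<bar>card {u \<in> U. P (wl S q N u)} / card U - measure M {x \<in> space M. P (wl T p N x)}\<bar> \<le> \<epsilon>"
proof -
  interpret prob_space M by fact
  let ?\<theta> = "wl T p N" and ?\<sigma> = "wl T p (Suc N)"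
  define lab where "lab l = fst (prod_decode l)" for l
  define nbl where "nbl l = set_decode (snd (prod_decode l))" for l
  have \<theta>: "fin_measurable M ?\<theta>" and \<sigma>: "fin_measurable M ?\<sigma>" using gu p by (rule fin_measurable_wl)+
  have Tsp: "T \<subseteq> space M \<times> space M" using gu by (rule graph_union_space)
  have finT: "finite (T `` {x})" for x using T(4) by (simp add: locally_finite_def)
  have lab\<sigma>: "lab (?\<sigma> x) = ?\<theta> x" "nbl (?\<sigma> x) = ?\<theta> ` (T `` {x})" for x
    using finT[of x] by (simp_all add: lab_def nbl_def wl.simps)
  have \<theta>p: "?\<theta> x = ?\<theta> y \<Longrightarrow> p x = p y" for x y by (rule wl_label)
  have inj\<theta>: "inj_on ?\<theta> (T `` {x})" for x
  proof (rule inj_onI)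
    fix y z assume yz: "y \<in> T `` {x}" "z \<in> T `` {x}" "?\<theta> y = ?\<theta> z"
    show "y = z" by (rule inj_onD[OF inj_walks_neighbours[OF T(1) inj N] _ yz(1,2)]) (simp add: \<theta>p[OF yz(3)])
  qed
  have irr\<theta>: "?\<theta> x \<notin> ?\<theta> ` (T `` {x})" for x
  proof
    assume "?\<theta> x \<in> ?\<theta> ` (T `` {x})"
    then obtain y where y: "(x, y) \<in> T" "?\<theta> x = ?\<theta> y" by auto
    have "1 \<le> N" "(x, y) \<in> T ^^ 1" using N y(1) by auto
    then have "x = y" using inj \<theta>p[OF y(2)] unfolding inj_walks_def by metis
    then show False using y(1) T(2) by (auto simp: irrefl_def)
  qed
  define \<Sigma> where "\<Sigma> = ?\<sigma> ` space M"
  define w where "w l = prob {x \<in> space M. ?\<sigma> x = l}" for l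
  have \<Sigma>: "finite \<Sigma>" using \<sigma> by (simp add: \<Sigma>_def fin_measurable_def)
  have sum_w: "(\<Sum>l | l \<in> \<Sigma> \<and> P l. w l) = prob {x \<in> space M. P (?\<sigma> x)}" for P
    unfolding \<Sigma>_def w_def by (rule prob_fibres[OF \<sigma>, symmetric])
  \<comment> \<open>Mass transport between the points of type \<open>a\<close> and those of type
    \<open>b\<close>. Neighbours have distinct types, so the degrees are 0 or 1 and the two
    integrals are measures of sets of stars.\<close>
  have bal_w: "(\<Sum>l | l \<in> \<Sigma> \<and> lab l = a \<and> b \<in> nbl l. w l) = (\<Sum>l | l \<in> \<Sigma> \<and> lab l = b \<and> a \<in> nbl l. w l)" for a b
  proof -
    let ?X = "\<lambda>a. {x \<in> space M. ?\<theta> x = a}"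
    let ?Y = "\<lambda>a b. {x \<in> space M. lab (?\<sigma> x) = a \<and> b \<in> nbl (?\<sigma> x)}"
    have X: "?X a \<in> sets M" for a using \<theta> by (simp add: fin_measurable_def)
    have Y: "?Y a b \<in> sets M" for a b using \<sigma> by (rule fin_measurable_sets)
    have deg: "deg_in T (?X b) x = (if b \<in> ?\<theta> ` (T `` {x}) then 1 else 0)" for b x
    proof (cases "b \<in> ?\<theta> ` (T `` {x})")
      case True
      then obtain y where y: "y \<in> T `` {x}" "b = ?\<theta> y" by blast
      have "T `` {x} \<inter> ?X b = {y}" using y inj\<theta>[of x] Tsp by (auto dest: inj_onD)
      then show ?thesis using True by (simp add: deg_in_def)
    next
      case False
      then have "T `` {x} \<inter> ?X b = {}" by auto
      then show ?thesis using False by (simp add: deg_in_def)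
    qed
    have int: "(\<integral>\<^sup>+x\<in>?X a. of_nat (deg_in T (?X b) x) \<partial>M) = emeasure M (?Y a b)" for a b
    proof -
      have "(\<integral>\<^sup>+x\<in>?X a. of_nat (deg_in T (?X b) x) \<partial>M) = (\<integral>\<^sup>+x. indicator (?Y a b) x \<partial>M)"
        unfolding deg by (rule nn_integral_cong) (auto simp: lab\<sigma> indicator_def)
      then show ?thesis using Y by simp
    qed
    have "emeasure M (?Y a b) = emeasure M (?Y b a)"
      using mt X unfolding mass_transport_def int[symmetric] by blast
    then have "prob (?Y a b) = prob (?Y b a)" by (simp add: measure_def)
    then show ?thesis unfolding sum_w .
  qed
  \<comment> \<open>An event sums at most \<open>card \<Sigma>\<close> errors of single stars;
    adding 1 keeps the denominator positive.\<close>
  define \<delta> where "\<delta> = \<epsilon> / (card \<Sigma> + 1)"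
  have "\<delta> > 0" using \<open>0 < \<epsilon>\<close> by (simp add: \<delta>_def)
  have w0: "0 \<le> w l" for l by (simp add: w_def)
  have w1: "(\<Sum>l\<in>\<Sigma>. w l) = 1" using sum_w[of "\<lambda>_. True"] prob_space by simp
  obtain n Q where Q: "0 < Q" "(\<Sum>l\<in>\<Sigma>. n l) = (Q::nat)"
    and close: "\<And>l. l \<in> \<Sigma> \<Longrightarrow> \<bar>real (n l) / Q - w l\<bar> \<le> \<delta>" and pos: "\<And>l. l \<in> \<Sigma> \<Longrightarrow> 0 < n l \<Longrightarrow> 0 < w l"
    and eqs: "\<And>A B. A \<subseteq> \<Sigma> \<Longrightarrow> B \<subseteq> \<Sigma> \<Longrightarrow> (\<Sum>l\<in>A. w l) = (\<Sum>l\<in>B. w l) \<Longrightarrow> (\<Sum>l\<in>A. n l) = (\<Sum>l\<in>B. n l)"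
    by (rule integer_solution[OF \<Sigma> w0 w1 \<open>\<delta> > 0\<close>]) (rule that; assumption)
  have irr: "lab l \<notin> nbl l" if "l \<in> \<Sigma>" for l
    using that irr\<theta> by (auto simp: \<Sigma>_def simp: lab\<sigma>)
  have bal: "(\<Sum>l | l \<in> \<Sigma> \<and> lab l = a \<and> b \<in> nbl l. n l) = (\<Sum>l | l \<in> \<Sigma> \<and> lab l = b \<and> a \<in> nbl l. n l)" for a b
    by (rule eqs[OF _ _ bal_w]) auto
  obtain U :: "nat set" and S \<tau> where U: "finite U" "\<And>u. u \<in> U \<Longrightarrow> \<tau> u \<in> \<Sigma> \<and> 0 < n (\<tau> u)"
    "\<And>l. l \<in> \<Sigma> \<Longrightarrow> card {u \<in> U. \<tau> u = l} = n l" and S: "S \<subseteq> U \<times> U" "sym S"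
    and Sinj: "\<And>u. u \<in> U \<Longrightarrow> inj_on (\<lambda>v. lab (\<tau> v)) (S `` {u})"
    and Snb: "\<And>u. u \<in> U \<Longrightarrow> (\<lambda>v. lab (\<tau> v)) ` (S `` {u}) = nbl (\<tau> u)"
    by (rule star_model[of \<Sigma> lab nbl n, OF \<Sigma> irr bal]) (assumption, (rule that; assumption))
  \<comment> \<open>Of its star a vertex keeps only the innermost colour, the label. By
    \<open>wl_model\<close>, refinement in the model recovers the rest.\<close>
  define q where "q u = down (Suc N) (\<tau> u)" for u
  have real0: "\<exists>x\<in>space M. \<tau> u = ?\<sigma> x" if "u \<in> U" for u
    using U(2)[OF that] by (auto simp: \<Sigma>_def)
  then have real1: "\<exists>x. \<tau> u = ?\<sigma> x" if "u \<in> U" for u using that by blast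
  have wlS: "wl S q k u = down (Suc N - k) (\<tau> u)" if "u \<in> U" "k \<le> Suc N" for u k
    unfolding q_def using wl_model[OF T(4) S(1) real1 Snb[unfolded lab_def nbl_def] that] .
  have wlN: "wl S q N u = lab (\<tau> u)" if "u \<in> U" for u
    using wlS[OF that, of N] by (simp add: down_def lab_def)
  have finS: "locally_finite S"
    unfolding locally_finite_def
  proof
    fix x
    have "S `` {x} \<subseteq> U" using S(1) by auto
    then show "finite (S `` {x})" using U(1) by (rule finite_subset)
  qed
  have real: "\<exists>x\<in>space M. wl S q N u = wl T p N x" if "u \<in> U" for u
    using real0[OF that] wlN[OF that] lab\<sigma>(1) by auto
  have injS: "inj_on (\<lambda>v. lab_part (q v)) (S `` {u})" if u: "u \<in> U" for u
  proof (rule inj_onI)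
    fix v v' assume v: "v \<in> S `` {u}" "v' \<in> S `` {u}" "lab_part (q v) = lab_part (q v')"
    obtain x where x: "\<tau> u = ?\<sigma> x" using real1[OF u] by blast
    have vU: "v \<in> U" "v' \<in> U" using v S(1) by auto
    have "lab (\<tau> v) \<in> ?\<theta> ` (T `` {x})" "lab (\<tau> v') \<in> ?\<theta> ` (T `` {x})"
      using Snb[OF u] v(1,2) lab\<sigma>(2)[of x] x by auto
    then obtain y y' where y: "y \<in> T `` {x}" "lab (\<tau> v) = ?\<theta> y" "y' \<in> T `` {x}" "lab (\<tau> v') = ?\<theta> y'"
      by blast
    have "q v = p y" "q v' = p y'"
      using wl_label[of S q N v T p y] wl_label[of S q N v' T p y'] wlN vU y by auto
    then have "y = y'" using inj_onD[OF inj_walks_neighbours[OF T(1) inj N, of x]] v(3) y by simp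
    then show "v = v'" using inj_onD[OF Sinj[OF u]] v y by simp
  qed
  have injS': "inj_walks S q N"
  proof (rule inj_walks_model[OF T(3,2,4) inj finS S injS])
    show "\<exists>x. wl S q N u = wl T p N x" if "u \<in> U" for u using real[OF that] by blast
  qed
  have cardU: "card {u \<in> U. P (\<tau> u)} = (\<Sum>l | l \<in> \<Sigma> \<and> P l. n l)" for P
  proof -
    have "{u \<in> U. P (\<tau> u)} = (\<Union>l\<in>{l \<in> \<Sigma>. P l}. {u \<in> U. \<tau> u = l})" using U(2) by auto
    also have "card \<dots> = (\<Sum>l | l \<in> \<Sigma> \<and> P l. card {u \<in> U. \<tau> u = l})"
      by (rule card_UN_disjoint) (use \<Sigma> U(1) in auto)
    finally show ?thesis using U(3) by simp
  qed
  have UQ: "card U = Q" using cardU[of "\<lambda>_. True"] Q(2) by simp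
  have "\<bar>card {u \<in> U. P (wl S q N u)} / card U - prob {x \<in> space M. P (wl T p N x)}\<bar> \<le> \<epsilon>" for P
  proof -
    let ?I = "{l \<in> \<Sigma>. P (lab l)}"
    have "{u \<in> U. P (wl S q N u)} = {u \<in> U. P (lab (\<tau> u))}" using wlN by auto
    then have "card {u \<in> U. P (wl S q N u)} / card U = (\<Sum>l\<in>?I. real (n l) / Q)"
      using cardU[of "\<lambda>l. P (lab l)"] by (simp add: UQ sum_divide_distrib)
    moreover have "prob {x \<in> space M. P (wl T p N x)} = (\<Sum>l\<in>?I. w l)"
      using sum_w[of "\<lambda>l. P (lab l)"] by (simp add: lab\<sigma>)
    ultimately have "\<bar>card {u \<in> U. P (wl S q N u)} / card U - prob {x \<in> space M. P (wl T p N x)}\<bar>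
        = \<bar>\<Sum>l\<in>?I. real (n l) / Q - w l\<bar>"
      by (simp add: sum_subtractf)
    also have "\<dots> \<le> (\<Sum>l\<in>?I. \<bar>real (n l) / Q - w l\<bar>)" by (rule sum_abs)
    also have "\<dots> \<le> (\<Sum>l\<in>?I. \<delta>)" using close by (intro sum_mono) auto
    also have "\<dots> \<le> card \<Sigma> * \<delta>"
      using card_mono[OF \<Sigma>, of ?I] \<open>\<delta> > 0\<close> by (simp add: mult_right_mono)
    also have "\<dots> \<le> (card \<Sigma> + 1) * \<delta>" using \<open>\<delta> > 0\<close> by (simp add: mult_right_mono)
    also have "\<dots> = \<epsilon>" by (simp add: \<delta>_def)
    finally show ?thesis .
  qed
  moreover have "U \<noteq> {}" using UQ Q(1) by auto
  ultimately show ?thesis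
    using that[OF U(1) _ S finS injS' real] by blast
qed

text \<open>This compares conditional probabilities. Since \<open>a' \<le> c'\<close>, the factor
  \<open>c'\<close> cancels and the error is governed by \<open>c\<close> alone.\<close>

lemma ratio_close:
  fixes a c a' c' \<delta> :: real
  assumes "\<bar>a' - a\<bar> \<le> \<delta>" "\<bar>c' - c\<bar> \<le> \<delta>" "0 \<le> a'" "a' \<le> c'" "0 < c'" "0 < c"
  shows "\<bar>a' / c' - a / c\<bar> \<le> 2 * \<delta> / c"
proof -
  have "a' / c' - a / c = (a' * (c - c') + c' * (a' - a)) / (c' * c)"
    using assms by (simp add: field_simps)
  also have "\<bar>\<dots>\<bar> = \<bar>a' * (c - c') + c' * (a' - a)\<bar> / (c' * c)" using assms by simp
  also have "\<dots> \<le> (c' * \<delta> + c' * \<delta>) / (c' * c)"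
  proof (intro divide_right_mono)
    have "\<bar>a' * (c - c') + c' * (a' - a)\<bar> \<le> \<bar>a'\<bar> * \<bar>c - c'\<bar> + \<bar>c'\<bar> * \<bar>a' - a\<bar>"
      by (metis abs_mult abs_triangle_ineq)
    also have "\<dots> \<le> c' * \<delta> + c' * \<delta>"
      using assms by (intro add_mono mult_mono) auto
    finally show "\<bar>a' * (c - c') + c' * (a' - a)\<bar> \<le> c' * \<delta> + c' * \<delta>" .
  qed (use assms in simp)
  also have "\<dots> = 2 * \<delta> / c" using assms by (simp add: field_simps)
  finally show ?thesis .
qed

text \<open>By \<open>decoded_ball_iso\<close>, applied to \<open>T\<close> and itself, the ball
  depends only on the type of depth \<open>N\<close> of its centre. For labels that satisfy
  \<open>fin_measurable\<close> this makes the event Borel, and its probability can be compared with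
  a frequency in the model.\<close>

lemma decoded_ball_factors:
  assumes T: "T \<subseteq> X \<times> X" "sym T" "locally_finite T" and inj: "inj_walks T p N" and N: "2 * (Suc s * R) \<le> N"
  obtains P where "\<And>x. x \<in> X \<Longrightarrow>
    lab_col (p x) \<noteq> 0 \<and> rooted_iso (graph_ball s (decoded_graph X T p R) x, x) t \<longleftrightarrow> P (wl T p N x)"
proof -
  let ?G = "decoded_graph X T p R"
  define P where "P l \<longleftrightarrow> (\<exists>x\<in>X. wl T p N x = l \<and> lab_col (p x) \<noteq> 0 \<and> rooted_iso (graph_ball s ?G x, x) t)" for l
  have "lab_col (p x) \<noteq> 0 \<and> rooted_iso (graph_ball s ?G x, x) t \<longleftrightarrow> P (wl T p N x)" if x: "x \<in> X" for x
  proof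
    assume "P (wl T p N x)"
    then obtain y where y: "y \<in> X" "wl T p N y = wl T p N x" "lab_col (p y) \<noteq> 0"
        "rooted_iso (graph_ball s ?G y, y) t" by (auto simp: P_def)
    have "rooted_iso (graph_ball s ?G y, y) (graph_ball s ?G x, x)"
      by (rule decoded_ball_iso[OF T(3) T(3) T(1) T(1) T(2) T(2) inj inj y(1) x y(2) N])
    moreover have "y \<in> verts (graph_ball s ?G y)"
      using y by (intro root_in_ball) (simp add: decoded_graph_def)
    ultimately have "rooted_iso (graph_ball s ?G x, x) t" 
      using rooted_iso_cong[of "graph_ball s ?G y" y "graph_ball s ?G x" x t] y(4) by simp
    then show "lab_col (p x) \<noteq> 0 \<and> rooted_iso (graph_ball s ?G x, x) t"
      using y(3) wl_label[OF y(2)] by simp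
  qed (use x in \<open>auto simp: P_def\<close>)
  then show ?thesis by (rule that)
qed

lemma decoded_ball_measurable:
  assumes "graph_union M T" "sym T" "locally_finite T" "fin_measurable M p" "inj_walks T p N" "2 * (Suc s * R) \<le> N"
  shows "{x \<in> space M. lab_col (p x) \<noteq> 0 \<and> rooted_iso (graph_ball s (decoded_graph (space M) T p R) x, x) t} \<in> sets M"
proof -
  obtain P where P: "\<And>x. x \<in> space M \<Longrightarrow>
    lab_col (p x) \<noteq> 0 \<and> rooted_iso (graph_ball s (decoded_graph (space M) T p R) x, x) t \<longleftrightarrow> P (wl T p N x)"
    by (rule decoded_ball_factors[OF graph_union_space[OF assms(1)] assms(2,3,5,6)]) (rule that; assumption)
  show ?thesis
    using fin_measurable_sets[OF fin_measurable_wl[OF assms(1,4)], of P N] P by (simp cong: conj_cong)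
qed

theorem decoded_graph_approximable:
  fixes M :: "'v measure"
  assumes "prob_space M" and gu: "graph_union M T" and T: "sym T" "irrefl T" "acyclic_graph T" "locally_finite T"
    and mt: "mass_transport M T" and p: "fin_measurable M p" and inj: "inj_walks T p N"
    and N: "2 \<le> N" "2 * (Suc r * R) \<le> N" and "0 < \<epsilon>"
    and nbs: "\<And>x. x \<in> space M \<Longrightarrow> lab_part (p x) \<notin> lab_nbs (p x)"
      "\<And>x. x \<in> space M \<Longrightarrow> card (lab_nbs (p x)) \<le> d"
    and col: "\<And>x. x \<in> space M \<Longrightarrow> lab_col (p x) \<le> c"
    and V: "0 < measure M {x \<in> space M. lab_col (p x) \<noteq> 0}"
  obtains H :: "nat cgraph" where "finite (verts H)" "verts H \<noteq> {}" "colored_graph c H"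
    "max_degree_le (verts H) (edges H) d"
    "\<And>s t. s \<le> r \<Longrightarrow> \<bar>measure_pmf.prob (pmf_of_set (verts H)) {u. rooted_iso (graph_ball s H u, u) t} -
       measure M {x \<in> space M. lab_col (p x) \<noteq> 0 \<and> rooted_iso (graph_ball s (decoded_graph (space M) T p R) x, x) t} /
         measure M {x \<in> space M. lab_col (p x) \<noteq> 0}\<bar> \<le> \<epsilon>"
proof -
  interpret prob_space M by fact
  define c0 where "c0 = prob {x \<in> space M. lab_col (p x) \<noteq> 0}"
  have c0: "0 < c0" using V by (simp add: c0_def)
  \<comment> \<open>The first bound is what \<open>ratio_close\<close> needs for an error of
    \<open>\<epsilon>\<close>. The second keeps \<open>\<delta>\<close> below \<open>c0\<close>, so
    that the model has vertices of nonzero colour.\<close>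
  define \<delta> where "\<delta> = min (\<epsilon> * c0 / 2) (c0 / 2)"
  have \<delta>: "0 < \<delta>" "2 * \<delta> / c0 \<le> \<epsilon>" "\<delta> < c0"
    using c0 \<open>0 < \<epsilon>\<close> by (auto simp: \<delta>_def field_simps min_def)
  obtain U :: "nat set" and S q where U: "finite U" "U \<noteq> {}" and S: "S \<subseteq> U \<times> U" "sym S" "locally_finite S"
    "inj_walks S q N" and real: "\<And>u. u \<in> U \<Longrightarrow> \<exists>x\<in>space M. wl S q N u = wl T p N x"
    and freq: "\<And>P. \<bar>card {u \<in> U. P (wl S q N u)} / card U - prob {x \<in> space M. P (wl T p N x)}\<bar> \<le> \<delta>"
    by (rule finite_model[OF assms(1) gu T mt p inj N(1) \<delta>(1)]) (rule that; assumption)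
  have cU: "0 < card U" using U by (simp add: card_gt_0_iff)
  let ?G = "decoded_graph (space M) T p R"
  define H where "H = decoded_graph U S q R"
  have vH: "verts H = {u \<in> U. lab_col (q u) \<noteq> 0}" by (simp add: H_def decoded_graph_def)
  have Tsp: "T \<subseteq> space M \<times> space M" using gu by (rule graph_union_space)
  have real_p: "\<exists>x\<in>space M. q u = p x" if "u \<in> U" for u using real[OF that] wl_label[of S q N u T p] by blast
  define colN where "colN l = lab_col (down N l)" for l
  have downN: "down N (wl T' p' N x) = p' x" for T' :: "'z rel" and p' x
    using down_wl[of N T' p' 0 x] by simp
  have colS: "colN (wl S q N u) = lab_col (q u)" for u by (simp add: colN_def downN)
  have colT: "colN (wl T p N x) = lab_col (p x)" for x by (simp add: colN_def downN)
  have cV: "\<bar>card (verts H) / card U - c0\<bar> \<le> \<delta>"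
    using freq[of "\<lambda>l. colN l \<noteq> 0"] by (simp add: vH c0_def colS colT)
  have cH: "0 < card (verts H) / card U" using cV \<delta>(3) by linarith
  then have H_ne: "verts H \<noteq> {}" by auto
  have H_fin: "finite (verts H)" using U by (simp add: vH)
  have RN: "R \<le> N" using N(2) by simp
  have "simple_graph (verts H) (edges H)"
    unfolding simple_graph_def
  proof (intro conjI)
    show "edges H \<subseteq> verts H \<times> verts H" by (auto simp: H_def decoded_graph_def)
    show "sym (edges H)"
      unfolding H_def decoded_graph_def using relpow_sym[OF S(2)] by (auto intro!: symI)
    show "irrefl (edges H)"
    proof (rule irreflI)
      fix u show "(u, u) \<notin> edges H"
        using real_p[of u] nbs(1) by (auto simp: H_def decoded_graph_def)
    qed
  qed
  moreover have "color H ` verts H \<subseteq> {1..c}"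
  proof
    fix k assume "k \<in> color H ` verts H"
    then obtain u where u: "u \<in> U" "lab_col (q u) \<noteq> 0" "k = lab_col (q u)"
      by (auto simp: H_def decoded_graph_def)
    then show "k \<in> {1..c}" using real_p[OF u(1)] col by auto
  qed
  ultimately have H_col: "colored_graph c H" by (simp add: colored_graph_def)
  have H_deg: "max_degree_le (verts H) (edges H) d"
    unfolding max_degree_le_def
  proof (intro ballI conjI)
    fix u assume u: "u \<in> verts H"
    then have uU: "u \<in> U" by (simp add: vH)
    obtain x where x: "x \<in> space M" "q u = p x" using real_p[OF uU] by blast
    show fin: "finite (edges H `` {u})"
    proof (rule finite_subset[OF _ H_fin])
      show "edges H `` {u} \<subseteq> verts H" by (auto simp: H_def decoded_graph_def)
    qed
    \<comment> \<open>Two decoded neighbours of \<open>u\<close> are at most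
      \<open>2 * R \<le> N\<close> steps apart in \<open>S\<close>, so their parts differ, and the
      parts listed in the label of \<open>u\<close> bound the degree.\<close>
    have "inj_on (\<lambda>v. lab_part (q v)) (edges H `` {u})"
    proof (rule inj_onI)
      fix v v' assume v: "v \<in> edges H `` {u}" "v' \<in> edges H `` {u}" "lab_part (q v) = lab_part (q v')"
      then obtain i j where ij: "i \<le> R" "j \<le> R" "(u, v) \<in> S ^^ i" "(u, v') \<in> S ^^ j"
        by (auto simp: H_def decoded_graph_def)
      then have "(v, v') \<in> S ^^ (i + j)" using relpow_add_I relpow_sym[OF S(2)] by metis
      moreover have "i + j \<le> N" using ij N(2) by simp
      ultimately show "v = v'" using S(4) v(3) unfolding inj_walks_def by blast
    qed
    moreover have "(\<lambda>v. lab_part (q v)) ` (edges H `` {u}) \<subseteq> lab_nbs (p x)"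
      using x by (auto simp: H_def decoded_graph_def)
    moreover have "finite (lab_nbs (p x))" by (simp add: lab_nbs_def)
    ultimately have "card (edges H `` {u}) \<le> card (lab_nbs (p x))"
      by (metis card_image card_mono)
    then show "card (edges H `` {u}) \<le> d" using nbs(2)[OF x(1)] by simp
  qed
  have main: "\<bar>measure_pmf.prob (pmf_of_set (verts H)) {u. rooted_iso (graph_ball s H u, u) t} -
       prob {x \<in> space M. lab_col (p x) \<noteq> 0 \<and> rooted_iso (graph_ball s ?G x, x) t} / c0\<bar> \<le> \<epsilon>"
    if s: "s \<le> r" for s t
  proof -
    have sN: "2 * (Suc s * R) \<le> N"
      by (rule le_trans[OF _ N(2)]) (use s in \<open>intro mult_le_mono2 mult_le_mono1; simp\<close>)
    obtain P where PT: "\<And>x. x \<in> space M \<Longrightarrow>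
        lab_col (p x) \<noteq> 0 \<and> rooted_iso (graph_ball s ?G x, x) t \<longleftrightarrow> P (wl T p N x)"
      by (rule decoded_ball_factors[OF Tsp T(1,4) inj sN]) (rule that; assumption)
    have PS: "lab_col (q u) \<noteq> 0 \<and> rooted_iso (graph_ball s H u, u) t \<longleftrightarrow> P (wl S q N u)" if u: "u \<in> U" for u
    proof -
      obtain x where x: "x \<in> space M" "wl S q N u = wl T p N x" using real[OF u] by blast
      have pq: "q u = p x" using wl_label[OF x(2)] .
      show ?thesis
      proof (cases "lab_col (p x) = 0")
        case True
        then show ?thesis using PT[OF x(1)] x(2) pq by simp
      next
        case False
        have "rooted_iso (graph_ball s H u, u) (graph_ball s ?G x, x)"
          unfolding H_def by (rule decoded_ball_iso[OF S(3) T(4) S(1) Tsp S(2) T(1) S(4) inj u x(1) x(2) sN])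
        moreover have "u \<in> verts (graph_ball s H u)"
          using u False pq by (intro root_in_ball) (simp add: vH)
        ultimately have "rooted_iso (graph_ball s H u, u) t \<longleftrightarrow> rooted_iso (graph_ball s ?G x, x) t"
          by (rule rooted_iso_cong)
        then show ?thesis using PT[OF x(1)] x(2) pq by simp
      qed
    qed
    have "verts H \<inter> {u. rooted_iso (graph_ball s H u, u) t} = {u \<in> U. P (wl S q N u)}"
      using PS by (auto simp: vH)
    then have e1: "measure_pmf.prob (pmf_of_set (verts H)) {u. rooted_iso (graph_ball s H u, u) t} =
        (card {u \<in> U. P (wl S q N u)} / card U) / (card (verts H) / card U)"
      using cU by (simp add: measure_pmf_of_set[OF H_ne H_fin])
    have e2: "{x \<in> space M. lab_col (p x) \<noteq> 0 \<and> rooted_iso (graph_ball s ?G x, x) t} = {x \<in> space M. P (wl T p N x)}"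
      using PT by blast
    have "{u \<in> U. P (wl S q N u)} \<subseteq> verts H" using PS by (auto simp: vH)
    then have "card {u \<in> U. P (wl S q N u)} / card U \<le> card (verts H) / card U"
      using card_mono[OF H_fin] by (simp add: divide_right_mono)
    then have "\<bar>(card {u \<in> U. P (wl S q N u)} / card U) / (card (verts H) / card U) -
        prob {x \<in> space M. P (wl T p N x)} / c0\<bar> \<le> 2 * \<delta> / c0"
      by (intro ratio_close freq cV cH c0) auto
    then show ?thesis unfolding e1 e2 using \<delta>(2) by linarith
  qed
  show ?thesis
    by (rule that[OF H_fin H_ne H_col H_deg]) (use main in \<open>simp add: c0_def\<close>)
qed

text \<open>A point outside \<open>B\<close> leaves the sets \<open>A n\<close> for good, so the
  unions of their tails decrease to a subset of \<open>B\<close>.\<close>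

lemma (in finite_measure) measure_eventually_small:
  assumes A: "\<And>n::nat. A n \<in> sets M" and B: "B \<in> sets M"
    and ev: "\<And>x. x \<in> space M \<Longrightarrow> x \<notin> B \<Longrightarrow> \<exists>n0. \<forall>n\<ge>n0. x \<notin> A n" and "0 < \<epsilon>"
  shows "\<exists>n0. \<forall>n\<ge>n0. measure M (A n) \<le> measure M B + \<epsilon>"
proof -
  define C where "C n = (\<Union>m\<in>{n..}. A m)" for n
  have C: "C n \<in> sets M" for n unfolding C_def using A by (intro sets.countable_UN'') auto
  have "decseq C" unfolding C_def by (intro decseq_SucI) (force simp: Suc_le_eq)
  then have lim: "(\<lambda>n. measure M (C n)) \<longlonglongrightarrow> measure M (\<Inter>n. C n)"
    using C by (intro finite_Lim_measure_decseq) auto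
  have "(\<Inter>n. C n) \<subseteq> B"
  proof
    fix x assume x: "x \<in> (\<Inter>n. C n)"
    then have "x \<in> space M" using sets.sets_into_space[OF C] by blast
    show "x \<in> B"
    proof (rule ccontr)
      assume "x \<notin> B"
      then obtain n0 where "\<forall>n\<ge>n0. x \<notin> A n" using ev \<open>x \<in> space M\<close> by blast
      moreover have "x \<in> C n0" using x by blast
      ultimately show False unfolding C_def by auto
    qed
  qed
  then have "measure M (\<Inter>n. C n) \<le> measure M B" using B by (rule finite_measure_mono)
  then have "measure M (\<Inter>n. C n) < measure M B + \<epsilon>" using \<open>0 < \<epsilon>\<close> by simp
  from order_tendstoD(2)[OF lim this]
  obtain n0 where n0: "\<And>n. n \<ge> n0 \<Longrightarrow> measure M (C n) < measure M B + \<epsilon>"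
    unfolding eventually_sequentially by blast
  have "measure M (A n) \<le> measure M (C n)" for n
    using C by (intro finite_measure_mono) (auto simp: C_def)
  then have "measure M (A n) \<le> measure M B + \<epsilon>" if "n \<ge> n0" for n
    by (rule order_trans) (rule less_imp_le[OF n0[OF that]])
  then show ?thesis by blast
qed

lemma acyclic_graph_subset: "acyclic_graph E \<Longrightarrow> E' \<subseteq> E \<Longrightarrow> acyclic_graph E'"
  unfolding acyclic_graph_def is_cycle_def by blast

lemma mass_transport_restrict:
  assumes "mass_transport M T" and X: "X \<in> sets M"
  shows "mass_transport M (T \<inter> X \<times> X)"
  unfolding mass_transport_def
proof (intro ballI)
  have deg: "deg_in (T \<inter> X \<times> X) B x = (if x \<in> X then deg_in T (B \<inter> X) x else 0)" for B x
  proof -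
    have "(T \<inter> X \<times> X) `` {x} \<inter> B = (if x \<in> X then T `` {x} \<inter> (B \<inter> X) else {})" by auto
    then show ?thesis by (simp add: deg_in_def)
  qed
  have int: "(\<integral>\<^sup>+x\<in>A. of_nat (deg_in (T \<inter> X \<times> X) B x) \<partial>M) = (\<integral>\<^sup>+x\<in>A \<inter> X. of_nat (deg_in T (B \<inter> X) x) \<partial>M)" for A B
    unfolding deg by (rule nn_integral_cong) (auto simp: indicator_def)
  fix A B assume "A \<in> sets M" "B \<in> sets M"
  then show "(\<integral>\<^sup>+x\<in>A. of_nat (deg_in (T \<inter> X \<times> X) B x) \<partial>M) = (\<integral>\<^sup>+x\<in>B. of_nat (deg_in (T \<inter> X \<times> X) A x) \<partial>M)"
    unfolding int using assms by (auto simp: mass_transport_def)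
qed

lemma fin_measurable_of_bool:
  assumes "{x \<in> space M. P x} \<in> sets M"
  shows "fin_measurable M (\<lambda>x. of_bool (P x))"
  unfolding fin_measurable_def
proof (intro conjI allI)
  have "(\<lambda>x. of_bool (P x)) ` space M \<subseteq> {0, 1 :: nat}" by auto
  then show "finite ((\<lambda>x. of_bool (P x) :: nat) ` space M)" by (rule finite_subset) simp
  fix l :: nat
  have "{x \<in> space M. \<not> P x} = space M - {x \<in> space M. P x}" by auto
  then have n: "{x \<in> space M. \<not> P x} \<in> sets M" using assms by simp
  consider "l = 0" | "l = 1" | "l > 1" by linarith
  then have "{x \<in> space M. of_bool (P x) = l} \<in> {{x \<in> space M. P x}, {x \<in> space M. \<not> P x}, {}}"
    by cases auto
  then show "{x \<in> space M. of_bool (P x) = l} \<in> sets M" using assms n by auto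
qed

text \<open>The codes give finite partitions that get finer with \<open>k\<close>. If the bits
  separate points, any given finite set is eventually separated.\<close>

fun bit_code :: "(nat \<Rightarrow> 'v \<Rightarrow> bool) \<Rightarrow> nat \<Rightarrow> 'v \<Rightarrow> nat" where
  "bit_code b 0 x = 0"
| "bit_code b (Suc k) x = prod_encode (bit_code b k x, of_bool (b k x))"

lemma bit_code_eq_iff: "bit_code b k x = bit_code b k y \<longleftrightarrow> (\<forall>i<k. b i x = b i y)"
  by (induction k) (auto simp: less_Suc_eq)

lemma fin_measurable_bit_code:
  assumes "\<And>i. {x \<in> space M. b i x} \<in> sets M"
  shows "fin_measurable M (bit_code b k)"
proof (induction k)
  case 0
  have "{x \<in> space M. 0 = l} \<in> sets M" for l :: nat by (cases "l = 0") auto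
  then show ?case by (auto simp: fin_measurable_def image_constant_conv)
next
  case (Suc k)
  show ?case
    using fin_measurable_pair[OF Suc fin_measurable_of_bool[OF assms[of k]], of "\<lambda>a b. prod_encode (a, b)"]
    by simp
qed

lemma relpow_subset: "E \<subseteq> E' \<Longrightarrow> (x, y) \<in> E ^^ j \<Longrightarrow> (x, y) \<in> E' ^^ j" for E :: "'a rel"
  by (induction j arbitrary: y) auto

lemma finite_relpow_Image:
  assumes "locally_finite E"
  shows "finite ((E ^^ j) `` {x})"
proof (induction j)
  case (Suc j)
  have eq: "(E ^^ Suc j) `` {x} = (\<Union>y\<in>(E ^^ j) `` {x}. E `` {y})" by auto
  show ?case unfolding eq by (intro finite_UN_I Suc) (use assms in \<open>simp add: locally_finite_def\<close>)
qed simp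

section \<open>Subgraphs of the orbit relation of a treeing\<close>

text \<open>The situation inside the treeing: \<open>M\<close> is the space of the treeing,
  \<open>V\<close> and \<open>F\<close> are the images of the vertices and the edges of the
  graphing. The inclusion \<open>F \<subseteq> T\<^sup>*\<close> carries no bound on the lengths of
  walks. Colour \<open>0\<close> marks the points outside \<open>V\<close>.\<close>

locale treed_graph = prob_space M for M :: "'v measure" +
  fixes T F :: "'v rel" and V :: "'v set" and \<kappa> :: "'v \<Rightarrow> nat" and d c :: nat
    and b :: "nat \<Rightarrow> 'v \<Rightarrow> bool"
  assumes diag: "diagonal_measurable M"
    and b_sets: "\<And>i. {x \<in> space M. b i x} \<in> sets M"
    and b_separates: "\<And>x y. x \<in> space M \<Longrightarrow> y \<in> space M \<Longrightarrow> x \<noteq> y \<Longrightarrow> \<exists>i. b i x \<noteq> b i y"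
    and T: "graph_union M T" "sym T" "irrefl T" "acyclic_graph T" "locally_finite T" "mass_transport M T"
    and F: "graph_union M F" "F \<subseteq> V \<times> V" "sym F" "irrefl F" "locally_finite F"
    and F_deg: "\<And>x. card (F `` {x}) \<le> d"
    and FT: "F \<subseteq> T\<^sup>*"
    and V: "V \<in> sets M" "0 < prob V"
    and \<kappa>: "\<And>k. {x \<in> V. \<kappa> x = k} \<in> sets M" "\<kappa> ` V \<subseteq> {1..c}" "\<And>x. x \<notin> V \<Longrightarrow> \<kappa> x = 0"
begin

abbreviation code where "code \<equiv> bit_code b"

definition walks :: "'v rel \<Rightarrow> nat \<Rightarrow> 'v rel" where
  "walks E R = (\<Union>j\<le>R. Id_on (space M) O E ^^ j)"

lemma walks_iff: "(x, y) \<in> walks E R \<longleftrightarrow> x \<in> space M \<and> (\<exists>j\<le>R. (x, y) \<in> E ^^ j)"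
  by (auto simp: walks_def)

lemma graph_union_walks: "graph_union M E \<Longrightarrow> graph_union M (walks E R)"
  unfolding walks_def by (intro graph_union_UN_le graph_union_relpow)

text \<open>The second bound is the one of \<open>decoded_ball_iso\<close>. The bound 2 keeps the
  parts of the neighbours of a vertex distinct even when \<open>R = 0\<close>.\<close>

definition inj_radius :: "nat \<Rightarrow> nat \<Rightarrow> nat" where "inj_radius r R = max 2 (2 * (Suc r * R))"

definition non_inj :: "nat \<Rightarrow> nat \<Rightarrow> 'v set" where
  "non_inj N k = Domain {(x, y). (x, y) \<in> walks T N \<and> (x \<noteq> y \<and> code k x = code k y)}"

text \<open>Deleted vertices lose their edges but remain in the space, so the measure need not be
  renormalised.\<close>

definition good_tree :: "nat \<Rightarrow> nat \<Rightarrow> 'v rel" where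
  "good_tree N k = T \<inter> (space M - non_inj N k) \<times> (space M - non_inj N k)"

text \<open>The connecting walk must run inside the truncated forest, which is all that the decoding
  sees.\<close>

definition good_edges :: "nat \<Rightarrow> nat \<Rightarrow> nat \<Rightarrow> 'v rel" where
  "good_edges r R k = F \<inter> walks (good_tree (inj_radius r R) k) R"

text \<open>Outside this set the balls of radius up to \<open>r\<close> in \<open>F\<close> and in a
  subgraph \<open>E\<close> coincide. Writing it as a \<open>Domain\<close> makes it Borel.\<close>

definition bad :: "nat \<Rightarrow> 'v rel \<Rightarrow> 'v set" where
  "bad r E = Domain (walks F r O (F - E))"

definition cgraph_of :: "'v rel \<Rightarrow> 'v cgraph" where
  "cgraph_of E = \<lparr>verts = V, edges = E, color = \<kappa>\<rparr>"

definition ball_set :: "'v rel \<Rightarrow> nat \<Rightarrow> nat cgraph \<times> nat \<Rightarrow> 'v set" where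
  "ball_set E s t = {x \<in> V. rooted_iso (graph_ball s (cgraph_of E) x, x) t}"

lemma V_space: "V \<subseteq> space M" using V(1) sets.sets_into_space by blast

lemma fin_code: "fin_measurable M (code k)" using b_sets by (rule fin_measurable_bit_code)

lemma graph_union_neq_code:
  assumes "graph_union M E"
  shows "graph_union M {(x, y). (x, y) \<in> E \<and> (x \<noteq> y \<and> code k x = code k y)}"
proof (rule graph_union_Collect[OF assms])
  fix g assume g: "g \<in> measurable M M"
  have d: "{x \<in> space M. x = g x} \<in> sets M"
    using diag g measurable_ident unfolding diagonal_measurable_def by fastforce
  have e: "{x \<in> space M. code k x = code k (g x)} \<in> sets M"
  proof -
    have "{x \<in> space M. code k x = code k (g x)} =
        (\<Union>l. {x \<in> space M. code k x = l} \<inter> (g -` {y \<in> space M. code k y = l} \<inter> space M))"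
      by (rule set_eqI) (auto simp: measurable_space[OF g])
    also have "\<dots> \<in> sets M"
    proof -
      have c: "{y \<in> space M. code k y = l} \<in> sets M" for l using fin_code by (simp add: fin_measurable_def)
      show ?thesis by (intro sets.countable_UN'' sets.Int c measurable_sets[OF g c]) simp
    qed
    finally show ?thesis .
  qed
  have "{x \<in> space M. x \<noteq> g x \<and> code k x = code k (g x)} =
      {x \<in> space M. code k x = code k (g x)} - {x \<in> space M. x = g x}" by auto
  then show "{x \<in> space M. x \<noteq> g x \<and> code k x = code k (g x)} \<in> sets M" using d e by simp
qed

lemma non_inj_sets: "non_inj N k \<in> sets M"
  unfolding non_inj_def
  by (intro graph_union_Domain graph_union_neq_code graph_union_walks T)

lemma good_tree:
  shows "graph_union M (good_tree N k)" "sym (good_tree N k)" "irrefl (good_tree N k)"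
    "acyclic_graph (good_tree N k)" "locally_finite (good_tree N k)" "mass_transport M (good_tree N k)"
    "good_tree N k \<subseteq> T"
proof -
  have X: "space M - non_inj N k \<in> sets M" using non_inj_sets by simp
  show sub: "good_tree N k \<subseteq> T" by (auto simp: good_tree_def)
  show "graph_union M (good_tree N k)" unfolding good_tree_def by (intro graph_union_restrict T X)
  show "sym (good_tree N k)" using T(2) by (auto simp: good_tree_def sym_def)
  show "irrefl (good_tree N k)" using T(3) by (auto simp: good_tree_def irrefl_def)
  show "acyclic_graph (good_tree N k)" by (rule acyclic_graph_subset[OF T(4) sub])
  show "locally_finite (good_tree N k)"
    using T(5) sub unfolding locally_finite_def by (meson Image_mono finite_subset order_refl)
  show "mass_transport M (good_tree N k)" unfolding good_tree_def by (intro mass_transport_restrict T X)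
qed

text \<open>A walk of positive length starts at a retained vertex, and \<open>non_inj\<close> tests
  all walks of \<open>T\<close>, among them those of the forest.\<close>

lemma good_tree_inj:
  assumes "(x, y) \<in> good_tree N k ^^ j" "j \<le> N" "code k x = code k y"
  shows "x = y"
proof (rule ccontr)
  assume "x \<noteq> y"
  then obtain i where "j = Suc i" using assms(1) by (cases j) auto
  then obtain z where "(x, z) \<in> good_tree N k" using assms(1) by (meson relpow_Suc_D2)
  then have x: "x \<in> space M" "x \<notin> non_inj N k" by (auto simp: good_tree_def)
  have "(x, y) \<in> T ^^ j" using assms(1) by (rule relpow_subset[OF good_tree(7)])
  then have "(x, y) \<in> walks T N" using x(1) assms(2) by (auto simp: walks_iff)
  then show False using x(2) \<open>x \<noteq> y\<close> assms(3) by (auto simp: non_inj_def)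
qed

lemma good_edges:
  shows "graph_union M (good_edges r R k)" "good_edges r R k \<subseteq> F" "sym (good_edges r R k)"
proof -
  have "good_edges r R k = F - (F - walks (good_tree (inj_radius r R) k) R)" by (auto simp: good_edges_def)
  then show "graph_union M (good_edges r R k)"
    by (simp add: graph_union_Diff graph_union_walks good_tree F diag)
  show "good_edges r R k \<subseteq> F" by (auto simp: good_edges_def)
  show "sym (good_edges r R k)"
  proof (rule symI)
    fix x y assume xy: "(x, y) \<in> good_edges r R k"
    then have "y \<in> space M" using F(2) V_space by (auto simp: good_edges_def)
    then show "(y, x) \<in> good_edges r R k"
      using xy relpow_sym[OF good_tree(2)] F(3) by (auto simp: good_edges_def walks_iff dest: symD)
  qed
qed

definition label :: "nat \<Rightarrow> nat \<Rightarrow> nat \<Rightarrow> 'v \<Rightarrow> nat" where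
  "label r R k x = mk_label (code k x) (\<kappa> x) (code k ` (good_edges r R k `` {x}))"

lemma finite_nbs: "finite (good_edges r R k `` {x})"
  using F(5) good_edges(2) unfolding locally_finite_def by (meson Image_mono finite_subset order_refl)

lemma label_sels [simp]:
  "lab_part (label r R k x) = code k x" "lab_col (label r R k x) = \<kappa> x"
  "lab_nbs (label r R k x) = code k ` (good_edges r R k `` {x})"
  using finite_nbs by (simp_all add: label_def)

lemma \<kappa>_V: "\<kappa> x \<noteq> 0 \<longleftrightarrow> x \<in> V"
  using \<kappa>(2) \<kappa>(3)[of x] by (cases "x \<in> V") (auto simp: image_subset_iff)

lemma fin_\<kappa>: "fin_measurable M \<kappa>"
  unfolding fin_measurable_def
proof (intro conjI allI)
  have "\<kappa> ` space M \<subseteq> insert 0 {1..c}" using \<kappa>(2,3) by auto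
  then show "finite (\<kappa> ` space M)" by (rule finite_subset) simp
  fix l
  have "{x \<in> space M. \<kappa> x = l} = (if l = 0 then space M - V else {x \<in> V. \<kappa> x = l})"
    (is "?L = ?R")
  proof (rule set_eqI)
    fix x show "x \<in> ?L \<longleftrightarrow> x \<in> ?R" using \<kappa>_V[of x] V_space by (cases "l = 0") auto
  qed
  then show "{x \<in> space M. \<kappa> x = l} \<in> sets M" using \<kappa>(1) V(1) by simp
qed

lemma fin_label: "fin_measurable M (label r R k)"
proof -
  note 1 = fin_measurable_nbs[OF good_edges(1)[of r R k] fin_code[of k]]
  note 2 = fin_measurable_pair[OF fin_\<kappa> 1, of "\<lambda>a b. prod_encode (a, b)"]
  from fin_measurable_pair[OF fin_code[of k] 2, of "\<lambda>a b. prod_encode (a, b)"]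
  show ?thesis by (simp add: label_def[abs_def] mk_label_def)
qed

lemma inj_walks_label: "inj_walks (good_tree N k) (label r R k) N"
  unfolding inj_walks_def using good_tree_inj by simp

text \<open>A label names only the part of a neighbour. A point of that part within \<open>R\<close>
  steps of \<open>x\<close> is within \<open>2 * R\<close> steps of the neighbour itself, so
  injectivity identifies the two.\<close>

lemma decoded_good: "decoded_graph (space M) (good_tree (inj_radius r R) k) (label r R k) R = cgraph_of (good_edges r R k)"
proof -
  let ?T = "good_tree (inj_radius r R) k" and ?E = "good_edges r R k"
  have e: "(x, y) \<in> ?E \<longleftrightarrow> x \<in> space M \<and> y \<in> space M \<and> x \<in> V \<and> y \<in> V \<and> (\<exists>j\<le>R. (x, y) \<in> ?T ^^ j) \<and>
      code k y \<in> code k ` (?E `` {x}) \<and> code k x \<in> code k ` (?E `` {y})" (is "_ \<longleftrightarrow> ?r") for x y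
  proof
    assume xy: "(x, y) \<in> ?E"
    then have "(y, x) \<in> ?E" using good_edges(3) by (auto dest: symD)
    then show ?r using xy F(2) V_space by (auto simp: good_edges_def walks_iff)
  next
    assume r: ?r
    then obtain j where j: "j \<le> R" "(x, y) \<in> ?T ^^ j" by blast
    obtain z where z: "(x, z) \<in> ?E" "code k y = code k z" using r by auto
    then obtain i where i: "i \<le> R" "(x, z) \<in> ?T ^^ i" by (auto simp: good_edges_def walks_iff)
    have "(y, z) \<in> ?T ^^ (j + i)" using relpow_add_I[OF relpow_sym[OF good_tree(2) j(2)] i(2)] .
    moreover have "j + i \<le> inj_radius r R" using i j by (simp add: inj_radius_def)
    ultimately have "y = z" using good_tree_inj z(2) by blast
    then show "(x, y) \<in> ?E" using z by simp
  qed
  have eq1: "{(x, y). x \<in> space M \<and> y \<in> space M \<and> x \<in> V \<and> y \<in> V \<and> (\<exists>j\<le>R. (x, y) \<in> ?T ^^ j) \<and>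
      code k y \<in> code k ` (?E `` {x}) \<and> code k x \<in> code k ` (?E `` {y})} = ?E"
  proof (rule set_eqI)
    fix p :: "'v \<times> 'v"
    obtain x y where p: "p = (x, y)" by force
    show "p \<in> {(x, y). x \<in> space M \<and> y \<in> space M \<and> x \<in> V \<and> y \<in> V \<and> (\<exists>j\<le>R. (x, y) \<in> ?T ^^ j) \<and>
      code k y \<in> code k ` (?E `` {x}) \<and> code k x \<in> code k ` (?E `` {y})} \<longleftrightarrow> p \<in> ?E"
      unfolding p mem_Collect_eq prod.case by (rule e[symmetric])
  qed
  have eq2: "{x \<in> space M. x \<in> V} = V" using V_space by blast
  show ?thesis unfolding decoded_graph_def cgraph_of_def label_sels \<kappa>_V eq1 eq2 ..
qed

lemma inj_radius: "2 \<le> inj_radius r R" "s \<le> r \<Longrightarrow> 2 * (Suc s * R) \<le> inj_radius r R"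
proof -
  assume "s \<le> r"
  then have "2 * (Suc s * R) \<le> 2 * (Suc r * R)" by (intro mult_le_mono2 mult_le_mono1) simp
  then show "2 * (Suc s * R) \<le> inj_radius r R"
    unfolding inj_radius_def by (rule le_trans) (rule max.cobounded2)
qed (simp add: inj_radius_def)

lemma ball_set_good: "ball_set (good_edges r R k) s t =
  {x \<in> space M. lab_col (label r R k x) \<noteq> 0 \<and> rooted_iso (graph_ball s
     (decoded_graph (space M) (good_tree (inj_radius r R) k) (label r R k) R) x, x) t}"
  unfolding ball_set_def decoded_good label_sels \<kappa>_V using V_space by blast

lemma ball_set_good_sets: "s \<le> r \<Longrightarrow> ball_set (good_edges r R k) s t \<in> sets M"
  unfolding ball_set_good
  by (rule decoded_ball_measurable[OF good_tree(1,2,5) fin_label inj_walks_label inj_radius(2)])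

lemma good_approximable:
  assumes "0 < \<epsilon>"
  obtains H :: "nat cgraph" where "finite (verts H)" "verts H \<noteq> {}" "colored_graph c H"
    "max_degree_le (verts H) (edges H) d"
    "\<And>s t. s \<le> r \<Longrightarrow> \<bar>measure_pmf.prob (pmf_of_set (verts H)) {u. rooted_iso (graph_ball s H u, u) t} -
       prob (ball_set (good_edges r R k) s t) / prob V\<bar> \<le> \<epsilon>"
proof -
  let ?T = "good_tree (inj_radius r R) k" and ?p = "label r R k" and ?N = "inj_radius r R"
  have nbs: "lab_part (?p x) \<notin> lab_nbs (?p x)" for x
  proof
    assume "lab_part (?p x) \<in> lab_nbs (?p x)"
    then obtain y where y: "(x, y) \<in> good_edges r R k" "code k x = code k y" by auto
    then obtain j where j: "j \<le> R" "(x, y) \<in> ?T ^^ j" by (auto simp: good_edges_def walks_iff)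
    moreover have "j \<le> ?N" using j by (simp add: inj_radius_def)
    ultimately have "x = y" using good_tree_inj y(2) by blast
    then have "(x, x) \<in> F" using y(1) good_edges(2)[of r R k] by blast
    then show False using F(4) by (simp add: irrefl_def)
  qed
  have card: "card (lab_nbs (?p x)) \<le> d" for x
  proof -
    have "card (lab_nbs (?p x)) \<le> card (good_edges r R k `` {x})"
      using finite_nbs by (simp add: card_image_le)
    also have "\<dots> \<le> card (F `` {x})"
      using F(5) Image_mono[OF good_edges(2) order_refl] by (intro card_mono) (simp_all add: locally_finite_def)
    finally show ?thesis using F_deg[of x] by linarith
  qed
  have col: "lab_col (?p x) \<le> c" for x using \<kappa>(2) \<kappa>(3)[of x] by (cases "x \<in> V") (auto simp: image_subset_iff)
  have VV: "{x \<in> space M. lab_col (?p x) \<noteq> 0} = V"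
    unfolding label_sels \<kappa>_V using V_space by blast
  have pos: "0 < prob {x \<in> space M. lab_col (?p x) \<noteq> 0}" unfolding VV by (rule V(2))
  show ?thesis
    by (rule decoded_graph_approximable[OF prob_space_axioms good_tree(1-6) fin_label inj_walks_label
        inj_radius(1)[of r R] inj_radius(2)[of r r R, OF order_refl] assms nbs card col pos])
      (rule that, assumption, assumption, assumption, assumption, simp only: ball_set_good VV)
qed

section \<open>Exceptional points of the two truncations\<close>

lemma ball_eq:
  assumes E: "E \<subseteq> F" and x: "x \<in> V" "x \<notin> bad r E" and "s \<le> r"
  shows "graph_ball s (cgraph_of F) x = graph_ball s (cgraph_of E) x"
proof -
  have xM: "x \<in> space M" using x V_space by blast
  have edge: "(y, z) \<in> E" if "(x, y) \<in> F ^^ j" "j \<le> r" "(y, z) \<in> F" for y z j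
  proof (rule ccontr)
    assume "(y, z) \<notin> E"
    then have "(y, z) \<in> F - E" using that by simp
    moreover have "(x, y) \<in> walks F r" using that xM unfolding walks_iff by blast
    ultimately have "x \<in> bad r E" unfolding bad_def by blast
    then show False using x by simp
  qed
  have pow: "(x, y) \<in> F ^^ j \<longleftrightarrow> (x, y) \<in> E ^^ j" if "j \<le> r" for y j
  proof
    assume "(x, y) \<in> F ^^ j"
    then show "(x, y) \<in> E ^^ j" using that
    proof (induction j arbitrary: y)
      case (Suc j)
      obtain z where "(x, z) \<in> F ^^ j" "(z, y) \<in> F" using Suc.prems(1) by auto
      have "(x, z) \<in> E ^^ j" using Suc.IH[OF \<open>(x, z) \<in> F ^^ j\<close>] Suc.prems by simp
      moreover have "(z, y) \<in> E"
        using edge[OF \<open>(x, z) \<in> F ^^ j\<close> _ \<open>(z, y) \<in> F\<close>] Suc.prems by simp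
      ultimately show ?case by (rule relpow_Suc_I)
    qed simp
  next
    assume "(x, y) \<in> E ^^ j"
    then show "(x, y) \<in> F ^^ j" by (rule relpow_subset[OF E])
  qed
  let ?B = "{u \<in> V. \<exists>k\<le>s. (x, u) \<in> F ^^ k}"
  have "(\<exists>k\<le>s. (x, u) \<in> E ^^ k) \<longleftrightarrow> (\<exists>k\<le>s. (x, u) \<in> F ^^ k)" for u
    using pow[OF le_trans[OF _ \<open>s \<le> r\<close>]] by (auto cong: conj_cong)
  then have B: "{u \<in> V. \<exists>k\<le>s. (x, u) \<in> E ^^ k} = ?B" by simp
  have "(y, z) \<in> E" if yz: "(y, z) \<in> F" "y \<in> ?B" for y z
  proof -
    obtain j where j: "j \<le> s" "(x, y) \<in> F ^^ j" using yz(2) by blast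
    show ?thesis by (rule edge[OF j(2) le_trans[OF j(1) \<open>s \<le> r\<close>] yz(1)])
  qed
  then have "F \<inter> ?B \<times> ?B = E \<inter> ?B \<times> ?B" using E by blast
  then show ?thesis using B by (simp add: graph_ball_def cgraph_of_def Let_def)
qed

lemma bad_sets: "graph_union M E \<Longrightarrow> bad r E \<in> sets M"
  unfolding bad_def by (intro graph_union_Domain graph_union_relcomp graph_union_walks graph_union_Diff F diag)

lemma finite_reach: "locally_finite E \<Longrightarrow> finite {y. \<exists>j\<le>r. (x, y) \<in> E ^^ j}"
proof -
  assume "locally_finite E"
  then have "finite (\<Union>j\<le>r. (E ^^ j) `` {x})" by (simp add: finite_relpow_Image)
  moreover have "{y. \<exists>j\<le>r. (x, y) \<in> E ^^ j} = (\<Union>j\<le>r. (E ^^ j) `` {x})" by auto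
  ultimately show ?thesis by simp
qed

text \<open>Only the finitely many points within \<open>N\<close> steps matter, and finitely many
  bits separate them from \<open>x\<close>.\<close>

lemma eventually_not_non_inj:
  assumes "x \<in> space M"
  shows "\<forall>\<^sub>F k in sequentially. x \<notin> non_inj N k"
proof -
  let ?Y = "{y. \<exists>j\<le>N. (x, y) \<in> T ^^ j}"
  have "\<forall>\<^sub>F k in sequentially. x = y \<or> code k x \<noteq> code k y" if "y \<in> ?Y" for y
  proof (cases "x = y")
    case False
    have "y \<in> space M" using that relpow_carrier[OF graph_union_space[OF T(1)] assms] by blast
    then obtain i where "b i x \<noteq> b i y" using b_separates assms False by blast
    then show ?thesis unfolding eventually_sequentially bit_code_eq_iff
      by (intro exI[of _ "Suc i"]) (auto simp: Suc_le_eq)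
  qed simp
  then have "\<forall>\<^sub>F k in sequentially. \<forall>y\<in>?Y. x = y \<or> code k x \<noteq> code k y"
    using finite_reach[OF T(5)] by (intro eventually_ball_finite) auto
  then show ?thesis
    by eventually_elim (auto simp: non_inj_def walks_iff)
qed

lemma eventually_good_walk:
  assumes "(x, y) \<in> T ^^ j" "x \<in> space M"
  shows "\<forall>\<^sub>F k in sequentially. (x, y) \<in> good_tree N k ^^ j"
  using assms(1)
proof (induction j arbitrary: y)
  case (Suc j)
  then obtain z where z: "(x, z) \<in> T ^^ j" "(z, y) \<in> T" by auto
  have "z \<in> space M" "y \<in> space M" using z(2) graph_union_space[OF T(1)] by auto
  from Suc.IH[OF z(1)] eventually_not_non_inj[OF this(1), of N] eventually_not_non_inj[OF this(2), of N]
  show ?case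
  proof eventually_elim
    case (elim k)
    then have "(z, y) \<in> good_tree N k" using z(2) \<open>z \<in> space M\<close> \<open>y \<in> space M\<close> by (simp add: good_tree_def)
    then show ?case using elim(1) by (rule relpow_Suc_I[rotated])
  qed
qed simp

definition short_edges :: "nat \<Rightarrow> 'v rel" where "short_edges R = F \<inter> walks T R"

lemma graph_union_short_edges: "graph_union M (short_edges R)"
proof -
  have "short_edges R = F - (F - walks T R)" by (auto simp: short_edges_def)
  then show ?thesis by (simp add: graph_union_Diff graph_union_walks T F diag)
qed

lemma not_badI: "(\<And>y z j. j \<le> r \<Longrightarrow> (x, y) \<in> F ^^ j \<Longrightarrow> (y, z) \<in> F \<Longrightarrow> (y, z) \<in> E) \<Longrightarrow> x \<notin> bad r E"
  by (auto simp: bad_def walks_iff)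

text \<open>Local finiteness of \<open>F\<close> leaves only finitely many edges within reach of
  \<open>x\<close> that have to appear.\<close>

lemma eventually_edges_not_bad:
  assumes "\<And>y z j. j \<le> r \<Longrightarrow> (x, y) \<in> F ^^ j \<Longrightarrow> (y, z) \<in> F \<Longrightarrow> \<forall>\<^sub>F n in sequentially. (y, z) \<in> E n"
  shows "\<exists>n0. \<forall>n\<ge>n0. x \<notin> bad r (E n)"
proof -
  let ?P = "\<Union>y\<in>{y. \<exists>j\<le>r. (x, y) \<in> F ^^ j}. {y} \<times> F `` {y}"
  have "finite ?P" using finite_reach[OF F(5)] F(5) by (auto simp: locally_finite_def)
  moreover have "\<forall>p\<in>?P. \<forall>\<^sub>F n in sequentially. p \<in> E n" using assms by auto
  ultimately have "\<forall>\<^sub>F n in sequentially. \<forall>p\<in>?P. p \<in> E n" by (rule eventually_ball_finite)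
  then have "\<forall>\<^sub>F n in sequentially. x \<notin> bad r (E n)"
    by eventually_elim (rule not_badI, auto)
  then show ?thesis by (simp add: eventually_sequentially)
qed

text \<open>The ends of an edge of \<open>F\<close> are joined by some walk in \<open>T\<close>,
  whose finite length \<open>n\<close> eventually reaches.\<close>

lemma eventually_not_bad_short:
  shows "\<exists>n0. \<forall>n\<ge>n0. x \<notin> bad r (short_edges n)"
proof (rule eventually_edges_not_bad)
  fix y z assume yz: "(y, z) \<in> F"
  then obtain j where j: "(y, z) \<in> T ^^ j" using FT rtrancl_power by blast
  have "y \<in> space M" using yz F(2) V_space by blast
  then show "\<forall>\<^sub>F n in sequentially. (y, z) \<in> short_edges n"
    using yz j unfolding eventually_sequentially short_edges_def by (auto simp: walks_iff)
qed

text \<open>Points that see an edge longer than \<open>R\<close> are excluded by assumption. The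
  others see finitely many short edges, and the corresponding walks avoid \<open>non_inj\<close>
  once the partition is fine enough.\<close>

lemma eventually_not_bad_good:
  assumes "x \<in> space M" "x \<notin> bad r (short_edges R)"
  shows "\<exists>n0. \<forall>n\<ge>n0. x \<notin> bad r (good_edges r R n)"
proof (rule eventually_edges_not_bad)
  fix y z j assume j: "j \<le> r" "(x, y) \<in> F ^^ j" and yz: "(y, z) \<in> F"
  have "(y, z) \<in> short_edges R"
  proof (rule ccontr)
    assume "(y, z) \<notin> short_edges R"
    then have "(y, z) \<in> F - short_edges R" using yz by simp
    moreover have "(x, y) \<in> walks F r" using assms(1) j unfolding walks_iff by blast
    ultimately have "x \<in> bad r (short_edges R)" unfolding bad_def by blast
    then show False using assms(2) by simp
  qed
  then obtain i where i: "i \<le> R" "(y, z) \<in> T ^^ i" "y \<in> space M" by (auto simp: short_edges_def walks_iff)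
  from eventually_good_walk[OF i(2,3)]
  show "\<forall>\<^sub>F n in sequentially. (y, z) \<in> good_edges r R n"
    by eventually_elim (use i yz in \<open>auto simp: good_edges_def walks_iff\<close>)
qed

lemma ball_set_agree:
  assumes "E \<subseteq> F" "s \<le> r" "x \<notin> bad r E"
  shows "x \<in> ball_set F s t \<longleftrightarrow> x \<in> ball_set E s t"
  using ball_eq[OF assms(1) _ assms(3,2)] by (auto simp: ball_set_def)

text \<open>Membership in \<open>ball_set F s t\<close> is the iterated limit of membership in the sets of the good edges.\<close>

lemma ball_set_sets: "ball_set F s t \<in> sets M"
proof -
  have "x \<in> ball_set F s t \<longleftrightarrow> (\<exists>R0. \<forall>R. R0 \<le> R \<longrightarrow> (\<exists>k0. \<forall>k. k0 \<le> k \<longrightarrow> x \<in> ball_set (good_edges s R k) s t))"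
    if x: "x \<in> space M" for x
  proof -
    obtain R0 where "\<forall>R\<ge>R0. x \<notin> bad s (short_edges R)" using eventually_not_bad_short ..
    then have R0: "x \<notin> bad s (short_edges R)" if "R \<ge> R0" for R using that by simp
    have "\<exists>k0. \<forall>k\<ge>k0. x \<in> ball_set F s t \<longleftrightarrow> x \<in> ball_set (good_edges s R k) s t" if R: "R \<ge> R0" for R
    proof -
      obtain k0 where "\<forall>k\<ge>k0. x \<notin> bad s (good_edges s R k)" using eventually_not_bad_good[OF x R0[OF R]] ..
      then have "\<forall>k\<ge>k0. x \<in> ball_set F s t \<longleftrightarrow> x \<in> ball_set (good_edges s R k) s t"
        using ball_set_agree[OF good_edges(2) order_refl] by simp
      then show ?thesis ..
    qed
    then have "\<forall>R. \<exists>k0. R \<ge> R0 \<longrightarrow> (\<forall>k\<ge>k0. x \<in> ball_set F s t \<longleftrightarrow> x \<in> ball_set (good_edges s R k) s t)" by simp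
    from choice[OF this]
    obtain k0 where k0: "\<And>R k. R \<ge> R0 \<Longrightarrow> k \<ge> k0 R \<Longrightarrow> x \<in> ball_set F s t \<longleftrightarrow> x \<in> ball_set (good_edges s R k) s t"
      by blast
    show ?thesis
    proof
      assume "x \<in> ball_set F s t"
      then show "\<exists>R0. \<forall>R. R0 \<le> R \<longrightarrow> (\<exists>k0. \<forall>k. k0 \<le> k \<longrightarrow> x \<in> ball_set (good_edges s R k) s t)"
        using k0 by (intro exI[of _ R0] allI impI exI[of _ "k0 _"]) simp
    next
      assume "\<exists>R0. \<forall>R. R0 \<le> R \<longrightarrow> (\<exists>k0. \<forall>k. k0 \<le> k \<longrightarrow> x \<in> ball_set (good_edges s R k) s t)"
      then obtain R1 where R1: "\<And>R. R1 \<le> R \<Longrightarrow> \<exists>k0. \<forall>k. k0 \<le> k \<longrightarrow> x \<in> ball_set (good_edges s R k) s t" by blast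
      let ?R = "max R0 R1"
      obtain k1 where k1: "\<And>k. k1 \<le> k \<Longrightarrow> x \<in> ball_set (good_edges s ?R k) s t" using R1[of ?R] by auto
      show "x \<in> ball_set F s t"
        using k0[of ?R "max (k0 ?R) k1"] k1[of "max (k0 ?R) k1"] by simp
    qed
  qed
  moreover have "ball_set F s t \<subseteq> space M" using V_space by (auto simp: ball_set_def)
  ultimately have "ball_set F s t = {x \<in> space M. \<exists>R0. \<forall>R. R0 \<le> R \<longrightarrow> (\<exists>k0. \<forall>k. k0 \<le> k \<longrightarrow> x \<in> ball_set (good_edges s R k) s t)}"
    by blast
  also have "\<dots> \<in> sets M"
  proof -
    have [measurable]: "ball_set (good_edges s R k) s t \<in> sets M" for R k by (rule ball_set_good_sets) simp
    show ?thesis by measurable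
  qed
  finally show ?thesis .
qed

theorem approximable:
  assumes "0 < \<epsilon>"
  shows "\<exists>H :: nat cgraph. finite (verts H) \<and> verts H \<noteq> {} \<and> colored_graph c H \<and>
    max_degree_le (verts H) (edges H) d \<and>
    (\<forall>s\<le>r. \<forall>t. \<bar>measure_pmf.prob (pmf_of_set (verts H)) {u. rooted_iso (graph_ball s H u, u) t} -
       prob (ball_set F s t) / prob V\<bar> \<le> \<epsilon>)"
proof -
  \<comment> \<open>Half of \<open>\<epsilon>\<close> goes to the finite model, half to the bad
    points. These have measure at most \<open>2 * \<delta>\<close>, one \<open>\<delta>\<close> for
    edges longer than \<open>R\<close> and one for edges lost to the partition; dividing by
    \<open>prob V\<close> gives \<open>\<epsilon> / 2\<close>.\<close>
  define \<delta> where "\<delta> = \<epsilon> * prob V / 4"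
  have \<delta>: "0 < \<delta>" using assms V(2) by (simp add: \<delta>_def)
  obtain R where R: "prob (bad r (short_edges R)) \<le> \<delta>"
    using measure_eventually_small[of "\<lambda>R. bad r (short_edges R)" "{}" \<delta>] bad_sets[OF graph_union_short_edges]
      eventually_not_bad_short \<delta> by auto
  \<comment> \<open>For fixed \<open>R\<close> no refinement of the partition restores the edges
    longer than \<open>R\<close>, so the limiting exceptional set is that of
    \<open>short_edges R\<close> instead of the empty set.\<close>
  have "\<exists>n0. \<forall>n\<ge>n0. prob (bad r (good_edges r R n)) \<le> prob (bad r (short_edges R)) + \<delta>"
    by (rule measure_eventually_small[OF bad_sets[OF good_edges(1)] bad_sets[OF graph_union_short_edges]
        eventually_not_bad_good \<delta>])
  then obtain k where "\<forall>n\<ge>k. prob (bad r (good_edges r R n)) \<le> prob (bad r (short_edges R)) + \<delta>" ..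
  then have "prob (bad r (good_edges r R k)) \<le> prob (bad r (short_edges R)) + \<delta>" by simp
  then have k: "prob (bad r (good_edges r R k)) \<le> 2 * \<delta>" using R by simp
  let ?E = "good_edges r R k"
  obtain H :: "nat cgraph" where H: "finite (verts H)" "verts H \<noteq> {}" "colored_graph c H"
    "max_degree_le (verts H) (edges H) d"
    and Hb: "\<And>s t. s \<le> r \<Longrightarrow> \<bar>measure_pmf.prob (pmf_of_set (verts H)) {u. rooted_iso (graph_ball s H u, u) t} -
       prob (ball_set ?E s t) / prob V\<bar> \<le> \<epsilon> / 2"
    by (rule good_approximable[of "\<epsilon> / 2" r R k]) (use assms in simp, (rule that; assumption))
  have "\<bar>measure_pmf.prob (pmf_of_set (verts H)) {u. rooted_iso (graph_ball s H u, u) t} -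
       prob (ball_set F s t) / prob V\<bar> \<le> \<epsilon>" if s: "s \<le> r" for s t
  proof -
    have b: "bad r ?E \<in> sets M" by (rule bad_sets[OF good_edges(1)])
    have agree: "x \<in> ball_set F s t \<longleftrightarrow> x \<in> ball_set ?E s t" if "x \<notin> bad r ?E" for x
      by (rule ball_set_agree[OF good_edges(2) s that])
    have "prob (ball_set F s t) \<le> prob (ball_set ?E s t \<union> bad r ?E)"
      using agree ball_set_good_sets[OF s] b by (intro finite_measure_mono subsetI sets.Un) blast+
    also have "\<dots> \<le> prob (ball_set ?E s t) + prob (bad r ?E)"
      using ball_set_good_sets[OF s] b by (rule measure_Un_le)
    finally have 1: "prob (ball_set F s t) \<le> prob (ball_set ?E s t) + 2 * \<delta>" using k by linarith
    have "prob (ball_set ?E s t) \<le> prob (ball_set F s t \<union> bad r ?E)"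
      using agree ball_set_sets b by (intro finite_measure_mono subsetI sets.Un) blast+
    also have "\<dots> \<le> prob (ball_set F s t) + prob (bad r ?E)"
      using ball_set_sets b by (rule measure_Un_le)
    finally have 2: "prob (ball_set ?E s t) \<le> prob (ball_set F s t) + 2 * \<delta>" using k by linarith
    have "\<bar>prob (ball_set ?E s t) / prob V - prob (ball_set F s t) / prob V\<bar> =
        \<bar>prob (ball_set ?E s t) - prob (ball_set F s t)\<bar> / prob V"
      using V(2) by (simp add: diff_divide_distrib[symmetric])
    also have "\<dots> \<le> 2 * \<delta> / prob V" using 1 2 V(2) by (intro divide_right_mono) auto
    also have "\<dots> = \<epsilon> / 2" using V(2) by (simp add: \<delta>_def)
    finally show ?thesis using Hb[OF s, of t] by linarith
  qed
  then show ?thesis using H by blast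
qed

end

section \<open>Weakly treeable graphings\<close>

lemma graph_ball_image_iso:
  fixes e :: "'v \<Rightarrow> 'w"
  assumes inj: "inj_on e X" and E: "E \<subseteq> X \<times> X" and x: "x \<in> X" and col: "\<And>y. y \<in> X \<Longrightarrow> \<kappa>' (e y) = \<kappa> y"
  shows "rooted_iso (graph_ball s \<lparr>verts = X, edges = E, color = \<kappa>\<rparr> x, x)
    (graph_ball s \<lparr>verts = e ` X, edges = map_prod e e ` E, color = \<kappa>'\<rparr> (e x), e x)"
proof -
  let ?F = "map_prod e e ` E"
  have edge: "(e y, e z) \<in> ?F \<longleftrightarrow> (y, z) \<in> E" if "y \<in> X" "z \<in> X" for y z
    using inj_on_image_mem_iff[OF map_prod_inj_on[OF inj inj], of "(y, z)" E] E that by simp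
  have walk: "(e x, w) \<in> ?F ^^ k \<longleftrightarrow> (\<exists>y\<in>X. w = e y \<and> (x, y) \<in> E ^^ k)" for w k
  proof (induction k arbitrary: w)
    case (Suc k)
    show ?case
    proof
      assume "(e x, w) \<in> ?F ^^ Suc k"
      then obtain v where v: "(e x, v) \<in> ?F ^^ k" "(v, w) \<in> ?F" by auto
      from v(2) obtain y z where yz: "(y, z) \<in> E" "v = e y" "w = e z" by auto
      obtain y' where y': "y' \<in> X" "v = e y'" "(x, y') \<in> E ^^ k" using Suc.IH v(1) by blast
      have "y = y'" using inj_onD[OF inj, of y y'] y' yz E by auto
      then show "\<exists>y\<in>X. w = e y \<and> (x, y) \<in> E ^^ Suc k" using yz y' E by (intro bexI[of _ z]) auto
    next
      assume "\<exists>y\<in>X. w = e y \<and> (x, y) \<in> E ^^ Suc k"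
      then obtain y z where "y \<in> X" "w = e y" "(x, z) \<in> E ^^ k" "(z, y) \<in> E" by auto
      moreover from this have "(e x, e z) \<in> ?F ^^ k" using Suc.IH[of "e z"] E by blast
      ultimately show "(e x, w) \<in> ?F ^^ Suc k" by (auto intro!: relcompI[of _ "e z"] rev_image_eqI)
    qed
  qed (use x in auto)
  let ?G = "\<lparr>verts = X, edges = E, color = \<kappa>\<rparr>" and ?H = "\<lparr>verts = e ` X, edges = ?F, color = \<kappa>'\<rparr>"
  define B where "B = {y \<in> X. \<exists>k\<le>s. (x, y) \<in> E ^^ k}"
  have BG: "verts (graph_ball s ?G x) = B" by (simp add: B_def graph_ball_def Let_def)
  have BX: "B \<subseteq> X" by (auto simp: B_def)
  have BH: "verts (graph_ball s ?H (e x)) = e ` B"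
  proof (rule set_eqI)
    fix w
    have "w \<in> verts (graph_ball s ?H (e x)) \<longleftrightarrow> w \<in> e ` X \<and> (\<exists>k\<le>s. \<exists>y\<in>X. w = e y \<and> (x, y) \<in> E ^^ k)"
      by (simp add: graph_ball_def Let_def walk)
    also have "\<dots> \<longleftrightarrow> w \<in> e ` B" unfolding B_def by blast
    finally show "w \<in> verts (graph_ball s ?H (e x)) \<longleftrightarrow> w \<in> e ` B" .
  qed
  show ?thesis
    unfolding rooted_iso_def prod.case BG BH
  proof (intro exI[of _ e] conjI ballI)
    show "bij_betw e B (e ` B)" using inj BX by (auto simp: bij_betw_def intro: inj_on_subset)
    fix y z assume yz: "y \<in> B" "z \<in> B"
    then have "y \<in> X" "z \<in> X" using BX by auto
    then show "(y, z) \<in> edges (graph_ball s ?G x) \<longleftrightarrow> (e y, e z) \<in> edges (graph_ball s ?H (e x))"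
      unfolding edges_graph_ball BG BH using edge yz by simp
  next
    fix y assume "y \<in> B"
    then show "color (graph_ball s ?H (e x)) (e y) = color (graph_ball s ?G x) y"
      using BX col by (auto simp: graph_ball_def Let_def)
  qed simp
qed

text \<open>The functions are conjugated by \<open>e\<close>, with its inverse extended by a
  constant off the image. The extended inverse is Borel because \<open>e\<close> maps Borel sets to
  Borel sets.\<close>

lemma graph_union_image:
  fixes M :: "'v measure" and L :: "'w measure"
  assumes gu: "graph_union M E" and inj: "inj_on e (space M)" and e: "e \<in> measurable M L"
    and eY: "\<And>Y. Y \<in> sets M \<Longrightarrow> e ` Y \<in> sets L" and ne: "space M \<noteq> {}"
  shows "graph_union L (map_prod e e ` E)"
proof -
  obtain x0 where x0: "x0 \<in> space M" using ne by auto
  define h where "h w = (if w \<in> e ` space M then inv_into (space M) e w else x0)" for w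
  have he: "h (e x) = x" if "x \<in> space M" for x using that inj by (simp add: h_def)
  have hM: "h w \<in> space M" for w using x0 by (auto simp: h_def inv_into_into)
  have h: "h \<in> measurable L M"
  proof (rule measurableI)
    fix Y assume Y: "Y \<in> sets M"
    have Ysp: "Y \<subseteq> space M" using sets.sets_into_space[OF Y] .
    have "h -` Y \<inter> space L = e ` Y \<union> (if x0 \<in> Y then space L - e ` space M else {})" (is "?A = ?B")
    proof (rule set_eqI)
      fix w
      show "w \<in> ?A \<longleftrightarrow> w \<in> ?B"
      proof (cases "w \<in> e ` space M")
        case True
        then obtain x where x: "x \<in> space M" "w = e x" by auto
        then have "w \<in> space L" using measurable_space[OF e] by simp
        then show ?thesis using x he Ysp inj_on_image_mem_iff[OF inj x(1) Ysp] by simp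
      next
        case False
        then show ?thesis using Ysp by (auto simp: h_def)
      qed
    qed
    then show "h -` Y \<inter> space L \<in> sets L" using eY[OF Y] eY[OF sets.top[of M]] by simp
  qed (rule hM)
  obtain g D where g: "\<And>n::nat. g n \<in> measurable M M" "\<And>n. D n \<in> sets M"
    "\<And>x y. (x, y) \<in> E \<longleftrightarrow> (\<exists>n. x \<in> D n \<and> y = g n x)"
    by (rule graph_unionE[OF gu]) (rule that; assumption)
  have Dsp: "D n \<subseteq> space M" for n using sets.sets_into_space[OF g(2)] .
  show ?thesis
  proof (rule graph_unionI'[of "\<lambda>n w. e (g n (h w))" L "\<lambda>n. e ` D n"])
    show "(\<lambda>w. e (g n (h w))) \<in> measurable L L" for n
      by (rule measurable_compose[OF measurable_compose[OF h g(1)] e])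
    show "e ` D n \<in> sets L" for n by (rule eY[OF g(2)])
    fix w v
    have "(w, v) \<in> map_prod e e ` E \<longleftrightarrow> (\<exists>x y. (x, y) \<in> E \<and> w = e x \<and> v = e y)" by auto
    also have "\<dots> \<longleftrightarrow> (\<exists>n. \<exists>x\<in>D n. w = e x \<and> v = e (g n x))" unfolding g(3) by blast
    also have "\<dots> \<longleftrightarrow> (\<exists>n. w \<in> e ` D n \<and> v = e (g n (h w)))"
    proof -
      have "(\<exists>x\<in>D n. w = e x \<and> v = e (g n x)) \<longleftrightarrow> w \<in> e ` D n \<and> v = e (g n (h w))" for n
        using he Dsp[of n] by (auto simp: subset_iff)
      then show ?thesis by simp
    qed
    finally show "(w, v) \<in> map_prod e e ` E \<longleftrightarrow> (\<exists>n. w \<in> e ` D n \<and> v = e (g n (h w)))" .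
  qed
qed

lemma graphing_graph_union:
  assumes "graphing M E"
  shows "graph_union M E" "locally_finite E"
proof -
  obtain d where d: "max_degree_le (space M) E d" using assms by (auto simp: graphing_def)
  have sb: "standard_borel M" and E: "E \<in> sets (M \<Otimes>\<^sub>M M)" and sg: "simple_graph (space M) E"
    using assms by (auto simp: graphing_def borel_graph_def)
  show "graph_union M E"
    by (rule lusin_novikov[OF sb E]) (use d in \<open>auto simp: max_degree_le_def\<close>)
  show "locally_finite E"
    unfolding locally_finite_def
  proof
    fix x show "finite (E `` {x})"
    proof (cases "x \<in> space M")
      case False
      then have "E `` {x} = {}" using sg by (auto simp: simple_graph_def)
      then show ?thesis by simp
    qed (use d in \<open>auto simp: max_degree_le_def\<close>)
  qed
qed

theorem theorem2:
  fixes M :: "'v measure" and E :: "'v rel" and \<kappa> :: "'v \<Rightarrow> nat" and d c :: nat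
  assumes "colored_graphing c M E \<kappa>"
    and "max_degree_le (space M) E d"
    and "weakly_treeable TYPE('w) M E"
  shows "\<exists>G :: nat \<Rightarrow> nat cgraph.
    (\<forall>n. finite (verts (G n)) \<and> verts (G n) \<noteq> {} \<and> colored_graph c (G n) \<and>
         max_degree_le (verts (G n)) (edges (G n)) d) \<and>
    locally_converges d c G M E \<kappa>"
proof -
  have gr: "graphing M E" and \<kappa>: "\<kappa> \<in> measurable M (count_space {1..c})"
    using assms(1) by (auto simp: colored_graphing_def)
  obtain L :: "'w measure" and T e where treeing: "treeing L T" and inj: "inj_on e (space M)"
    and e: "e \<in> measurable M L" and eY: "\<And>Y. Y \<in> sets M \<Longrightarrow> e ` Y \<in> sets L"
    and pos: "measure L (e ` space M) > 0"
    and meas: "\<And>Y. Y \<in> sets M \<Longrightarrow> measure M Y = measure L (e ` Y) / measure L (e ` space M)"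
    and comp: "\<forall>C\<in>conn_components (space M) E. \<exists>D\<in>conn_components (space L) T. e ` C \<subseteq> D"
    using assms(3) unfolding weakly_treeable_def by (elim exE conjE) (rule that; blast)
  have grT: "graphing L T" and acT: "acyclic_graph T" using treeing by (auto simp: treeing_def)
  interpret L: prob_space L using grT by (simp add: graphing_def)
  interpret M: prob_space M using gr by (simp add: graphing_def)
  have sgE: "E \<subseteq> space M \<times> space M" "sym E" "irrefl E"
    using gr by (auto simp: graphing_def borel_graph_def simple_graph_def)
  have sgT: "T \<subseteq> space L \<times> space L" "sym T" "irrefl T" and sbT: "standard_borel L"
    using grT by (auto simp: graphing_def borel_graph_def simple_graph_def)
  define V where "V = e ` space M"
  have eV: "e x \<in> V" if "x \<in> space M" for x using that by (simp add: V_def)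
  have VE: "\<exists>x\<in>space M. w = e x" if "w \<in> V" for w using that by (auto simp: V_def)
  define F where "F = map_prod e e ` E"
  \<comment> \<open>The colours of the graphing start at 1, so the default \<open>0\<close> can mark
    the points outside \<open>V\<close>.\<close>
  define \<kappa>' where "\<kappa>' w = (if w \<in> V then \<kappa> (inv_into (space M) e w) else 0)" for w
  have \<kappa>'e: "\<kappa>' (e x) = \<kappa> x" if "x \<in> space M" for x using that inj by (simp add: \<kappa>'_def V_def)
  have \<kappa>c: "\<kappa> x \<in> {1..c}" if "x \<in> space M" for x using measurable_space[OF \<kappa> that] by simp
  have FE: "F `` {e x} = e ` (E `` {x})" if "x \<in> space M" for x
    using sgE(1) inj_onD[OF inj _ that] that by (force simp: F_def)
  have F0: "F `` {w} = {}" if "w \<notin> V" for w using sgE(1) that by (auto simp: F_def V_def)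
  have degE: "finite (E `` {x})" "card (E `` {x}) \<le> d" if "x \<in> space M" for x
    using assms(2) that by (auto simp: max_degree_le_def)
  have degF: "finite (F `` {w}) \<and> card (F `` {w}) \<le> d" for w
  proof (cases "w \<in> V")
    case True
    then obtain x where x: "x \<in> space M" "w = e x" by (auto simp: V_def)
    then show ?thesis using FE[OF x(1)] degE[OF x(1)] card_image_le[OF degE(1)[OF x(1)], of e] by simp
  qed (simp add: F0)
  \<comment> \<open>Inclusion of components yields a walk in \<open>T\<close> between the ends of
    each edge, of unknown length.\<close>
  have FT: "F \<subseteq> T\<^sup>*"
  proof
    fix p assume "p \<in> F"
    then obtain x y where p: "p = (e x, e y)" "(x, y) \<in> E" by (auto simp: F_def)
    then have x: "x \<in> space M" using sgE(1) by auto
    have "E\<^sup>* `` {x} \<in> conn_components (space M) E" using x by (auto simp: conn_components_def)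
    then obtain D where D: "D \<in> conn_components (space L) T" "e ` (E\<^sup>* `` {x}) \<subseteq> D" using comp by blast
    then obtain z where "D = T\<^sup>* `` {z}" by (auto simp: conn_components_def)
    then have "(z, e x) \<in> T\<^sup>*" "(z, e y) \<in> T\<^sup>*" using D(2) p(2) by auto
    moreover have "(e x, z) \<in> T\<^sup>*" using \<open>(z, e x) \<in> T\<^sup>*\<close> sym_rtrancl[OF sgT(2)] by (auto dest: symD)
    ultimately show "p \<in> T\<^sup>*" unfolding p(1) by (meson rtrancl_trans)
  qed
  obtain b :: "nat \<Rightarrow> 'w \<Rightarrow> bool" where b: "\<And>i. {x \<in> space L. b i x} \<in> sets L"
    "\<And>x y. x \<in> space L \<Longrightarrow> y \<in> space L \<Longrightarrow> x \<noteq> y \<Longrightarrow> \<exists>i. b i x \<noteq> b i y"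
    by (rule standard_borel_separating_sequence[OF sbT L.not_empty]) (rule that; assumption)
  interpret treed_graph L T F V \<kappa>' d c b
  proof
    show "diagonal_measurable L" using sbT by (rule standard_borel_diagonal)
    show "graph_union L T" "locally_finite T" using graphing_graph_union[OF grT] by auto
    show "mass_transport L T" using grT by (simp add: graphing_def mass_transport_def)
    show "graph_union L F"
      unfolding F_def by (rule graph_union_image[OF graphing_graph_union(1)[OF gr] inj e eY M.not_empty])
    show "F \<subseteq> V \<times> V" using sgE(1) by (auto simp: F_def V_def)
    show "sym F" using sgE(2) by (force simp: F_def sym_def)
    show "irrefl F"
    proof (rule irreflI)
      fix w show "(w, w) \<notin> F"
      proof
        assume "(w, w) \<in> F"
        then obtain x y where xy: "(x, y) \<in> E" "e x = e y" by (auto simp: F_def)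
        then have "x = y" using sgE(1) inj_onD[OF inj] by blast
        then show False using xy(1) sgE(3) by (auto simp: irrefl_def)
      qed
    qed
    show "locally_finite F" using degF by (simp add: locally_finite_def)
    show "card (F `` {w}) \<le> d" for w using degF by simp
    show "V \<in> sets L" unfolding V_def by (rule eY) simp
    show "0 < measure L V" using pos by (simp add: V_def)
    show "{w \<in> V. \<kappa>' w = k} \<in> sets L" for k
    proof -
      have "{w \<in> V. \<kappa>' w = k} = e ` {x \<in> space M. \<kappa> x = k}" using \<kappa>'e by (auto simp: V_def)
      moreover have "{x \<in> space M. \<kappa> x = k} \<in> sets M"
      proof (cases "k \<in> {1..c}")
        case True
        then have "\<kappa> -` {k} \<inter> space M \<in> sets M" by (intro measurable_sets[OF \<kappa>]) simp
        moreover have "\<kappa> -` {k} \<inter> space M = {x \<in> space M. \<kappa> x = k}" by auto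
        ultimately show ?thesis by simp
      next
        case False
        then have empty: "{x \<in> space M. \<kappa> x = k} = {}" using \<kappa>c by auto
        show ?thesis unfolding empty by simp
      qed
      ultimately show ?thesis using eY by simp
    qed
    show "\<kappa>' ` V \<subseteq> {1..c}" using \<kappa>'e \<kappa>c by (auto simp: V_def)
  qed (use sgT acT FT b in \<open>auto simp: \<kappa>'_def\<close>)
  let ?G = "\<lparr>verts = space M, edges = E, color = \<kappa>\<rparr>"
  let ?Q = "\<lambda>s t. {x \<in> space M. rooted_iso (graph_ball s ?G x, x) t}"
  have iso: "rooted_iso (graph_ball s ?G x, x) t \<longleftrightarrow> e x \<in> ball_set F s t" if x: "x \<in> space M" for s t x
  proof -
    have "rooted_iso (graph_ball s ?G x, x) (graph_ball s (cgraph_of F) (e x), e x)"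
      unfolding cgraph_of_def unfolding V_def F_def by (rule graph_ball_image_iso[OF inj sgE(1) x]) (rule \<kappa>'e)
    moreover have "x \<in> verts (graph_ball s ?G x)" using x by (intro root_in_ball) simp
    ultimately have "rooted_iso (graph_ball s ?G x, x) t \<longleftrightarrow> rooted_iso (graph_ball s (cgraph_of F) (e x), e x) t"
      by (rule rooted_iso_cong)
    then show ?thesis using eV[OF x] by (simp add: ball_set_def)
  qed
  \<comment> \<open>The measure of the graphing is that of the treeing conditioned on
    \<open>V\<close>, so ball probabilities become the ratios that \<open>approximable\<close>
    handles.\<close>
  have Q: "measure M (?Q s t) = measure L (ball_set F s t) / measure L V" for s t
  proof -
    have "?Q s t = e -` ball_set F s t \<inter> space M" using iso by blast
    then have Q_sets: "?Q s t \<in> sets M" using measurable_sets[OF e ball_set_sets] by simp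
    have img: "e ` ?Q s t = ball_set F s t"
    proof (intro set_eqI iffI)
      fix w assume w: "w \<in> ball_set F s t"
      then have "w \<in> V" by (simp add: ball_set_def)
      then obtain x where "x \<in> space M" "w = e x" using VE by blast
      then show "w \<in> e ` ?Q s t" using iso w by blast
    qed (use iso in blast)
    show ?thesis using meas[OF Q_sets, folded V_def] unfolding img .
  qed
  \<comment> \<open>A diagonal choice: the graph with index \<open>n\<close> is accurate up to
    \<open>1/(n + 1)\<close> for all radii up to \<open>n\<close>, so every fixed radius is
    eventually covered.\<close>
  define approx where "approx n H \<longleftrightarrow> finite (verts H) \<and> verts H \<noteq> {} \<and> colored_graph c H \<and>
    max_degree_le (verts H) (edges H) d \<and>
    (\<forall>s\<le>n. \<forall>t :: nat cgraph \<times> nat. \<bar>measure_pmf.prob (pmf_of_set (verts H)) {u. rooted_iso (graph_ball s H u, u) t} -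
       measure M (?Q s t)\<bar> \<le> inverse (real (Suc n)))" for n and H :: "nat cgraph"
  have "\<exists>H. approx n H" for n
    unfolding approx_def Q by (rule approximable) simp
  then obtain H where approx: "\<And>n. approx n (H n)" by metis
  have H: "finite (verts (H n)) \<and> verts (H n) \<noteq> {} \<and> colored_graph c (H n) \<and>
      max_degree_le (verts (H n)) (edges (H n)) d" for n
    using approx[of n] unfolding approx_def by (elim conjE) (intro conjI)
  have Hb: "\<bar>measure_pmf.prob (pmf_of_set (verts (H n))) {u. rooted_iso (graph_ball s (H n) u, u) t} -
       measure M (?Q s t)\<bar> \<le> inverse (real (Suc n))" if "s \<le> n" for n s and t :: "nat cgraph \<times> nat"
    using approx[of n] that unfolding approx_def by blast
  have lim: "(\<lambda>n. measure_pmf.prob (pmf_of_set (verts (H n))) {u. rooted_iso (graph_ball s (H n) u, u) t})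
      \<longlonglongrightarrow> measure M (?Q s t)" for s and t :: "nat cgraph \<times> nat"
  proof (rule LIM_zero_cancel, rule Lim_null_comparison[OF _ LIMSEQ_inverse_real_of_nat])
    show "\<forall>\<^sub>F n in sequentially. norm (measure_pmf.prob (pmf_of_set (verts (H n))) {u. rooted_iso (graph_ball s (H n) u, u) t} -
        measure M (?Q s t)) \<le> inverse (real (Suc n))"
      unfolding eventually_sequentially real_norm_def using Hb by blast
  qed
  have "locally_converges d c H M E \<kappa>"
    unfolding locally_converges_def Let_def using lim by blast
  then show ?thesis using H by blast
qed

end
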